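(* Let $(\Gamma,\alpha,\theta,\lambda)$ be a $d$-valent 1-skeleton in $\mathbb{R}^n$ satisfying the acyclicity axiom. Then $(\Gamma,\alpha,\theta,\lambda)$ has the Morse package if and only if every $2$-slice of $(\Gamma,\alpha,\theta,\lambda)$ has the Morse package.
   Context: A graph $\Gamma$ consists of a finite vertex set $V_\Gamma$ and a set $E_\Gamma$ of oriented edges (ordered pairs $pq$ of distinct vertices, with $pq\in E_\Gamma$ iff $qp\in E_\Gamma$); $E^p$ denotes the set of oriented edges with initial vertex $p$. Graphs are connected and $d$-valent ($|E^p|=d$ for all $p$). A connection $\theta$ is a family of bijections $\theta_{pq}\colon E^p\to E^q$ ($pq\in E_\Gamma$) with $\theta_{pq}(pq)=qp$ and $\theta_{qp}=\theta_{pq}^{-1}$. An axial function compatible with $\theta$ is a map $\alpha\colon E_\Gamma\to\mathbb{R}^n$ such that (A1) for each $p$ the vectors $\alpha(e)$, $e\in E^p$, are pairwise linearly independent; (A2) $\alpha(qp)=-\alpha(pq)$; (A3) for every $pq\in E_\Gamma$ and $e\in E^p$ there is a real number $\lambda_{pq}(e)>0$ with $\alpha(e)-\lambda_{pq}(e)\alpha(\theta_{pq}(e))\in\mathbb{R}\alpha(pq)$. The quadruple $(\Gamma,\alpha,\theta,\lambda)$ is a $d$-valent 1-skeleton in $\mathbb{R}^n$. A subskeleton is a connected subgraph $\Gamma_0=(V_0,E_0)$ of constant valency such that $\theta_{pq}(E^p_0)=E^q_0$ for all $pq\in E_0$ (where $E^p_0=E^p\cap E_0$), with the restricted $\alpha,\theta,\lambda$;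 it is itself a 1-skeleton. For a $2$-dimensional linear subspace $H\subseteq\mathbb{R}^n$, let $E_H=\{e\in E_\Gamma:\alpha(e)\in H\}$; a $2$-slice is a connected component of the subgraph of $\Gamma$ with edge set $E_H$ (vertices: endpoints of these edges), regarded as a subskeleton. Let $S=\mathrm{Sym}(\mathbb{R}^n)$, a polynomial ring graded with $\mathbb{R}^n$ in degree $1$. The equivariant cohomology of a 1-skeleton is $H(\Gamma,\alpha)=\{f\colon V_\Gamma\to S:\ f(q)-f(p)\in\alpha(pq)S\ \forall pq\in E_\Gamma\}$, a graded $S$-algebra under pointwise operations. A covector $\xi\in(\mathbb{R}^n)^*$ is polarizing if $\langle\xi,\alpha(e)\rangle\neq0$ for all $e$; it orients $\Gamma$ by selecting, from each pair $pq,qp$, the one with $\langle\xi,\alpha\rangle>0$. The acyclicity axiom requires a polarizing $\xi$ whose induced orientation has no oriented cycles. $\xi$ is generic if for each $p$ the vectors $\alpha(e)/\langle\xi,\alpha(e)\rangle-\alpha(e')/\langle\xi,\alpha(e')\rangle$, over ordered pairs of distinct $e,e'\in E^p$, are pairwise distinct. For such $\xi$, $\mathrm{ind}_\xi(p)=\#\{e\in E^p:\langle\xi,\alpha(e)\rangle<0\}$ and $b_i=\#\{p:\mathrm{ind}_\xi(p)=i\}$ (these numbers do not depend on the choice of a generic polarizing $\xi$ inducing an acyclic orientation). A 1-skeleton satisfying the acyclicity axiom has the Morse package if $H(\Gamma,\alpha)$ is a free graded $S$-module with exactly $b_i$ generators in degree $i$ for each $i$. A $2$-slice inherits the acyclicity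 axiom (via the same $\xi$), and its Morse package refers to its own equivariant cohomology and Betti numbers. *)

theory Defs
  imports
    "HOL-Analysis.Analysis"
    "HOL-Library.Poly_Mapping"
    "HOL-Library.Function_Algebras"
    "Graph_Theory.Graph_Theory"
begin

subsection \<open>The symmetric algebra of Euclidean space\<close>

text \<open>
  The symmetric algebra of \<open>real ^ 'n\<close> is realised as the polynomial ring in one variable for each
  standard basis vector: a monomial is a finitely supported exponent function, and a polynomial a
  finitely supported coefficient function on monomials.
\<close>

type_synonym 'n sym_alg = "('n \<Rightarrow>\<^sub>0 nat) \<Rightarrow>\<^sub>0 real"

text \<open>The embedding of \<open>real ^ 'n\<close> as the degree-one part.\<close>

definition sym_vec :: "real ^ 'n \<Rightarrow> 'n::finite sym_alg" where
  "sym_vec v = (\<Sum>i\<in>UNIV. Poly_Mapping.single (Poly_Mapping.single i 1) (v $ i))"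

definition homogeneous :: "nat \<Rightarrow> 'n::finite sym_alg \<Rightarrow> bool" where
  "homogeneous k f \<longleftrightarrow> (\<forall>m\<in>Poly_Mapping.keys f. (\<Sum>i\<in>UNIV. Poly_Mapping.lookup m i) = k)"

subsection \<open>1-skeleta\<close>

text \<open>
  The values of \<open>axial\<close>, \<open>conn\<close> and \<open>scal\<close> (in the usual notation: alpha, theta and lambda) matter
  only on the edges of the graph. Restricting a skeleton to a subgraph therefore just replaces the
  graph. In \<open>conn e\<close> and \<open>scal e\<close> the argument \<open>e\<close> is the edge along which one transports.
\<close>

record ('v, 'n::finite) skeleton =
  graph :: "'v pair_pre_digraph"
  axial :: "'v \<times> 'v \<Rightarrow> real ^ 'n"
  conn :: "'v \<times> 'v \<Rightarrow> 'v \<times> 'v \<Rightarrow> 'v \<times> 'v"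
  scal :: "'v \<times> 'v \<Rightarrow> 'v \<times> 'v \<Rightarrow> real"

abbreviation skel_verts :: "('v, 'n::finite) skeleton \<Rightarrow> 'v set" where
  "skel_verts \<Gamma> \<equiv> pverts (graph \<Gamma>)"

abbreviation skel_edges :: "('v, 'n::finite) skeleton \<Rightarrow> ('v \<times> 'v) set" where
  "skel_edges \<Gamma> \<equiv> parcs (graph \<Gamma>)"

abbreviation skel_star :: "('v, 'n::finite) skeleton \<Rightarrow> 'v \<Rightarrow> ('v \<times> 'v) set" where
  "skel_star \<Gamma> p \<equiv> out_arcs (with_proj (graph \<Gamma>)) p"

locale one_skeleton = pair_graph "graph \<Gamma>"
  for \<Gamma> :: "('v, 'n::finite) skeleton" +
  fixes d :: nat
  assumes graph_connected: "Digraph_Component.connected (with_proj (graph \<Gamma>))"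
    and valency: "p \<in> skel_verts \<Gamma> \<Longrightarrow> card (skel_star \<Gamma> p) = d"
    and conn_bij: "(p, q) \<in> skel_edges \<Gamma> \<Longrightarrow> bij_betw (conn \<Gamma> (p, q)) (skel_star \<Gamma> p) (skel_star \<Gamma> q)"
    and conn_self: "(p, q) \<in> skel_edges \<Gamma> \<Longrightarrow> conn \<Gamma> (p, q) (p, q) = (q, p)"
    and conn_inverse:
      "(p, q) \<in> skel_edges \<Gamma> \<Longrightarrow> e \<in> skel_star \<Gamma> p \<Longrightarrow> conn \<Gamma> (q, p) (conn \<Gamma> (p, q) e) = e"
    and axial_indep:
      "p \<in> skel_verts \<Gamma> \<Longrightarrow> e \<in> skel_star \<Gamma> p \<Longrightarrow> e' \<in> skel_star \<Gamma> p \<Longrightarrow> e \<noteq> e' \<Longrightarrow>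
        axial \<Gamma> e \<noteq> axial \<Gamma> e' \<and> independent {axial \<Gamma> e, axial \<Gamma> e'}"
    and axial_reverse: "(p, q) \<in> skel_edges \<Gamma> \<Longrightarrow> axial \<Gamma> (q, p) = - axial \<Gamma> (p, q)"
    and scal_pos: "(p, q) \<in> skel_edges \<Gamma> \<Longrightarrow> e \<in> skel_star \<Gamma> p \<Longrightarrow> scal \<Gamma> (p, q) e > 0"
    and axial_conn:
      "(p, q) \<in> skel_edges \<Gamma> \<Longrightarrow> e \<in> skel_star \<Gamma> p \<Longrightarrow>
        axial \<Gamma> e - scal \<Gamma> (p, q) e *\<^sub>R axial \<Gamma> (conn \<Gamma> (p, q) e) \<in> span {axial \<Gamma> (p, q)}"

subsection \<open>2-slices\<close>

definition slice_graph :: "('v, 'n::finite) skeleton \<Rightarrow> (real ^ 'n) set \<Rightarrow> 'v pair_pre_digraph" where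
  "slice_graph \<Gamma> H =
    (let EH = {e \<in> skel_edges \<Gamma>. axial \<Gamma> e \<in> H} in \<lparr> pverts = fst ` EH \<union> snd ` EH, parcs = EH \<rparr>)"

definition two_slices :: "('v, 'n::finite) skeleton \<Rightarrow> ('v, 'n) skeleton set" where
  "two_slices \<Gamma> =
    {\<Gamma>\<lparr>graph := C\<rparr> | C H. subspace H \<and> dim H = 2 \<and>
      pre_digraph.max_subgraph (with_proj (slice_graph \<Gamma> H)) Digraph_Component.connected (with_proj C)}"

subsection \<open>Equivariant cohomology\<close>

text \<open>
  The equivariant cohomology sits inside the module of all functions from the type \<open>'v\<close> to the
  symmetric algebra; its elements are extended by zero outside the vertex set.
\<close>

definition eqcoh :: "('v, 'n::finite) skeleton \<Rightarrow> ('v \<Rightarrow> 'n sym_alg) set" where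
  "eqcoh \<Gamma> = {f. (\<forall>p. p \<notin> skel_verts \<Gamma> \<longrightarrow> f p = 0) \<and>
    (\<forall>(p, q)\<in>skel_edges \<Gamma>. sym_vec (axial \<Gamma> (p, q)) dvd f q - f p)}"

definition sym_scale :: "'n::finite sym_alg \<Rightarrow> ('v \<Rightarrow> 'n sym_alg) \<Rightarrow> 'v \<Rightarrow> 'n sym_alg" where
  "sym_scale c f = (\<lambda>p. c * f p)"

interpretation sym_module: module sym_scale
  by unfold_locales (simp_all add: sym_scale_def fun_eq_iff algebra_simps)

lemma subspace_eqcoh: "sym_module.subspace (eqcoh \<Gamma>)"
proof (rule sym_module.subspaceI)
  show "0 \<in> eqcoh \<Gamma>"
    by (simp add: eqcoh_def Ball_def)
next
  fix f g assume f: "f \<in> eqcoh \<Gamma>" and g: "g \<in> eqcoh \<Gamma>"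
  have "sym_vec (axial \<Gamma> (p, q)) dvd (f + g) q - (f + g) p" if "(p, q) \<in> skel_edges \<Gamma>" for p q
  proof -
    have "sym_vec (axial \<Gamma> (p, q)) dvd (f q - f p) + (g q - g p)"
      using f g that by (intro dvd_add) (auto simp: eqcoh_def)
    also have "(f q - f p) + (g q - g p) = (f + g) q - (f + g) p"
      by (simp add: algebra_simps)
    finally show ?thesis .
  qed
  then show "f + g \<in> eqcoh \<Gamma>"
    using f g by (simp add: eqcoh_def Ball_def)
next
  fix c f assume f: "f \<in> eqcoh \<Gamma>"
  have "sym_vec (axial \<Gamma> (p, q)) dvd sym_scale c f q - sym_scale c f p" if "(p, q) \<in> skel_edges \<Gamma>" for p q
  proof -
    have "sym_vec (axial \<Gamma> (p, q)) dvd c * (f q - f p)"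
      using f that by (intro dvd_mult) (auto simp: eqcoh_def)
    also have "c * (f q - f p) = sym_scale c f q - sym_scale c f p"
      by (simp add: sym_scale_def right_diff_distrib)
    finally show ?thesis .
  qed
  then show "sym_scale c f \<in> eqcoh \<Gamma>"
    using f by (simp add: eqcoh_def sym_scale_def Ball_def)
qed

subsection \<open>Acyclicity, Betti numbers and the Morse package\<close>

text \<open>Covectors are represented as linear functionals \<open>real ^ 'n \<Rightarrow> real\<close>.\<close>

definition polarizing :: "('v, 'n::finite) skeleton \<Rightarrow> (real ^ 'n \<Rightarrow> real) \<Rightarrow> bool" where
  "polarizing \<Gamma> \<xi> \<longleftrightarrow> linear \<xi> \<and> (\<forall>e\<in>skel_edges \<Gamma>. \<xi> (axial \<Gamma> e) \<noteq> 0)"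

definition acyclic_orientation :: "('v, 'n::finite) skeleton \<Rightarrow> (real ^ 'n \<Rightarrow> real) \<Rightarrow> bool" where
  "acyclic_orientation \<Gamma> \<xi> \<longleftrightarrow> acyclic {e \<in> skel_edges \<Gamma>. \<xi> (axial \<Gamma> e) > 0}"

definition acyclicity_axiom :: "('v, 'n::finite) skeleton \<Rightarrow> bool" where
  "acyclicity_axiom \<Gamma> \<longleftrightarrow> (\<exists>\<xi>. polarizing \<Gamma> \<xi> \<and> acyclic_orientation \<Gamma> \<xi>)"

definition generic :: "('v, 'n::finite) skeleton \<Rightarrow> (real ^ 'n \<Rightarrow> real) \<Rightarrow> bool" where
  "generic \<Gamma> \<xi> \<longleftrightarrow> (\<forall>p\<in>skel_verts \<Gamma>.
    inj_on (\<lambda>(e, e'). axial \<Gamma> e /\<^sub>R \<xi> (axial \<Gamma> e) - axial \<Gamma> e' /\<^sub>R \<xi> (axial \<Gamma> e'))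
      {(e, e'). e \<in> skel_star \<Gamma> p \<and> e' \<in> skel_star \<Gamma> p \<and> e \<noteq> e'})"

definition ind :: "('v, 'n::finite) skeleton \<Rightarrow> (real ^ 'n \<Rightarrow> real) \<Rightarrow> 'v \<Rightarrow> nat" where
  "ind \<Gamma> \<xi> p = card {e \<in> skel_star \<Gamma> p. \<xi> (axial \<Gamma> e) < 0}"

definition betti :: "('v, 'n::finite) skeleton \<Rightarrow> (real ^ 'n \<Rightarrow> real) \<Rightarrow> nat \<Rightarrow> nat" where
  "betti \<Gamma> \<xi> i = card {p \<in> skel_verts \<Gamma>. ind \<Gamma> \<xi> p = i}"

text \<open>\<open>M\<close> is a free graded module with exactly \<open>b i\<close> generators in each degree \<open>i\<close>.\<close>

definition graded_free :: "('v \<Rightarrow> 'n::finite sym_alg) set \<Rightarrow> (nat \<Rightarrow> nat) \<Rightarrow> bool" where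
  "graded_free M b \<longleftrightarrow> (\<exists>B. finite B \<and> sym_module.independent B \<and> sym_module.span B = M \<and>
    (\<forall>f\<in>B. \<exists>k. \<forall>p. homogeneous k (f p)) \<and>
    (\<forall>i. card {f \<in> B. \<forall>p. homogeneous i (f p)} = b i))"

text \<open>
  The Betti numbers do not depend on the generic polarizing covector inducing an acyclic
  orientation, and such a covector exists whenever the acyclicity axiom holds; hence it makes no
  difference that the definition asks for some such covector.
\<close>

definition morse_package :: "('v, 'n::finite) skeleton \<Rightarrow> bool" where
  "morse_package \<Gamma> \<longleftrightarrow> (\<exists>\<xi>. polarizing \<Gamma> \<xi> \<and> acyclic_orientation \<Gamma> \<xi> \<and> generic \<Gamma> \<xi> \<and>
    graded_free (eqcoh \<Gamma>) (betti \<Gamma> \<xi>))"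

end

theory Submission
  imports Defs
begin

text \<open>
  Fix a generic polarizing covector with acyclic orientation and refine the orientation to a total
  order of the vertices. Comparing graded ranks shows that the Morse package holds if and only if
  every vertex \<open>p\<close> has a flow-up class: one that vanishes below \<open>p\<close> and whose value at \<open>p\<close> is the
  Thom value, the product of the axial vectors descending from \<open>p\<close>.

  A flow-up class of the graph restricts to a slice in a plane \<open>H\<close> with value the Thom value of the
  slice times linear forms outside \<open>H\<close>; a translation fixing \<open>H\<close> makes the latter units modulo higher
  degree. Conversely, a flow-up class of a slice can be multiplied by linear forms outside \<open>H\<close> and
  extended by zero. Hence the obstruction to a flow-up class at \<open>p\<close> is an ideal contained in no
  prime generated by a plane; as the classes vanishing up to \<open>p\<close> form a free module by induction,
  this codimension at least three forces the extension to split. The Betti numbers of a slice do not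
  depend on the covector, since wall crossings permute the indices.
\<close>

text \<open>Why codimension three splits the extension: the obstruction lies in Ext^1(J, K), where J
  is the ideal of leading values at p divided by the Thom value and K the free module of classes
  vanishing up to p; Ext^1(J, S) is zero in that codimension. A splitting evaluated at a vertex is a
  linear map from J to S, hence multiplication by one element of S, and these elements are the
  values of the flow-up class. The proof replaces Ext by explicit cocycles. Primes of codimension
  two need not be generated by linear forms; planes suffice because the slices supply products of
  linear forms in J, so each denominator that occurs is such a product.

  A slice may witness its Morse package by a covector of its own, while the flow-up classes must fit
  one common order; the invariance of the Betti numbers bridges this gap. Two degenerate cases need
  care. A plane may contain no edge at p; a lone vertex then plays the part of the slice. In
  dimension one there are no planes, and the classes are written down directly.\<close>

section \<open>The symmetric algebra: constants, linear forms, induction\<close>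

lemma sum_single_induct [case_names zero add]:
  fixes f :: "'a \<Rightarrow>\<^sub>0 'b::comm_monoid_add"
  assumes "P 0" and "\<And>f m a. P f \<Longrightarrow> P (f + Poly_Mapping.single m a)"
  shows "P f"
proof (induction f rule: update_induct)
  case const
  show ?case by (rule assms)
next
  case (update f m a)
  have "Poly_Mapping.update m a f = f + Poly_Mapping.single m a"
    using update(1) by (intro poly_mapping_eqI)
      (auto simp: lookup_update lookup_add lookup_single in_keys_iff when_def)
  with assms(2)[OF update(3)] show ?case by simp
qed

definition sym_const :: "real \<Rightarrow> 'n::finite sym_alg" where
  "sym_const = Poly_Mapping.single 0"

lemma sym_const_0 [simp]: "sym_const 0 = 0"
  and sym_const_1 [simp]: "sym_const 1 = 1"
  and sym_const_add: "sym_const (a + b) = sym_const a + sym_const b"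
  and sym_const_mult: "sym_const (a * b) = sym_const a * sym_const b"
  by (simp_all add: sym_const_def single_add mult_single)

lemma sym_const_eq_0_iff [simp]: "sym_const a = 0 \<longleftrightarrow> a = 0"
  by (metis sym_const_def lookup_single_eq lookup_zero single_zero)

lemma sym_const_sum: "sym_const (sum g A) = (\<Sum>x\<in>A. sym_const (g x))"
  by (induction A rule: infinite_finite_induct) (simp_all add: sym_const_add)

lemma sym_vec_axis: "sym_vec (axis i 1) = Poly_Mapping.single (Poly_Mapping.single i 1) 1"
proof -
  have "sym_vec (axis i 1) =
      (\<Sum>j\<in>UNIV. if i = j then Poly_Mapping.single (Poly_Mapping.single j 1) (1::real) else 0)"
    unfolding sym_vec_def by (intro sum.cong) (auto simp: axis_def)
  then show ?thesis by simp
qed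

lemma sym_vec_add: "sym_vec (v + w) = sym_vec v + sym_vec w"
  by (simp add: sym_vec_def single_add sum.distrib)

lemma sym_vec_scaleR: "sym_vec (a *\<^sub>R v) = sym_const a * sym_vec v"
  by (simp add: sym_vec_def sym_const_def sum_distrib_left mult_single)

lemma sym_vec_0 [simp]: "sym_vec 0 = 0"
  by (simp add: sym_vec_def)

lemma sym_vec_uminus: "sym_vec (- v) = - sym_vec v"
  by (metis sym_vec_0 sym_vec_add add.right_inverse add_eq_0_iff)

lemma sym_vec_diff: "sym_vec (v - w) = sym_vec v - sym_vec w"
  using sym_vec_add[of v "- w"] by (simp add: sym_vec_uminus)

lemma sym_vec_expand: "sym_vec v = (\<Sum>i\<in>UNIV. sym_const (v $ i) * sym_vec (axis i 1))"
  unfolding sym_vec_axis by (simp add: sym_vec_def sym_const_def mult_single)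

lemma single_1_eq_iff:
  "Poly_Mapping.single i (Suc 0) = Poly_Mapping.single j (Suc 0) \<longleftrightarrow> i = j"
  by (metis lookup_single_eq lookup_single_not_eq nat.distinct(1))

lemma sym_vec_eq_0_iff [simp]: "sym_vec v = 0 \<longleftrightarrow> v = 0"
proof
  assume 0: "sym_vec v = 0"
  have "v $ j = 0" for j
  proof -
    have "Poly_Mapping.lookup (sym_vec v) (Poly_Mapping.single j 1) = (\<Sum>i\<in>UNIV. if i = j then v $ j else 0)"
      unfolding sym_vec_def lookup_sum
      by (intro sum.cong) (auto simp: lookup_single when_def single_1_eq_iff)
    with 0 show ?thesis by simp
  qed
  then show "v = 0" by (simp add: vec_eq_iff)
qed simp

lemma single_eq_const_times_vars:
  "Poly_Mapping.single m a = sym_const a * (\<Prod>i\<in>UNIV. sym_vec (axis i 1) ^ Poly_Mapping.lookup m i)"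
proof -
  have pow: "sym_vec (axis i 1) ^ k = Poly_Mapping.single (Poly_Mapping.single i k) 1" for i :: 'a and k
    by (induction k) (simp_all add: sym_vec_axis mult_single single_add[symmetric])
  have prod: "(\<Prod>i\<in>A. Poly_Mapping.single (g i) (1::real)) = Poly_Mapping.single (sum g A) 1"
    for A :: "'a set" and g :: "'a \<Rightarrow> 'a \<Rightarrow>\<^sub>0 nat"
    by (induction A rule: infinite_finite_induct) (simp_all add: mult_single)
  have m: "(\<Sum>i\<in>UNIV. Poly_Mapping.single i (Poly_Mapping.lookup m i)) = m"
  proof (rule poly_mapping_eqI)
    fix j
    have "Poly_Mapping.lookup (\<Sum>i\<in>UNIV. Poly_Mapping.single i (Poly_Mapping.lookup m i)) j
        = (\<Sum>i\<in>UNIV. if i = j then Poly_Mapping.lookup m j else 0)"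
      unfolding lookup_sum by (intro sum.cong) (auto simp: lookup_single when_def)
    then show "Poly_Mapping.lookup (\<Sum>i\<in>UNIV. Poly_Mapping.single i (Poly_Mapping.lookup m i)) j
        = Poly_Mapping.lookup m j" by simp
  qed
  show ?thesis
    by (simp add: pow prod m sym_const_def mult_single)
qed

text \<open>Constants and linear forms generate the algebra; taking the forms of all vectors keeps
  later inductions free of a basis.\<close>

lemma sym_alg_induct [case_names const vec add mult]:
  fixes f :: "'n::finite sym_alg"
  assumes const: "\<And>a. P (sym_const a)" and vec: "\<And>v. P (sym_vec v)"
    and add: "\<And>f g. P f \<Longrightarrow> P g \<Longrightarrow> P (f + g)" and mult: "\<And>f g. P f \<Longrightarrow> P g \<Longrightarrow> P (f * g)"
  shows "P f"
proof (induction f rule: sum_single_induct)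
  case zero
  show ?case using const[of 0] by simp
next
  case (add f m a)
  have one: "P 1" using const[of 1] by simp
  have pow: "P (x ^ k)" if "P x" for x k
    by (induction k) (simp_all add: one mult that)
  have "P (\<Prod>i\<in>A. sym_vec (axis i 1) ^ Poly_Mapping.lookup m i)" for A
    by (induction A rule: infinite_finite_induct) (simp_all add: one mult pow vec)
  then show ?case
    by (subst single_eq_const_times_vars) (intro assms(3) mult const add)
qed

subsection \<open>Substitution homomorphisms\<close>

text \<open>The universal property of the polynomial ring, generic in the target because three
  targets occur: polynomials in variables indexed by \<open>nat\<close>, the algebra itself (for
  \<open>kill\<close> and for translations), and univariate polynomials over it (for the
  grading).\<close>

locale sym_coeff_hom =
  fixes c :: "real \<Rightarrow> 'a::comm_ring_1"
  assumes c_1: "c 1 = 1" and c_add: "c (x + y) = c x + c y" and c_mult: "c (x * y) = c x * c y"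
begin

definition subst :: "('n \<Rightarrow> 'a) \<Rightarrow> 'n::finite sym_alg \<Rightarrow> 'a" where
  "subst \<phi> f = (\<Sum>m\<in>Poly_Mapping.keys f.
     c (Poly_Mapping.lookup f m) * (\<Prod>i\<in>UNIV. \<phi> i ^ Poly_Mapping.lookup m i))"

lemma c_0: "c 0 = 0"
  using c_add[of 0 0] by simp

lemma subst_add: "subst \<phi> (f + g) = subst \<phi> f + subst \<phi> g"
  unfolding subst_def
  by (rule setsum_keys_plus_distrib) (simp_all add: c_0 c_add algebra_simps)

lemma subst_0: "subst \<phi> 0 = 0"
  by (simp add: subst_def)

lemma subst_single:
  "subst \<phi> (Poly_Mapping.single m a) = c a * (\<Prod>i\<in>UNIV. \<phi> i ^ Poly_Mapping.lookup m i)"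
  by (cases "a = 0") (simp_all add: subst_def c_0)

lemma subst_const: "subst \<phi> (sym_const a) = c a"
  by (simp add: sym_const_def subst_single)

lemma subst_1: "subst \<phi> 1 = 1"
  using subst_const[of \<phi> 1] by (simp add: c_1)

lemma subst_var: "subst \<phi> (sym_vec (axis i 1)) = \<phi> i"
proof -
  have "(\<Prod>j\<in>UNIV. \<phi> j ^ Poly_Mapping.lookup (Poly_Mapping.single i 1) j) = (\<Prod>j\<in>UNIV. if i = j then \<phi> j else 1)"
    by (intro prod.cong) (auto simp: lookup_single when_def)
  then show ?thesis
    by (simp add: sym_vec_axis subst_single c_1)
qed

lemma subst_mult: "subst \<phi> (f * g) = subst \<phi> f * subst \<phi> g"
proof (induction g rule: sum_single_induct)
  case zero
  show ?case by (simp add: subst_0)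
next
  case (add g m a)
  have "subst \<phi> (f * Poly_Mapping.single m a) = subst \<phi> f * subst \<phi> (Poly_Mapping.single m a)"
  proof (induction f rule: sum_single_induct)
    case zero
    show ?case by (simp add: subst_0)
  next
    case (add f k b)
    then show ?case
      by (simp add: distrib_right subst_add mult_single subst_single c_mult lookup_add power_add
          prod.distrib algebra_simps)
  qed
  with add show ?case
    by (simp add: distrib_left subst_add)
qed

lemma subst_sum: "subst \<phi> (sum g A) = (\<Sum>x\<in>A. subst \<phi> (g x))"
  by (induction A rule: infinite_finite_induct) (simp_all add: subst_0 subst_add)

lemma subst_prod: "subst \<phi> (prod g A) = (\<Prod>x\<in>A. subst \<phi> (g x))"
  by (induction A rule: infinite_finite_induct) (simp_all add: subst_1 subst_mult)

lemma subst_uminus: "subst \<phi> (- f) = - subst \<phi> f"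
  by (metis subst_0 subst_add add.right_inverse add_eq_0_iff)

lemma subst_diff: "subst \<phi> (f - g) = subst \<phi> f - subst \<phi> g"
  using subst_add[of \<phi> f "- g"] by (simp add: subst_uminus)

lemma subst_vec: "subst \<phi> (sym_vec v) = (\<Sum>i\<in>UNIV. c (v $ i) * \<phi> i)"
  by (subst sym_vec_expand) (simp add: subst_sum subst_mult subst_const subst_var)

end

text \<open>The library makes polynomials over a linearly ordered set of variables an integral domain; an
  arbitrary finite set of variables is mapped injectively to the natural numbers.\<close>

lemma sym_alg_no_zero_divisors:
  fixes f g :: "'n::finite sym_alg"
  assumes "f * g = 0"
  shows "f = 0 \<or> g = 0"
proof -
  obtain e :: "'n \<Rightarrow> nat" where e: "inj e"
    using finite_imp_inj_to_nat_seg[of "UNIV :: 'n set"] by auto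
  let ?c = "Poly_Mapping.single 0 :: real \<Rightarrow> (nat \<Rightarrow>\<^sub>0 nat) \<Rightarrow>\<^sub>0 real"
  interpret sym_coeff_hom ?c
    by unfold_locales (simp_all add: single_add mult_single)
  define \<phi> where "\<phi> i = Poly_Mapping.single (Poly_Mapping.single (e i) (1::nat)) (1::real)" for i
  define h where "h m = (\<Sum>i\<in>UNIV. Poly_Mapping.single (e i) (Poly_Mapping.lookup m i))" for m :: "'n \<Rightarrow>\<^sub>0 nat"
  have pow: "\<phi> i ^ k = Poly_Mapping.single (Poly_Mapping.single (e i) k) 1" for i k
    by (induction k) (simp_all add: \<phi>_def mult_single single_add[symmetric])
  have prod: "(\<Prod>i\<in>A. Poly_Mapping.single (u i) (1::real)) = Poly_Mapping.single (sum u A) 1"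
    for A :: "'n set" and u :: "'n \<Rightarrow> nat \<Rightarrow>\<^sub>0 nat"
    by (induction A rule: infinite_finite_induct) (simp_all add: mult_single)
  have h_lookup: "Poly_Mapping.lookup (h m) (e j) = Poly_Mapping.lookup m j" for m j
  proof -
    have "Poly_Mapping.lookup (h m) (e j) = (\<Sum>i\<in>UNIV. if i = j then Poly_Mapping.lookup m j else 0)"
      unfolding h_def lookup_sum using e
      by (intro sum.cong) (auto simp: lookup_single when_def inj_eq)
    then show ?thesis by simp
  qed
  have h: "inj h"
  proof (rule injI)
    fix m k assume "h m = h k"
    then show "m = k"
      by (intro poly_mapping_eqI) (simp only: h_lookup[symmetric])
  qed
  \<comment> \<open>As \<open>h\<close> is injective on monomials, terms of the image cannot cancel
    and each coefficient can be read off.\<close>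
  have lookup: "Poly_Mapping.lookup (subst \<phi> p) (h m) = Poly_Mapping.lookup p m" for p m
  proof -
    have "Poly_Mapping.lookup (subst \<phi> p) (h m) =
        (\<Sum>k\<in>Poly_Mapping.keys p. if k = m then Poly_Mapping.lookup p m else 0)"
      unfolding subst_def lookup_sum pow prod h_def[symmetric] mult_single using h
      by (intro sum.cong) (auto simp: lookup_single when_def inj_eq)
    then show ?thesis by (simp add: in_keys_iff)
  qed
  have inj0: "p = 0" if "subst \<phi> p = 0" for p
  proof (rule poly_mapping_eqI)
    fix m
    show "Poly_Mapping.lookup p m = Poly_Mapping.lookup 0 m" using lookup[of p m] that by simp
  qed
  have "subst \<phi> f * subst \<phi> g = 0"
    using assms by (simp only: subst_mult[symmetric] subst_0)
  then show ?thesis using inj0 by auto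
qed

lemma sym_mult_eq_0_iff: "f * g = 0 \<longleftrightarrow> f = 0 \<or> g = (0 :: 'n::finite sym_alg)"
  using sym_alg_no_zero_divisors by auto

lemma sym_mult_left_cancel: "c \<noteq> 0 \<Longrightarrow> c * a = c * b \<longleftrightarrow> a = (b :: 'n::finite sym_alg)"
  using sym_mult_eq_0_iff[of c "a - b"] by (simp add: right_diff_distrib)

lemma sym_prod_eq_0_iff:
  "finite A \<Longrightarrow> prod g A = (0 :: 'n::finite sym_alg) \<longleftrightarrow> (\<exists>x\<in>A. g x = 0)"
  by (induction A rule: finite_induct) (simp_all add: sym_mult_eq_0_iff)

interpretation sym_self: sym_coeff_hom "sym_const :: real \<Rightarrow> 'n::finite sym_alg"
  by unfold_locales (simp_all add: sym_const_add sym_const_mult)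

interpretation sym_grade: sym_coeff_hom "\<lambda>a. [:sym_const a:] :: 'n::finite sym_alg poly"
  by unfold_locales (simp_all add: sym_const_add sym_const_mult)

subsection \<open>Divisibility by a linear form\<close>

text \<open>For \<open>l = 0\<close> division by zero makes this the identity, which is the right
  value: divisibility by the zero form means being zero, so no case distinction arises
  later.\<close>

definition proj_off :: "real ^ 'n \<Rightarrow> real ^ 'n \<Rightarrow> real ^ 'n::finite" where
  "proj_off l v = v - (v \<bullet> l / (l \<bullet> l)) *\<^sub>R l"

text \<open>A model inside the algebra of the quotient by the ideal of \<open>l\<close>: a
  retraction whose kernel is that ideal (\<open>sym_vec_dvd_iff\<close>). Congruences modulo
  \<open>l\<close> become equations in a domain, and primality of linear forms follows.\<close>

definition kill :: "real ^ 'n \<Rightarrow> 'n::finite sym_alg \<Rightarrow> 'n sym_alg" where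
  "kill l = sym_self.subst (\<lambda>i. sym_vec (proj_off l (axis i 1)))"

lemma kill_add: "kill l (f + g) = kill l f + kill l g"
  and kill_mult: "kill l (f * g) = kill l f * kill l g"
  and kill_const: "kill l (sym_const a) = sym_const a"
  and kill_0 [simp]: "kill l 0 = 0"
  and kill_1 [simp]: "kill l 1 = 1"
  and kill_diff: "kill l (f - g) = kill l f - kill l g"
  and kill_prod: "kill l (prod h A) = (\<Prod>x\<in>A. kill l (h x))"
  unfolding kill_def
  by (simp_all add: sym_self.subst_add sym_self.subst_mult sym_self.subst_const sym_self.subst_0
      sym_self.subst_1 sym_self.subst_diff sym_self.subst_prod)

lemma sym_vec_sum: "sym_vec (sum g A) = (\<Sum>x\<in>A. sym_vec (g x))"
  by (induction A rule: infinite_finite_induct) (simp_all add: sym_vec_add)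

lemma linear_proj_off: "linear (proj_off l)"
  by (rule linearI) (simp_all add: proj_off_def inner_add_left add_divide_distrib algebra_simps)

lemma kill_vec: "kill l (sym_vec v) = sym_vec (proj_off l v)"
proof -
  have "kill l (sym_vec v) = (\<Sum>i\<in>UNIV. sym_const (v $ i) * sym_vec (proj_off l (axis i 1)))"
    by (simp add: kill_def sym_self.subst_vec)
  also have "\<dots> = sym_vec (proj_off l (\<Sum>i\<in>UNIV. (v $ i) *\<^sub>R axis i 1))"
    by (simp add: sym_vec_sum sym_vec_scaleR linear_sum[OF linear_proj_off]
        linear_scale[OF linear_proj_off])
  also have "(\<Sum>i\<in>UNIV. (v $ i) *\<^sub>R axis i 1) = v"
    using basis_expansion[of v] by (simp add: scalar_mult_eq_scaleR)
  finally show ?thesis .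
qed

lemma dvd_diff_kill: "sym_vec l dvd f - kill l f"
proof (induction f rule: sym_alg_induct)
  case (const a)
  show ?case by (simp add: kill_const)
next
  case (vec v)
  have "sym_vec v - kill l (sym_vec v) = sym_vec l * sym_const (v \<bullet> l / (l \<bullet> l))"
    by (simp add: kill_vec proj_off_def sym_vec_diff sym_vec_scaleR mult.commute)
  then show ?case by simp
next
  case (add f g)
  then have "sym_vec l dvd (f - kill l f) + (g - kill l g)" by (rule dvd_add)
  then show ?case by (simp add: kill_add algebra_simps)
next
  case (mult f g)
  then have "sym_vec l dvd (f - kill l f) * g + kill l f * (g - kill l g)"
    by (intro dvd_add) simp_all
  then show ?case by (simp add: kill_mult algebra_simps)
qed

lemma proj_off_eq_0_iff: "proj_off l v = 0 \<longleftrightarrow> v \<in> span {l}"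
proof
  assume "proj_off l v = 0"
  then have "v = (v \<bullet> l / (l \<bullet> l)) *\<^sub>R l" by (simp add: proj_off_def)
  then show "v \<in> span {l}" by (metis span_mul span_base singletonI)
next
  assume "v \<in> span {l}"
  then obtain k where "v = k *\<^sub>R l" by (auto simp: span_singleton)
  then show "proj_off l v = 0" by (cases "l = 0") (simp_all add: proj_off_def)
qed

lemma kill_self [simp]: "kill l (sym_vec l) = 0"
  by (simp add: kill_vec proj_off_eq_0_iff span_base)

lemma sym_vec_dvd_iff: "sym_vec l dvd f \<longleftrightarrow> kill l f = 0"
proof
  assume "sym_vec l dvd f"
  then show "kill l f = 0" by (auto simp: kill_mult)
next
  assume "kill l f = 0"
  then show "sym_vec l dvd f" using dvd_diff_kill[of l f] by simp
qed

lemma sym_vec_prime: "sym_vec l dvd f * g \<longleftrightarrow> sym_vec l dvd f \<or> sym_vec l dvd g"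
  by (simp add: sym_vec_dvd_iff kill_mult sym_mult_eq_0_iff)

lemma sym_vec_dvd_prod_iff:
  "finite A \<Longrightarrow> sym_vec l dvd (\<Prod>x\<in>A. sym_vec (g x)) \<longleftrightarrow> (\<exists>x\<in>A. g x \<in> span {l})"
  by (simp add: sym_vec_dvd_iff kill_prod sym_prod_eq_0_iff kill_vec proj_off_eq_0_iff)

text \<open>Each new factor is prime and does not divide the product collected so far, so it divides
  the cofactor.\<close>

lemma prod_sym_vec_dvd:
  assumes "finite A"
    and "\<And>x y. x \<in> A \<Longrightarrow> y \<in> A \<Longrightarrow> x \<noteq> y \<Longrightarrow> g x \<notin> span {g y}"
    and "\<And>x. x \<in> A \<Longrightarrow> sym_vec (g x) dvd f"
  shows "(\<Prod>x\<in>A. sym_vec (g x)) dvd f"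
  using assms
proof (induction A rule: finite_induct)
  case (insert x A)
  then have "(\<Prod>x\<in>A. sym_vec (g x)) dvd f" by simp
  then obtain h where h: "f = (\<Prod>x\<in>A. sym_vec (g x)) * h" by (elim dvdE)
  have "\<not> sym_vec (g x) dvd (\<Prod>x\<in>A. sym_vec (g x))"
    using insert by (subst sym_vec_dvd_prod_iff) auto
  moreover have "sym_vec (g x) dvd (\<Prod>x\<in>A. sym_vec (g x)) * h"
    using insert.prems(2)[of x] h by simp
  ultimately have "sym_vec (g x) dvd h" by (simp add: sym_vec_prime)
  then show ?case
    using insert by (simp add: h mult.commute mult_dvd_mono)
qed simp

subsection \<open>Homogeneous components\<close>

text \<open>Substituting t x_i for x_i makes the homogeneous components the coefficients in t, so
  the behaviour of \<open>hcomp\<close> on products comes from multiplicativity of the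
  substitution.\<close>

definition grading :: "'n::finite sym_alg \<Rightarrow> 'n sym_alg poly" where
  "grading = sym_grade.subst (\<lambda>i. [:0, sym_vec (axis i 1):])"

definition hcomp :: "nat \<Rightarrow> 'n::finite sym_alg \<Rightarrow> 'n sym_alg" where
  "hcomp k f = poly.coeff (grading f) k"

lemma grading_single:
  "grading (Poly_Mapping.single m a) =
    monom (Poly_Mapping.single m a) (\<Sum>i\<in>UNIV. Poly_Mapping.lookup m i)"
proof -
  have pow: "[:0, x:] ^ j = monom (x ^ j) j" for x :: "'a sym_alg" and j
    using monom_power[of x 1 j] by (simp add: monom_Suc monom_0)
  have prod: "(\<Prod>i\<in>A. monom (g i) (h i)) = monom (\<Prod>i\<in>A. g i) (\<Sum>i\<in>A. h i)"
    for A :: "'a set" and g :: "'a \<Rightarrow> 'a sym_alg" and h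
    by (induction A rule: infinite_finite_induct) (simp_all add: mult_monom)
  show ?thesis
    by (simp add: grading_def sym_grade.subst_single pow prod smult_monom
        single_eq_const_times_vars[of m a, symmetric])
qed

lemma hcomp_add: "hcomp k (f + g) = hcomp k f + hcomp k g"
  and hcomp_diff: "hcomp k (f - g) = hcomp k f - hcomp k g"
  and hcomp_0 [simp]: "hcomp k 0 = 0"
  and hcomp_sum: "hcomp k (sum h A) = (\<Sum>x\<in>A. hcomp k (h x))"
  by (simp_all add: hcomp_def grading_def sym_grade.subst_add sym_grade.subst_diff
      sym_grade.subst_0 sym_grade.subst_sum coeff_sum)

lemma grading_mult: "grading (f * g) = grading f * grading g"
  by (simp add: grading_def sym_grade.subst_mult)

lemma lookup_hcomp:
  "Poly_Mapping.lookup (hcomp k f) m =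
    (if (\<Sum>i\<in>UNIV. Poly_Mapping.lookup m i) = k then Poly_Mapping.lookup f m else 0)"
proof (induction f rule: sum_single_induct)
  case (add f m' a)
  then show ?case
    by (auto simp: hcomp_add lookup_add hcomp_def[of _ "Poly_Mapping.single m' a"] grading_single
        lookup_single when_def)
qed simp

lemma homogeneous_iff_lookup:
  "homogeneous k f \<longleftrightarrow>
    (\<forall>m. Poly_Mapping.lookup f m \<noteq> 0 \<longrightarrow> (\<Sum>i\<in>UNIV. Poly_Mapping.lookup m i) = k)"
  by (auto simp: homogeneous_def in_keys_iff)

lemma homogeneous_iff_hcomp: "homogeneous k f \<longleftrightarrow> hcomp k f = f"
  by (auto simp: homogeneous_iff_lookup poly_mapping_eq_iff fun_eq_iff lookup_hcomp)

lemma hcomp_hcomp: "hcomp j (hcomp k f) = (if j = k then hcomp k f else 0)"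
  by (auto intro!: poly_mapping_eqI simp: lookup_hcomp)

lemma homogeneous_hcomp [simp]: "homogeneous k (hcomp k f)"
  by (simp add: homogeneous_iff_hcomp hcomp_hcomp)

lemma homogeneous_grading: "homogeneous k f \<longleftrightarrow> grading f = monom f k"
proof
  assume "homogeneous k f"
  then have f: "hcomp k f = f" by (simp only: homogeneous_iff_hcomp)
  have "poly.coeff (grading f) j = (if k = j then f else 0)" for j
    using hcomp_hcomp[of j k f] unfolding f by (auto simp: hcomp_def)
  then show "grading f = monom f k"
    by (intro poly_eqI) (simp only: coeff_monom)
next
  assume f: "grading f = monom f k"
  have "hcomp k f = poly.coeff (monom f k) k" unfolding hcomp_def f ..
  then show "homogeneous k f" by (simp add: homogeneous_iff_hcomp)
qed

lemma homogeneous_mult: "homogeneous j f \<Longrightarrow> homogeneous k g \<Longrightarrow> homogeneous (j + k) (f * g)"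
  by (simp add: homogeneous_grading grading_mult mult_monom)

lemma homogeneous_0 [simp]: "homogeneous k 0"
  by (simp add: homogeneous_iff_hcomp)

lemma homogeneous_diff: "homogeneous k f \<Longrightarrow> homogeneous k g \<Longrightarrow> homogeneous k (f - g)"
  by (simp add: homogeneous_iff_hcomp hcomp_diff)

lemma homogeneous_const: "homogeneous 0 (sym_const a)"
  by (simp add: homogeneous_iff_lookup sym_const_def lookup_single when_def)

lemma homogeneous_vec: "homogeneous 1 (sym_vec v)"
proof -
  have "(\<Sum>j\<in>UNIV. Poly_Mapping.lookup (Poly_Mapping.single i 1) j) = (\<Sum>j\<in>UNIV. if i = j then 1 else 0)"
    for i :: 'a
    by (intro sum.cong) (simp_all add: lookup_single when_def)
  then have "homogeneous 1 (Poly_Mapping.single (Poly_Mapping.single i 1) a)" for i :: 'a and a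
    by (auto simp: homogeneous_iff_lookup lookup_single when_def)
  then show ?thesis
    by (simp add: sym_vec_def homogeneous_iff_hcomp hcomp_sum)
qed

lemma homogeneous_prod_vec: "homogeneous (card A) (\<Prod>x\<in>A. sym_vec (g x))"
proof (induction A rule: infinite_finite_induct)
  case (insert x A)
  then show ?case using homogeneous_mult[OF homogeneous_vec] by simp
qed (use homogeneous_const[of 1] in simp_all)

lemma homogeneous_unique: "homogeneous j f \<Longrightarrow> homogeneous k f \<Longrightarrow> f \<noteq> 0 \<Longrightarrow> j = k"
  by (metis homogeneous_iff_hcomp hcomp_hcomp)

lemma hcomp_mult_homogeneous:
  "homogeneous j f \<Longrightarrow> hcomp k (f * g) = (if j \<le> k then f * hcomp (k - j) g else 0)"
  by (simp add: hcomp_def grading_mult homogeneous_grading coeff_monom_mult)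

lemma hcomp_0_mult: "hcomp 0 (f * g) = hcomp 0 f * hcomp 0 g"
  by (simp add: hcomp_def grading_mult coeff_mult_0)

lemma homogeneous_0_imp_const:
  assumes "homogeneous 0 f"
  shows "\<exists>a. f = sym_const a"
proof
  show "f = sym_const (Poly_Mapping.lookup f 0)"
  proof (rule poly_mapping_eqI)
    fix m :: "'a \<Rightarrow>\<^sub>0 nat"
    have "m = 0" if "(\<Sum>i\<in>UNIV. Poly_Mapping.lookup m i) = 0"
      using that by (intro poly_mapping_eqI) (simp add: sum_eq_0_iff)
    with assms show "Poly_Mapping.lookup f m =
        Poly_Mapping.lookup (sym_const (Poly_Mapping.lookup f 0)) m"
      by (auto simp: homogeneous_iff_lookup sym_const_def lookup_single when_def)
  qed
qed

subsection \<open>Splitting cocycles\<close>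

text \<open>For a subspace \<open>H\<close> such a product lies outside the prime ideal generated by
  \<open>H\<close>. The inductive form allows one linear factor to be removed at a time.\<close>

inductive vec_prod :: "(real ^ 'n) set \<Rightarrow> 'n::finite sym_alg \<Rightarrow> bool" for H where
  one: "vec_prod H 1"
| mult: "v \<notin> H \<Longrightarrow> vec_prod H u \<Longrightarrow> vec_prod H (sym_vec v * u)"

lemma vec_prod_prod:
  "finite A \<Longrightarrow> (\<And>x. x \<in> A \<Longrightarrow> g x \<notin> H) \<Longrightarrow> vec_prod H (\<Prod>x\<in>A. sym_vec (g x))"
  by (induction A rule: finite_induct) (simp_all add: vec_prod.intros)

lemma vec_prod_antimono: "vec_prod H u \<Longrightarrow> L \<subseteq> H \<Longrightarrow> vec_prod L u"
  by (induction rule: vec_prod.induct) (auto intro: vec_prod.intros)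

lemma vec_prod_nonzero: "vec_prod H u \<Longrightarrow> 0 \<in> H \<Longrightarrow> u \<noteq> 0"
  by (induction rule: vec_prod.induct) (auto simp: sym_mult_eq_0_iff)

lemma kill_vec_prod_nonzero: "vec_prod H u \<Longrightarrow> span {l} \<subseteq> H \<Longrightarrow> kill l u \<noteq> 0"
  by (induction rule: vec_prod.induct)
    (auto simp: kill_mult sym_mult_eq_0_iff kill_vec proj_off_eq_0_iff)

lemma kill_kill: "kill l (kill l f) = kill l f"
  using dvd_diff_kill[of l f] by (simp add: sym_vec_dvd_iff kill_diff)

text \<open>Killing \<open>l\<close> and then the image of \<open>m\<close> is the quotient by the
  plane of \<open>l\<close> and \<open>m\<close>, again a domain in which no factor outside the
  plane vanishes.\<close>

lemma kill_kill_vec_prod_nonzero: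
  assumes "vec_prod H u" "span {l, m} \<subseteq> H"
  shows "kill (proj_off l m) (kill l u) \<noteq> 0"
  using assms
proof (induction rule: vec_prod.induct)
  case (mult v u)
  have "proj_off l v \<notin> span {proj_off l m}"
  proof
    assume "proj_off l v \<in> span {proj_off l m}"
    then obtain k where "proj_off l v = k *\<^sub>R proj_off l m"
      by (auto simp: span_singleton)
    then have "proj_off l (v - k *\<^sub>R m) = 0"
      by (simp add: linear_diff[OF linear_proj_off] linear_scale[OF linear_proj_off])
    then have "v - k *\<^sub>R m \<in> span {l}" by (simp add: proj_off_eq_0_iff)
    then have "v - k *\<^sub>R m \<in> span {l, m}" by (rule subsetD[OF span_mono, rotated]) simp
    then have "v - k *\<^sub>R m + k *\<^sub>R m \<in> span {l, m}"
      by (intro span_add) (simp_all add: span_mul span_base)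
    with mult show False by auto
  qed
  with mult show ?case
    by (simp add: kill_mult kill_vec sym_mult_eq_0_iff proj_off_eq_0_iff)
qed simp

text \<open>More than lying in no prime of a plane: the witness is itself a product of linear forms.
  In dimension two the only plane is the whole space, and the witness must be \<open>1\<close>; in
  dimension one the condition is empty, hence the bound on the dimension below.\<close>

definition ample :: "'n::finite sym_alg set \<Rightarrow> bool" where
  "ample J \<longleftrightarrow> (\<forall>H. subspace H \<longrightarrow> dim H = 2 \<longrightarrow> (\<exists>u\<in>J. vec_prod H u))"

lemma dim_span_pair:
  fixes l m :: "real ^ 'n::finite"
  assumes "l \<noteq> 0" "m \<notin> span {l}"
  shows "dim (span {l, m}) = 2"
  using assms by (simp add: insert_commute[of l] dim_insert)

text \<open>The dimension bound provides a plane through the line, and forms outside the plane are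
  outside the line.\<close>

lemma ample_line:
  fixes l :: "real ^ 'n::finite"
  assumes "ample J" "CARD('n) \<ge> 2" "l \<noteq> 0"
  shows "\<exists>u\<in>J. vec_prod (span {l}) u"
proof -
  have "dim (span {l}) < DIM(real ^ 'n)"
    using assms by (simp add: dim_insert)
  then obtain m where m: "m \<notin> span {l}"
    by (metis dim_UNIV UNIV_eq_I nless_le)
  obtain u where "u \<in> J" "vec_prod (span {l, m}) u"
    using assms(1) dim_span_pair[OF assms(3) m] subspace_span unfolding ample_def by metis
  moreover have "span {l} \<subseteq> span {l, m}" by (rule span_mono) auto
  ultimately show ?thesis using vec_prod_antimono by blast
qed

text \<open>A cocycle with values in the domain \<open>S / (l)\<close> is multiplication by a fraction; its
  denominator can be cleared one linear factor \<open>v\<close> at a time, because some element of \<open>J\<close> avoids the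
  plane of \<open>l\<close> and \<open>v\<close>.\<close>

lemma cocycle_mod_vec:
  fixes l :: "real ^ 'n::finite" and c :: "'n sym_alg \<Rightarrow> 'n sym_alg"
  assumes J: "ample J" "CARD('n) \<ge> 2" and l: "l \<noteq> 0"
    and cocycle: "\<And>b b'. b \<in> J \<Longrightarrow> b' \<in> J \<Longrightarrow> sym_vec l dvd b' * c b - b * c b'"
  shows "\<exists>d. \<forall>b\<in>J. sym_vec l dvd c b - b * d"
proof -
  have cocycle': "kill l b' * kill l (c b) = kill l b * kill l (c b')" if "b \<in> J" "b' \<in> J" for b b'
    using cocycle[OF that] by (simp add: sym_vec_dvd_iff kill_diff kill_mult)
  obtain b0 where b0: "b0 \<in> J" "vec_prod (span {l}) b0"
    using ample_line[OF J l] by blast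
  \<comment> \<open>\<open>u\<close> runs through divisors of \<open>b0\<close> from
    \<open>1\<close> up to \<open>b0\<close> itself, with cofactor \<open>w\<close>; at each stage
    \<open>c b0\<close> is divisible by \<open>u\<close> modulo \<open>l\<close>.\<close>
  have "vec_prod (span {l}) u \<Longrightarrow> b0 = u * w \<Longrightarrow> \<exists>d. kill l (c b0) = kill l d * kill l u" for u w
  proof (induction arbitrary: w rule: vec_prod.induct)
    case one
    show ?case by (intro exI[of _ "c b0"]) simp
  next
    case (mult v u)
    then obtain d where d: "kill l (c b0) = kill l d * kill l u"
      using mult.IH[of "sym_vec v * w"] by (auto simp: mult_ac)
    have u: "kill l u \<noteq> 0" using kill_vec_prod_nonzero[OF mult(2)] by simp
    obtain b where b: "b \<in> J" "vec_prod (span {l, v}) b"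
      using J(1) dim_span_pair[OF l mult(1)] subspace_span unfolding ample_def by metis
    let ?m = "proj_off l v"
    have "kill l b * (kill l d * kill l u) = kill l u * (sym_vec ?m * kill l w) * kill l (c b)"
      using cocycle'[OF b0(1) b(1)] mult.prems d by (simp add: kill_mult kill_vec mult_ac)
    then have "kill l u * (kill l b * kill l d) = kill l u * (sym_vec ?m * (kill l w * kill l (c b)))"
      by (simp add: mult_ac)
    then have "kill l b * kill l d = sym_vec ?m * (kill l w * kill l (c b))"
      using u sym_mult_left_cancel by blast
    then have "sym_vec ?m dvd kill l b * kill l d" by simp
    moreover have "\<not> sym_vec ?m dvd kill l b"
      using kill_kill_vec_prod_nonzero[OF b(2)] by (simp add: sym_vec_dvd_iff)
    ultimately obtain e where e: "kill l d = sym_vec ?m * e"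
      using sym_vec_prime by (blast elim: dvdE)
    \<comment> \<open>\<open>kill l\<close> is idempotent, so applying it once more replaces the
      cofactor \<open>e\<close> by its image.\<close>
    have "kill l d = kill l (sym_vec v) * kill l e"
      by (metis e kill_kill kill_mult kill_vec)
    then show ?case
      using d by (intro exI[of _ e]) (simp add: kill_mult mult_ac)
  qed
  from this[OF b0(2), of 1] obtain d where d: "kill l (c b0) = kill l d * kill l b0" by auto
  have "sym_vec l dvd c b - b * d" if "b \<in> J" for b
  proof -
    have "kill l b0 * kill l (c b) = kill l b0 * (kill l b * kill l d)"
      using cocycle'[OF that b0(1)] d by (simp add: mult_ac)
    then have "kill l (c b) = kill l b * kill l d"
      using kill_vec_prod_nonzero[OF b0(2)] sym_mult_left_cancel by blast
    then show ?thesis by (simp add: sym_vec_dvd_iff kill_diff kill_mult)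
  qed
  then show ?thesis by blast
qed

text \<open>One factor \<open>v\<close> at a time: once \<open>c\<close> is corrected to be
  divisible by \<open>v\<close>, the quotient is a cocycle modulo the remaining factors, and the
  corrections add up as \<open>d + v d'\<close>.\<close>

lemma cocycle_mod_prod:
  fixes a :: "'n::finite sym_alg" and c :: "'n sym_alg \<Rightarrow> 'n sym_alg"
  assumes J: "ample J" "CARD('n) \<ge> 2" and a: "vec_prod {0} a"
    and cocycle: "\<And>b b'. b \<in> J \<Longrightarrow> b' \<in> J \<Longrightarrow> a dvd b' * c b - b * c b'"
  shows "\<exists>d. \<forall>b\<in>J. a dvd c b - b * d"
  using a cocycle
proof (induction arbitrary: c rule: vec_prod.induct)
  case (mult v a)
  then have v: "v \<noteq> 0" by simp
  obtain d where d: "\<forall>b\<in>J. sym_vec v dvd c b - b * d"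
    using cocycle_mod_vec[OF J v, of c] mult.prems by (meson dvd_mult_left)
  then obtain c' where c': "\<And>b. b \<in> J \<Longrightarrow> c b - b * d = sym_vec v * c' b"
    unfolding dvd_def by metis
  have "a dvd b' * c' b - b * c' b'" if b: "b \<in> J" "b' \<in> J" for b b'
  proof -
    obtain e where e: "b' * c b - b * c b' = sym_vec v * a * e"
      using mult.prems[OF b] by (elim dvdE)
    have "b' * c b - b * c b' = b' * (c b - b * d) - b * (c b' - b' * d)"
      by (simp add: algebra_simps)
    also have "\<dots> = sym_vec v * (b' * c' b - b * c' b')"
      by (simp only: c' b) (simp add: algebra_simps)
    finally have "sym_vec v * (b' * c' b - b * c' b') = sym_vec v * (a * e)"
      using e by (simp add: mult_ac)
    then show ?thesis
      using sym_mult_left_cancel[of "sym_vec v"] v by simp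
  qed
  from mult.IH[OF this] obtain d' where d': "\<forall>b\<in>J. a dvd c' b - b * d'" by blast
  have "sym_vec v * a dvd c b - b * (d + sym_vec v * d')" if "b \<in> J" for b
  proof -
    have "c b - b * (d + sym_vec v * d') = (c b - b * d) - sym_vec v * (b * d')"
      by (simp add: algebra_simps)
    also have "\<dots> = sym_vec v * (c' b - b * d')"
      by (simp only: c' that) (simp add: algebra_simps)
    finally show ?thesis using d' that by (simp add: mult_dvd_mono)
  qed
  then show ?case by blast
qed simp

text \<open>Each linear factor of \<open>a\<close> fails to divide some element of \<open>J\<close>;
  being prime, it divides \<open>f\<close> instead.\<close>

lemma ample_dvd:
  fixes a :: "'n::finite sym_alg"
  assumes J: "ample J" "CARD('n) \<ge> 2" and a: "vec_prod {0} a"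
    and dvd: "\<And>b. b \<in> J \<Longrightarrow> a dvd b * f"
  shows "a dvd f"
  using a dvd
proof (induction arbitrary: f rule: vec_prod.induct)
  case (mult v a)
  then have v: "v \<noteq> 0" by simp
  obtain b where b: "b \<in> J" "vec_prod (span {v}) b"
    using ample_line[OF J v] by blast
  have "sym_vec v dvd b * f" using mult.prems[OF b(1)] by (rule dvd_mult_left)
  moreover have "\<not> sym_vec v dvd b"
    using kill_vec_prod_nonzero[OF b(2)] by (simp add: sym_vec_dvd_iff)
  ultimately obtain g where g: "f = sym_vec v * g"
    using sym_vec_prime by (blast elim: dvdE)
  have "a dvd b * g" if "b \<in> J" for b
  proof -
    obtain e where "b * f = sym_vec v * a * e" using mult.prems[OF \<open>b \<in> J\<close>] by (elim dvdE)
    then have "sym_vec v * (b * g) = sym_vec v * (a * e)" by (simp add: g mult_ac)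
    then show ?thesis using sym_mult_left_cancel[of "sym_vec v"] v by simp
  qed
  from mult.IH[OF this] show ?case by (simp add: g mult_dvd_mono)
qed simp

lemma sum_apply: "(\<Sum>x\<in>A. f x) v = (\<Sum>x\<in>A. f x v)"
  by (induction A rule: infinite_finite_induct) simp_all

subsection \<open>Flow-up classes\<close>

text \<open>What a skeleton shares with its slices, lone vertices included, so that the theory of
  flow-up classes built on it serves both.\<close>

locale axial_skeleton =
  fixes \<Gamma> :: "('v, 'n::finite) skeleton"
  assumes finite_verts: "finite (skel_verts \<Gamma>)"
    and edge_verts: "(p, q) \<in> skel_edges \<Gamma> \<Longrightarrow> p \<in> skel_verts \<Gamma> \<and> q \<in> skel_verts \<Gamma>"
    and edge_sym: "(p, q) \<in> skel_edges \<Gamma> \<Longrightarrow> (q, p) \<in> skel_edges \<Gamma>"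
    and reverse: "(p, q) \<in> skel_edges \<Gamma> \<Longrightarrow> axial \<Gamma> (q, p) = - axial \<Gamma> (p, q)"
    and nonparallel: "(p, q) \<in> skel_edges \<Gamma> \<Longrightarrow> (p, q') \<in> skel_edges \<Gamma> \<Longrightarrow> q \<noteq> q' \<Longrightarrow>
      axial \<Gamma> (p, q) \<notin> span {axial \<Gamma> (p, q')}"
begin

lemma finite_edges: "finite (skel_edges \<Gamma>)"
  by (rule finite_subset[of _ "skel_verts \<Gamma> \<times> skel_verts \<Gamma>"]) (use edge_verts finite_verts in auto)

lemma edge_reverse_linear:
  "linear \<xi> \<Longrightarrow> (p, q) \<in> skel_edges \<Gamma> \<Longrightarrow> \<xi> (axial \<Gamma> (q, p)) = - \<xi> (axial \<Gamma> (p, q))"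
  by (simp add: reverse linear_neg)

end

locale ranked_skeleton = axial_skeleton \<Gamma>
  for \<Gamma> :: "('v, 'n::finite) skeleton" +
  fixes \<xi> :: "real ^ 'n \<Rightarrow> real" and r :: "'v \<Rightarrow> nat"
  assumes polarizing: "polarizing \<Gamma> \<xi>"
    and rank_inj: "inj_on r (skel_verts \<Gamma>)"
    and rank_mono: "(p, q) \<in> skel_edges \<Gamma> \<Longrightarrow> \<xi> (axial \<Gamma> (p, q)) > 0 \<Longrightarrow> r p < r q"
begin

lemma xi_nonzero: "e \<in> skel_edges \<Gamma> \<Longrightarrow> \<xi> (axial \<Gamma> e) \<noteq> 0"
  using polarizing by (simp add: polarizing_def)

lemma axial_nonzero: "e \<in> skel_edges \<Gamma> \<Longrightarrow> axial \<Gamma> e \<noteq> 0"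
  using xi_nonzero polarizing by (force simp: polarizing_def linear_0)

lemma rank_antimono:
  assumes "(p, q) \<in> skel_edges \<Gamma>" "\<xi> (axial \<Gamma> (p, q)) < 0"
  shows "r q < r p"
proof -
  have "\<xi> (axial \<Gamma> (q, p)) = - \<xi> (axial \<Gamma> (p, q))"
    using polarizing assms(1) by (simp add: polarizing_def edge_reverse_linear)
  then show ?thesis using rank_mono[of q p] edge_sym[OF assms(1)] assms by simp
qed

definition down :: "'v \<Rightarrow> ('v \<times> 'v) set" where
  "down p = {e \<in> skel_edges \<Gamma>. fst e = p \<and> \<xi> (axial \<Gamma> e) < 0}"

definition thom :: "'v \<Rightarrow> 'n sym_alg" where
  "thom p = (\<Prod>e\<in>down p. sym_vec (axial \<Gamma> e))"

lemma finite_down: "finite (down p)"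
  using finite_edges by (simp add: down_def)

lemma ind_eq: "ind \<Gamma> \<xi> p = card (down p)"
  unfolding ind_def down_def out_arcs_def
  by (rule arg_cong[of _ _ card]) auto

lemma homogeneous_thom: "homogeneous (ind \<Gamma> \<xi> p) (thom p)"
  by (simp add: thom_def ind_eq homogeneous_prod_vec)

lemma thom_nonzero: "thom p \<noteq> 0"
  using finite_down axial_nonzero by (auto simp: thom_def sym_prod_eq_0_iff down_def)

definition vanishes_below :: "nat \<Rightarrow> ('v \<Rightarrow> 'n sym_alg) \<Rightarrow> bool" where
  "vanishes_below n f \<longleftrightarrow> (\<forall>q\<in>skel_verts \<Gamma>. r q < n \<longrightarrow> f q = 0)"

definition flow_up :: "'v \<Rightarrow> ('v \<Rightarrow> 'n sym_alg) \<Rightarrow> bool" where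
  "flow_up p f \<longleftrightarrow> f \<in> eqcoh \<Gamma> \<and> vanishes_below (r p) f \<and> f p = thom p"

lemma eqcoh_iff: "f \<in> eqcoh \<Gamma> \<longleftrightarrow> (\<forall>p. p \<notin> skel_verts \<Gamma> \<longrightarrow> f p = 0) \<and>
    (\<forall>p q. (p, q) \<in> skel_edges \<Gamma> \<longrightarrow> sym_vec (axial \<Gamma> (p, q)) dvd f q - f p)"
  by (auto simp: eqcoh_def)

lemma eqcoh_edge:
  "f \<in> eqcoh \<Gamma> \<Longrightarrow> (p, q) \<in> skel_edges \<Gamma> \<Longrightarrow> sym_vec (axial \<Gamma> (p, q)) dvd f q - f p"
  by (simp add: eqcoh_iff)

lemma eqcoh_0: "(\<lambda>v. 0) \<in> eqcoh \<Gamma>"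
  by (simp add: eqcoh_iff)

lemma eqcoh_add: "f \<in> eqcoh \<Gamma> \<Longrightarrow> g \<in> eqcoh \<Gamma> \<Longrightarrow> (\<lambda>v. f v + g v) \<in> eqcoh \<Gamma>"
  using sym_module.subspace_add[OF subspace_eqcoh] by (simp add: plus_fun_def)

lemma eqcoh_mult: "f \<in> eqcoh \<Gamma> \<Longrightarrow> (\<lambda>v. c * f v) \<in> eqcoh \<Gamma>"
  using sym_module.subspace_scale[OF subspace_eqcoh] by (simp add: sym_scale_def)

lemma eqcoh_diff: "f \<in> eqcoh \<Gamma> \<Longrightarrow> g \<in> eqcoh \<Gamma> \<Longrightarrow> (\<lambda>v. f v - g v) \<in> eqcoh \<Gamma>"
  using sym_module.subspace_diff[OF subspace_eqcoh] by (simp add: fun_diff_def)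

lemma eqcoh_sum:
  "(\<And>x. x \<in> A \<Longrightarrow> f x \<in> eqcoh \<Gamma>) \<Longrightarrow> (\<lambda>v. \<Sum>x\<in>A. c x * f x v) \<in> eqcoh \<Gamma>"
proof (induction A rule: infinite_finite_induct)
  case (insert x A)
  then have "(\<lambda>v. c x * f x v + (\<Sum>x\<in>A. c x * f x v)) \<in> eqcoh \<Gamma>"
    by (intro eqcoh_add eqcoh_mult) auto
  with insert(1,2) show ?case by simp
qed (simp_all add: eqcoh_0)

lemma eqcoh_hcomp:
  assumes "f \<in> eqcoh \<Gamma>"
  shows "(\<lambda>v. hcomp k (f v)) \<in> eqcoh \<Gamma>"
proof -
  have "sym_vec (axial \<Gamma> (p, q)) dvd hcomp k (f q) - hcomp k (f p)"
    if e: "(p, q) \<in> skel_edges \<Gamma>" for p q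
  proof -
    obtain g where "f q - f p = sym_vec (axial \<Gamma> (p, q)) * g"
      using eqcoh_edge[OF assms e] by (elim dvdE)
    then show ?thesis
      by (simp add: hcomp_diff[symmetric] hcomp_mult_homogeneous[OF homogeneous_vec])
  qed
  with assms show ?thesis by (simp add: eqcoh_iff)
qed

text \<open>\<open>f\<close> vanishes at the lower end of every edge descending from
  \<open>p\<close>, so each of these pairwise nonparallel axial vectors divides
  \<open>f p\<close>.\<close>

lemma thom_dvd:
  assumes f: "f \<in> eqcoh \<Gamma>" "vanishes_below (r p) f"
  shows "thom p dvd f p"
  unfolding thom_def
proof (rule prod_sym_vec_dvd)
  fix e assume "e \<in> down p"
  then obtain q where e: "e = (p, q)" "(p, q) \<in> skel_edges \<Gamma>" "\<xi> (axial \<Gamma> (p, q)) < 0"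
    by (cases e) (auto simp: down_def)
  then have "r q < r p" by (intro rank_antimono)
  then have "f q = 0" using f(2) edge_verts[OF e(2)] by (auto simp: vanishes_below_def)
  then show "sym_vec (axial \<Gamma> e) dvd f p"
    using eqcoh_edge[OF f(1) e(2)] e(1) by simp
next
  fix x y assume "x \<in> down p" "y \<in> down p" "x \<noteq> y"
  then show "axial \<Gamma> x \<notin> span {axial \<Gamma> y}"
    by (cases x; cases y) (auto simp: down_def nonparallel)
qed (rule finite_down)

lemma flow_up_hcomp: "flow_up p f \<Longrightarrow> flow_up p (\<lambda>v. hcomp (ind \<Gamma> \<xi> p) (f v))"
  using homogeneous_thom[of p]
  by (simp add: flow_up_def eqcoh_hcomp vanishes_below_def homogeneous_iff_hcomp)

lemma vanishes_below_Suc: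
  assumes "vanishes_below (r p) f" "f p = 0" "p \<in> skel_verts \<Gamma>"
  shows "vanishes_below (Suc (r p)) f"
  unfolding vanishes_below_def
proof (intro ballI impI)
  fix q assume "q \<in> skel_verts \<Gamma>" "r q < Suc (r p)"
  then show "f q = 0"
    using assms rank_inj by (cases "r q = r p") (auto simp: vanishes_below_def inj_on_def)
qed

text \<open>Cancelling the value at the lowest vertex of the support moves that vertex up;
  \<open>m\<close> counts the vertices at or above it.\<close>

lemma lead_induct [consumes 1, case_names zero step]:
  assumes "f \<in> eqcoh \<Gamma>" and zero: "P (\<lambda>v. 0)"
    and step: "\<And>g p. g \<in> eqcoh \<Gamma> \<Longrightarrow> p \<in> skel_verts \<Gamma> \<Longrightarrow> g p \<noteq> 0 \<Longrightarrow> vanishes_below (r p) g \<Longrightarrow>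
      (\<And>h. h \<in> eqcoh \<Gamma> \<Longrightarrow> vanishes_below (Suc (r p)) h \<Longrightarrow> P h) \<Longrightarrow> P g"
  shows "P f"
proof -
  define m where "m f = card {q \<in> skel_verts \<Gamma>. \<exists>s\<in>skel_verts \<Gamma>. f s \<noteq> 0 \<and> r s \<le> r q}"
    for f :: "'v \<Rightarrow> 'n sym_alg"
  show ?thesis using assms(1)
  proof (induction "m f" arbitrary: f rule: less_induct)
    case less
    show ?case
    proof (cases "\<exists>s\<in>skel_verts \<Gamma>. f s \<noteq> 0")
      case False
      then have "f = (\<lambda>v. 0)" using less.prems by (auto simp: eqcoh_iff)
      then show ?thesis using zero by simp
    next
      case True
      define p where "p = arg_min r (\<lambda>s. s \<in> skel_verts \<Gamma> \<and> f s \<noteq> 0)"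
      have p: "p \<in> skel_verts \<Gamma>" "f p \<noteq> 0"
        and min: "\<And>s. s \<in> skel_verts \<Gamma> \<Longrightarrow> f s \<noteq> 0 \<Longrightarrow> r p \<le> r s"
        using True arg_min_natI[of "\<lambda>s. s \<in> skel_verts \<Gamma> \<and> f s \<noteq> 0" _ r]
          arg_min_nat_le[of "\<lambda>s. s \<in> skel_verts \<Gamma> \<and> f s \<noteq> 0" _ r]
        by (auto simp: p_def)
      show ?thesis
      proof (rule step[OF less.prems p])
        show "vanishes_below (r p) f"
          using min by (fastforce simp: vanishes_below_def)
        fix h assume h: "h \<in> eqcoh \<Gamma>" "vanishes_below (Suc (r p)) h"
        have "m h < m f"
          unfolding m_def
        proof (rule psubset_card_mono)
          show "{q \<in> skel_verts \<Gamma>. \<exists>s\<in>skel_verts \<Gamma>. h s \<noteq> 0 \<and> r s \<le> r q} \<subset>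
              {q \<in> skel_verts \<Gamma>. \<exists>s\<in>skel_verts \<Gamma>. f s \<noteq> 0 \<and> r s \<le> r q}" (is "?A \<subset> ?B")
          proof
            show "?A \<subseteq> ?B"
            proof
              fix q assume "q \<in> ?A"
              then obtain s where "q \<in> skel_verts \<Gamma>" "s \<in> skel_verts \<Gamma>" "h s \<noteq> 0" "r s \<le> r q" by auto
              moreover have "r p < r s"
                using h(2) calculation by (force simp: vanishes_below_def)
              ultimately show "q \<in> ?B" using p by auto
            qed
            have "p \<in> ?B" using p by auto
            moreover have "p \<notin> ?A" using h(2) by (auto simp: vanishes_below_def less_Suc_eq_le)
            ultimately show "?A \<noteq> ?B" by blast
          qed
        qed (use finite_verts in simp)
        then show "P h" using less.hyps h(1) by blast
      qed
    qed
  qed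
qed

text \<open>Triangular elimination: by \<open>thom_dvd\<close> a multiple of the flow-up class at
  the lowest support vertex cancels the leading value. The threshold \<open>n\<close> serves both
  spanning (\<open>0\<close>) and the classes strictly above a vertex.\<close>

lemma flow_up_expand:
  assumes F: "\<And>q. q \<in> skel_verts \<Gamma> \<Longrightarrow> n \<le> r q \<Longrightarrow> flow_up q (F q)"
    and "h \<in> eqcoh \<Gamma>" "vanishes_below n h"
  shows "\<exists>c. h = (\<lambda>v. \<Sum>q\<in>{q\<in>skel_verts \<Gamma>. n \<le> r q}. c q * F q v)"
  using assms(2,3)
proof (induction rule: lead_induct)
  case zero
  show ?case by (intro exI[of _ "\<lambda>_. 0"]) simp
next
  case (step h p)
  let ?U = "{q\<in>skel_verts \<Gamma>. n \<le> r q}"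
  have p: "p \<in> ?U" using step by (force simp: vanishes_below_def)
  then have Fp: "F p \<in> eqcoh \<Gamma>" "vanishes_below (r p) (F p)" "F p p = thom p"
    using F[of p] by (auto simp: flow_up_def)
  obtain s where s: "h p = thom p * s"
    using thom_dvd[OF step(1,4)] by (elim dvdE)
  let ?h = "\<lambda>v. h v - s * F p v"
  have h: "?h \<in> eqcoh \<Gamma>" using step(1) Fp(1) by (intro eqcoh_diff eqcoh_mult)
  moreover have van: "vanishes_below (Suc (r p)) ?h"
    using step(2,4) Fp s by (intro vanishes_below_Suc) (auto simp: vanishes_below_def mult.commute)
  moreover have "vanishes_below n ?h"
    using van p by (auto simp: vanishes_below_def)
  ultimately obtain c where c: "?h = (\<lambda>v. \<Sum>q\<in>?U. c q * F q v)"
    using step(5) by blast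
  have "h = (\<lambda>v. \<Sum>q\<in>?U. (c q + (if q = p then s else 0)) * F q v)"
  proof
    fix v
    have "(\<Sum>q\<in>?U. (if q = p then s else 0) * F q v) = (\<Sum>q\<in>?U. if q = p then s * F p v else 0)"
      by (intro sum.cong) auto
    also have "\<dots> = s * F p v" using p finite_verts by simp
    finally show "h v = (\<Sum>q\<in>?U. (c q + (if q = p then s else 0)) * F q v)"
      using fun_cong[OF c, of v] by (simp add: distrib_right sum.distrib algebra_simps)
  qed
  then show ?case by (intro exI[of _ "\<lambda>q. c q + (if q = p then s else 0)"])
qed

text \<open>Triangularity once more: once the coefficients at lower vertices vanish, only the class
  of \<open>q\<close> itself contributes at \<open>q\<close>.\<close>

lemma flow_up_independent:
  assumes F: "\<And>q. q \<in> U \<Longrightarrow> flow_up q (F q)" and U: "U \<subseteq> skel_verts \<Gamma>"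
    and 0: "\<And>v. v \<in> U \<Longrightarrow> (\<Sum>q\<in>U. c q * F q v) = 0"
    and "q \<in> U"
  shows "c q = 0"
  using \<open>q \<in> U\<close>
proof (induction "r q" arbitrary: q rule: less_induct)
  case less
  have fin: "finite U" using U finite_verts finite_subset by blast
  have "c q' * F q' q = 0" if "q' \<in> U - {q}" for q'
  proof (cases "r q' < r q")
    case True
    then show ?thesis using less that by simp
  next
    case False
    have "r q' \<noteq> r q" using that less.prems U rank_inj by (auto simp: inj_on_def)
    then have "F q' q = 0"
      using False F[of q'] that less.prems U by (auto simp: flow_up_def vanishes_below_def)
    then show ?thesis by simp
  qed
  then have "(\<Sum>q'\<in>U. c q' * F q' q) = c q * F q q"
    using less.prems fin by (simp add: sum.remove[of U q])
  then have "c q * thom q = 0" using 0[of q] F[of q] less.prems by (simp add: flow_up_def)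
  then show "c q = 0" by (simp add: sym_mult_eq_0_iff thom_nonzero)
qed

lemma graded_free_if_flow_up:
  assumes "\<And>p. p \<in> skel_verts \<Gamma> \<Longrightarrow> \<exists>f. flow_up p f"
  shows "graded_free (eqcoh \<Gamma>) (betti \<Gamma> \<xi>)"
proof -
  let ?V = "skel_verts \<Gamma>"
  \<comment> \<open>The component in the degree of the Thom value is still a flow-up class, which
    makes the basis homogeneous of the right degrees.\<close>
  define F where "F p v = hcomp (ind \<Gamma> \<xi> p) ((SOME f. flow_up p f) v)" for p v
  have F: "flow_up p (F p)" if "p \<in> ?V" for p
    unfolding F_def by (rule flow_up_hcomp[OF someI_ex[OF assms[OF that]]])
  have hom: "homogeneous (ind \<Gamma> \<xi> p) (F p v)" for p v
    by (simp add: F_def)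
  have inj: "inj_on F ?V"
  proof (rule inj_onI)
    fix p q assume pq: "p \<in> ?V" "q \<in> ?V" "F p = F q"
    have "\<not> r s < r t" if "s \<in> ?V" "t \<in> ?V" "F s = F t" for s t
    proof
      assume "r s < r t"
      then have "F t s = 0"
        using F[OF that(2)] that(1) unfolding flow_up_def vanishes_below_def by blast
      moreover have "F s s \<noteq> 0"
        using F[OF that(1)] thom_nonzero[of s] unfolding flow_up_def by simp
      ultimately show False using that(3) by simp
    qed
    from this[of p q] this[of q p] pq have "r p = r q" by auto
    then show "p = q" using pq rank_inj by (auto simp: inj_on_def)
  qed
  let ?B = "F ` ?V"
  have sum_F: "(\<Sum>b\<in>?B. sym_scale (u b) b) = (\<lambda>v. \<Sum>q\<in>?V. u (F q) * F q v)" for u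
    by (simp add: sum.reindex[OF inj] sym_scale_def fun_eq_iff sum_apply)
  have indep: "sym_module.independent ?B"
  proof -
    have "u (F p) = 0" if "(\<Sum>b\<in>?B. sym_scale (u b) b) = 0" "p \<in> ?V" for u p
      using flow_up_independent[of ?V F "\<lambda>q. u (F q)" p] F that unfolding sum_F
      by (simp add: fun_eq_iff)
    then show ?thesis
      using sym_module.dependent_finite[of ?B] finite_verts by auto
  qed
  have span: "sym_module.span ?B = eqcoh \<Gamma>"
  proof
    show "sym_module.span ?B \<subseteq> eqcoh \<Gamma>"
      using F by (intro sym_module.span_minimal subspace_eqcoh) (auto simp: flow_up_def)
    show "eqcoh \<Gamma> \<subseteq> sym_module.span ?B"
    proof
      fix h assume "h \<in> eqcoh \<Gamma>"
      then obtain c where c: "h = (\<lambda>v. \<Sum>q\<in>?V. c q * F q v)"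
        using flow_up_expand[of 0 F h] F by (auto simp: vanishes_below_def)
      have "h = (\<Sum>q\<in>?V. sym_scale (c q) (F q))"
        by (simp add: c fun_eq_iff sum_apply sym_scale_def)
      also have "\<dots> \<in> sym_module.span ?B"
        by (intro sym_module.span_sum sym_module.span_scale sym_module.span_base) simp
      finally show "h \<in> sym_module.span ?B" .
    qed
  qed
  have card: "card {f \<in> ?B. \<forall>p. homogeneous i (f p)} = betti \<Gamma> \<xi> i" for i
  proof -
    have "(\<forall>v. homogeneous i (F p v)) \<longleftrightarrow> ind \<Gamma> \<xi> p = i" if "p \<in> ?V" for p
    proof
      assume "\<forall>v. homogeneous i (F p v)"
      then have "homogeneous i (F p p)" by blast
      then show "ind \<Gamma> \<xi> p = i"
        using hom[of p p] F[OF that] thom_nonzero[of p] homogeneous_unique by (auto simp: flow_up_def)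
    qed (use hom in auto)
    then have "{f \<in> ?B. \<forall>p. homogeneous i (f p)} = F ` {p \<in> ?V. ind \<Gamma> \<xi> p = i}" by auto
    also have "card \<dots> = betti \<Gamma> \<xi> i"
      unfolding betti_def by (rule card_image) (rule inj_on_subset[OF inj], auto)
    finally show ?thesis .
  qed
  have homB: "\<forall>f\<in>?B. \<exists>k. \<forall>v. homogeneous k (f v)"
  proof (rule ballI, elim imageE)
    fix f p assume f: "f = F p"
    show "\<exists>k. \<forall>v. homogeneous k (f v)"
      by (rule exI[of _ "ind \<Gamma> \<xi> p"], rule allI, subst f, rule hom)
  qed
  show ?thesis
    unfolding graded_free_def
    by (intro exI[of _ ?B] conjI allI indep span card homB finite_imageI finite_verts)
qed

end

text \<open>Gaussian elimination with more unknowns \<open>B\<close> than equations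
  \<open>A\<close>: equation \<open>a\<close> is solved for the unknown \<open>b0\<close>, and
  \<open>N\<close> is the reduced matrix.\<close>

lemma underdetermined_system:
  fixes M :: "'b \<Rightarrow> 'a \<Rightarrow> real"
  assumes "finite A" "finite B" "card A < card B"
  shows "\<exists>x. (\<exists>b\<in>B. x b \<noteq> 0) \<and> (\<forall>a\<in>A. (\<Sum>b\<in>B. x b * M b a) = 0)"
  using assms
proof (induction A arbitrary: B M rule: finite_induct)
  case empty
  then have "B \<noteq> {}" by auto
  then show ?case by (intro exI[of _ "\<lambda>_. 1"]) auto
next
  case (insert a A)
  show ?case
  proof (cases "\<forall>b\<in>B. M b a = 0")
    case True
    have "card A < card B" using insert by simp
    then obtain x where "\<exists>b\<in>B. x b \<noteq> 0" "\<forall>a\<in>A. (\<Sum>b\<in>B. x b * M b a) = 0"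
      using insert.IH[OF insert.prems(1)] by blast
    with True show ?thesis by (intro exI[of _ x]) auto
  next
    case False
    then obtain b0 where b0: "b0 \<in> B" "M b0 a \<noteq> 0" by blast
    define N where "N b a' = M b a' - M b a / M b0 a * M b0 a'" for b a'
    have "card A < card (B - {b0})" using insert b0 by simp
    then obtain x where x: "\<exists>b\<in>B - {b0}. x b \<noteq> 0"
      "\<And>a'. a' \<in> A \<Longrightarrow> (\<Sum>b\<in>B - {b0}. x b * N b a') = 0"
      using insert.IH[of "B - {b0}" N] insert.prems(1) by auto
    define y where "y b = (if b = b0 then - (\<Sum>b\<in>B - {b0}. x b * M b a) / M b0 a else x b)" for b
    have y0: "y b0 * M b0 a' = - (\<Sum>b\<in>B - {b0}. x b * M b a) * (M b0 a' / M b0 a)" for a'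
      by (simp add: y_def)
    have split: "(\<Sum>b\<in>B. y b * M b a') = y b0 * M b0 a' + (\<Sum>b\<in>B - {b0}. x b * M b a')" for a'
      using b0 insert.prems(1) by (simp add: sum.remove[of B b0] y_def)
    have "(\<Sum>b\<in>B. y b * M b a') = 0" if "a' \<in> insert a A" for a'
    proof (cases "a' = a")
      case True
      then show ?thesis using b0(2) unfolding split y0 by simp
    next
      case False
      then have "a' \<in> A" using that by simp
      have "(\<Sum>b\<in>B - {b0}. x b * N b a') =
          (\<Sum>b\<in>B - {b0}. x b * M b a' - x b * M b a * (M b0 a' / M b0 a))"
        by (intro sum.cong) (simp_all add: N_def algebra_simps)
      also have "\<dots> = (\<Sum>b\<in>B - {b0}. x b * M b a') - (\<Sum>b\<in>B - {b0}. x b * M b a) * (M b0 a' / M b0 a)"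
        by (simp only: sum_subtractf sum_distrib_right)
      also have "\<dots> = (\<Sum>b\<in>B. y b * M b a')"
        unfolding split y0 by simp
      finally show ?thesis using x(2)[OF \<open>a' \<in> A\<close>] by simp
    qed
    moreover have "\<exists>b\<in>B. y b \<noteq> 0" using x(1) by (auto simp: y_def)
    ultimately show ?thesis by blast
  qed
qed

section \<open>Existence of flow-up classes, from ampleness and from freeness\<close>

context ranked_skeleton
begin

text \<open>The Thom value divides every possible leading value at \<open>p\<close>
  (\<open>thom_dvd\<close>); this is the ideal of quotients, and a flow-up class exists exactly when
  it contains \<open>1\<close>.\<close>

definition leading :: "'v \<Rightarrow> 'n sym_alg set" where
  "leading p = {b. \<exists>f\<in>eqcoh \<Gamma>. vanishes_below (r p) f \<and> f p = b * thom p}"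

text \<open>The classes \<open>F b\<close> with leading value \<open>b\<close> times the Thom value at \<open>p\<close> satisfy
  \<open>a * F b - b * F a = \<Sum> D b a q * G q\<close> with \<open>G q\<close> the flow-up classes above \<open>p\<close>. Splitting the cocycles
  \<open>D _ a q\<close> modulo \<open>a\<close> corrects \<open>F a\<close> to a multiple of \<open>a\<close>, and the quotient is the flow-up class.\<close>

lemma flow_up_if_ample:
  assumes n: "CARD('n) \<ge> 2" and p: "p \<in> skel_verts \<Gamma>"
    and above: "\<And>q. q \<in> skel_verts \<Gamma> \<Longrightarrow> r p < r q \<Longrightarrow> \<exists>f. flow_up q f"
    and ample: "ample (leading p)"
  shows "\<exists>f. flow_up p f"
proof -
  let ?J = "leading p" and ?W = "{q \<in> skel_verts \<Gamma>. Suc (r p) \<le> r q}"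
  define F where "F b = (SOME f. f \<in> eqcoh \<Gamma> \<and> vanishes_below (r p) f \<and> f p = b * thom p)" for b
  define G where "G q = (SOME f. flow_up q f)" for q
  have F: "F b \<in> eqcoh \<Gamma>" "vanishes_below (r p) (F b)" "F b p = b * thom p" if "b \<in> ?J" for b
    using that someI_ex[of "\<lambda>f. f \<in> eqcoh \<Gamma> \<and> vanishes_below (r p) f \<and> f p = b * thom p"]
    by (auto simp: leading_def F_def)
  have G: "flow_up q (G q)" if "q \<in> ?W" for q
    unfolding G_def using that by (intro someI_ex[OF above]) auto
  have comb: "(\<lambda>v. \<Sum>q\<in>?W. c q * G q v) \<in> eqcoh \<Gamma>" for c
    using G by (intro eqcoh_sum) (auto simp: flow_up_def)
  have comb_below: "(\<Sum>q\<in>?W. c q * G q v) = 0" if "v \<in> skel_verts \<Gamma>" "r v \<le> r p" for c v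
    using G that by (intro sum.neutral) (fastforce simp: flow_up_def vanishes_below_def)
  have ex_D: "\<exists>c. (\<lambda>v. b' * F b v - b * F b' v) = (\<lambda>v. \<Sum>q\<in>?W. c q * G q v)"
    if b: "b \<in> ?J" "b' \<in> ?J" for b b'
  proof (rule flow_up_expand)
    show "(\<lambda>v. b' * F b v - b * F b' v) \<in> eqcoh \<Gamma>"
      using F b by (intro eqcoh_diff eqcoh_mult)
    show "vanishes_below (Suc (r p)) (\<lambda>v. b' * F b v - b * F b' v)"
      using F[OF b(1)] F[OF b(2)] p
      by (intro vanishes_below_Suc) (auto simp: vanishes_below_def mult_ac)
  qed (use G in auto)
  define D where "D b b' = (SOME c. (\<lambda>v. b' * F b v - b * F b' v) = (\<lambda>v. \<Sum>q\<in>?W. c q * G q v))" for b b'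
  have D: "b' * F b v - b * F b' v = (\<Sum>q\<in>?W. D b b' q * G q v)" if "b \<in> ?J" "b' \<in> ?J" for b b' v
    using fun_cong[OF someI_ex[OF ex_D[OF that]]] unfolding D_def .
  \<comment> \<open>A product of nonzero linear forms in the ideal, the common denominator modulo
    which the cocycles are split.\<close>
  obtain a where a: "a \<in> ?J" "vec_prod {0} a"
  proof -
    obtain l :: "real ^ 'n" where "l \<noteq> 0" using zero_neq_one by blast
    then obtain a where "a \<in> ?J" "vec_prod (span {l}) a" using ample_line[OF ample n] by blast
    moreover have "{0} \<subseteq> span {l}" by (simp add: span_zero)
    ultimately show ?thesis using that vec_prod_antimono by blast
  qed
  have a0: "a \<noteq> 0" using vec_prod_nonzero[OF a(2)] by simp
  \<comment> \<open>Both sides are coefficients of the same combination of \<open>F a\<close>,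
    \<open>F b\<close> and \<open>F b'\<close>; independence of the classes \<open>G q\<close> lets
    them be compared.\<close>
  have cocycle: "b' * D b a q - b * D b' a q = a * D b b' q"
    if b: "b \<in> ?J" "b' \<in> ?J" and q: "q \<in> ?W" for b b' q
  proof -
    have "(\<Sum>q\<in>?W. (b' * D b a q - b * D b' a q - a * D b b' q) * G q v) = 0" for v
    proof -
      have "(\<Sum>q\<in>?W. (b' * D b a q - b * D b' a q - a * D b b' q) * G q v) =
          b' * (\<Sum>q\<in>?W. D b a q * G q v) - b * (\<Sum>q\<in>?W. D b' a q * G q v)
          - a * (\<Sum>q\<in>?W. D b b' q * G q v)"
        by (simp add: sum_subtractf sum_distrib_left left_diff_distrib mult.assoc)
      also have "\<dots> = b' * (a * F b v - b * F a v) - b * (a * F b' v - b' * F a v)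
          - a * (b' * F b v - b * F b' v)"
        using b a by (simp only: D)
      also have "\<dots> = 0" by (simp add: algebra_simps)
      finally show ?thesis .
    qed
    then have "b' * D b a q - b * D b' a q - a * D b b' q = 0"
      using flow_up_independent[of ?W G "\<lambda>q. b' * D b a q - b * D b' a q - a * D b b' q" q] G q
      by blast
    then show ?thesis by simp
  qed
  have ex_d: "\<exists>d. \<forall>b\<in>?J. a dvd D b a q - b * d" if q: "q \<in> ?W" for q
    using cocycle[OF _ _ q] by (intro cocycle_mod_prod[OF ample n a(2)]) simp
  define d where "d q = (SOME d. \<forall>b\<in>?J. a dvd D b a q - b * d)" for q
  have d: "a dvd D b a q - b * d q" if "b \<in> ?J" "q \<in> ?W" for b q
    using someI_ex[OF ex_d[OF that(2)]] that(1) unfolding d_def by (rule bspec)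
  define e where "e b q = (SOME x. D b a q - b * d q = a * x)" for b q
  have e: "D b a q - b * d q = a * e b q" if "b \<in> ?J" "q \<in> ?W" for b q
    unfolding e_def using d[OF that] unfolding dvd_def by (rule someI_ex)
  \<comment> \<open>\<open>b * g = a * h' b\<close> will hold for all \<open>b\<close>. Thus
    \<open>g / a\<close> is the wanted class, and \<open>h'\<close> is the splitting, multiplication
    by it.\<close>
  define g where "g v = F a v + (\<Sum>q\<in>?W. d q * G q v)" for v
  define h' where "h' b v = F b v - (\<Sum>q\<in>?W. e b q * G q v)" for b v
  have bg: "b * g v = a * h' b v" if b: "b \<in> ?J" for b v
  proof -
    have "a * F b v - b * F a v = (\<Sum>q\<in>?W. (b * d q + a * e b q) * G q v)"
      unfolding D[OF b a(1)] using e[OF b] by (intro sum.cong) (auto simp: algebra_simps)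
    also have "\<dots> = b * (\<Sum>q\<in>?W. d q * G q v) + a * (\<Sum>q\<in>?W. e b q * G q v)"
      by (simp add: distrib_right sum.distrib sum_distrib_left mult.assoc)
    finally show ?thesis by (simp add: g_def h'_def algebra_simps)
  qed
  have "a dvd g v" for v
    by (rule ample_dvd[OF ample n a(2)]) (simp add: bg)
  then obtain h where h: "\<And>v. g v = a * h v" unfolding dvd_def by metis
  have bh: "b * h v = h' b v" if "b \<in> ?J" for b v
  proof -
    have "a * (b * h v) = a * h' b v" using bg[OF that, of v] by (simp add: h mult_ac)
    then show ?thesis using a0 sym_mult_left_cancel by blast
  qed
  have h': "h' b \<in> eqcoh \<Gamma>" if "b \<in> ?J" for b
    unfolding h'_def using F(1)[OF that] by (intro eqcoh_diff comb)
  have g: "g \<in> eqcoh \<Gamma>"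
    unfolding g_def using F(1)[OF a(1)] by (intro eqcoh_add comb)
  have "h \<in> eqcoh \<Gamma>"
    unfolding eqcoh_iff
  proof (intro conjI allI impI)
    fix v assume "v \<notin> skel_verts \<Gamma>"
    then have "a * h v = 0" using g h[of v] by (simp add: eqcoh_iff)
    then show "h v = 0" using a0 by (simp add: sym_mult_eq_0_iff)
  next
    fix s t assume st: "(s, t) \<in> skel_edges \<Gamma>"
    let ?l = "axial \<Gamma> (s, t)"
    \<comment> \<open>\<open>b * h\<close> satisfies the edge condition, and a \<open>b\<close>
      prime to the axial vector can be cancelled from it.\<close>
    obtain b where b: "b \<in> ?J" "vec_prod (span {?l}) b"
      using ample_line[OF ample n axial_nonzero[OF st]] by blast
    have "sym_vec ?l dvd b * (h t - h s)"
      using eqcoh_edge[OF h'[OF b(1)] st] by (simp add: bh[OF b(1)] right_diff_distrib)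
    moreover have "\<not> sym_vec ?l dvd b"
      using kill_vec_prod_nonzero[OF b(2)] by (simp add: sym_vec_dvd_iff)
    ultimately show "sym_vec ?l dvd h t - h s" by (simp add: sym_vec_prime)
  qed
  moreover have "h q = 0" if "q \<in> skel_verts \<Gamma>" "r q < r p" for q
  proof -
    have "a * h q = 0"
      using F(2)[OF a(1)] that comb_below[of q d] by (simp add: h[symmetric] g_def vanishes_below_def)
    then show ?thesis using a0 by (simp add: sym_mult_eq_0_iff)
  qed
  moreover have "h p = thom p"
  proof -
    have "a * h p = a * thom p"
      using F(3)[OF a(1)] comb_below[OF p, of d] by (simp add: h[symmetric] g_def)
    then show ?thesis using a0 sym_mult_left_cancel by blast
  qed
  ultimately show ?thesis by (auto simp: flow_up_def vanishes_below_def)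
qed

lemma leading_homogeneous:
  assumes "f \<in> eqcoh \<Gamma>" "vanishes_below (r p) f" "f p \<noteq> 0" "\<And>v. homogeneous k (f v)"
  obtains s where "f p = thom p * s" "ind \<Gamma> \<xi> p \<le> k" "homogeneous (k - ind \<Gamma> \<xi> p) s"
proof -
  obtain s where s: "f p = thom p * s" using thom_dvd[OF assms(1,2)] by (elim dvdE)
  have eq: "thom p * s = (if ind \<Gamma> \<xi> p \<le> k then thom p * hcomp (k - ind \<Gamma> \<xi> p) s else 0)"
    using assms(4)[of p] hcomp_mult_homogeneous[OF homogeneous_thom, of k p s]
    by (simp add: s homogeneous_iff_hcomp)
  then have le: "ind \<Gamma> \<xi> p \<le> k" using assms(3) s by (auto split: if_splits)
  with eq have "s = hcomp (k - ind \<Gamma> \<xi> p) s"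
    using sym_mult_left_cancel[OF thom_nonzero] by fastforce
  then show ?thesis using that[OF s le] homogeneous_hcomp by metis
qed

text \<open>In the component of degree \<open>j\<close> of a representation, generators of larger
  degree drop out.\<close>

lemma homogeneous_in_span:
  assumes fin: "finite B" and deg: "\<And>b v. b \<in> B \<Longrightarrow> homogeneous (deg b) (b v)"
    and f: "f \<in> sym_module.span B" "\<And>v. homogeneous j (f v)"
  shows "f \<in> sym_module.span {b \<in> B. deg b \<le> j}"
proof -
  obtain c where c: "f = (\<Sum>b\<in>B. sym_scale (c b) b)"
    using f(1) by (auto simp: sym_module.span_finite[OF fin])
  have "f v = (\<Sum>b\<in>{b \<in> B. deg b \<le> j}. sym_scale (hcomp (j - deg b) (c b)) b) v" for v
  proof -
    have "f v = hcomp j (f v)" using f(2) by (simp add: homogeneous_iff_hcomp)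
    also have "\<dots> = (\<Sum>b\<in>B. hcomp j (b v * c b))"
      by (simp add: c sum_apply sym_scale_def hcomp_sum mult.commute)
    also have "\<dots> = (\<Sum>b\<in>B. if deg b \<le> j then b v * hcomp (j - deg b) (c b) else 0)"
      using deg by (intro sum.cong) (auto simp: hcomp_mult_homogeneous)
    also have "\<dots> = (\<Sum>b\<in>{b \<in> B. deg b \<le> j}. b v * hcomp (j - deg b) (c b))"
      using fin by (simp add: sum.inter_filter)
    finally show ?thesis by (simp add: sum_apply sym_scale_def mult.commute)
  qed
  then have "f = (\<Sum>b\<in>{b \<in> B. deg b \<le> j}. sym_scale (hcomp (j - deg b) (c b)) b)" by blast
  also have "\<dots> \<in> sym_module.span {b \<in> B. deg b \<le> j}"
    by (intro sym_module.span_sum sym_module.span_scale sym_module.span_base) simp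
  finally show ?thesis .
qed

text \<open>In degree \<open>k\<close> there are as many generators as vertices of index \<open>k\<close>. If one of these vertices had
  no flow-up class, some real combination of the generators of degree \<open>k\<close> would reduce to a
  combination of generators of smaller degree.\<close>

lemma flow_up_if_graded_free:
  assumes free: "graded_free (eqcoh \<Gamma>) (betti \<Gamma> \<xi>)" and "p \<in> skel_verts \<Gamma>"
  shows "\<exists>f. flow_up p f"
  using assms(2)
proof (induction "ind \<Gamma> \<xi> p" arbitrary: p rule: less_induct)
  case less
  define k where "k = ind \<Gamma> \<xi> p"
  have IH: "\<exists>f. flow_up q f" if "q \<in> skel_verts \<Gamma>" "ind \<Gamma> \<xi> q < k" for q
    using less.hyps that by (simp add: k_def)
  obtain B where B: "finite B" "sym_module.independent B" "sym_module.span B = eqcoh \<Gamma>"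
    "\<And>f. f \<in> B \<Longrightarrow> \<exists>k. \<forall>p. homogeneous k (f p)"
    "\<And>i. card {f \<in> B. \<forall>p. homogeneous i (f p)} = betti \<Gamma> \<xi> i"
    using free unfolding graded_free_def by blast
  define deg where "deg b = (SOME k. \<forall>p. homogeneous k (b p))" for b :: "'v \<Rightarrow> 'n sym_alg"
  have deg: "homogeneous (deg b) (b v)" if "b \<in> B" for b v
    using someI_ex[OF B(4)[OF that]] by (simp add: deg_def)
  define Bk where "Bk = {f \<in> B. \<forall>p. homogeneous k (f p)}"
  have finBk: "finite Bk" "Bk \<subseteq> B" using B(1) by (auto simp: Bk_def)
  have deg_Bk: "deg b = k" if "b \<in> Bk" for b
  proof -
    have "b \<in> B" using that finBk by blast
    \<comment> \<open>The zero class is homogeneous of every degree, so the degree of a generator is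
      determined only after excluding it.\<close>
    then have "b \<noteq> 0" using B(2) sym_module.dependent_zero by blast
    then obtain v where "b v \<noteq> 0" by (auto simp: fun_eq_iff)
    then show ?thesis
      using deg[OF \<open>b \<in> B\<close>, of v] that homogeneous_unique by (auto simp: Bk_def)
  qed
  define L where "L = {q \<in> skel_verts \<Gamma>. ind \<Gamma> \<xi> q = k \<and> (\<exists>f. flow_up q f)}"
  have finL: "finite L" using finite_verts by (simp add: L_def)
  define F where "F q v = hcomp (ind \<Gamma> \<xi> q) ((SOME f. flow_up q f) v)" for q v
  have F: "flow_up q (F q)" if "\<exists>f. flow_up q f" for q
    unfolding F_def by (rule flow_up_hcomp[OF someI_ex[OF that]])
  have F_hom: "homogeneous (ind \<Gamma> \<xi> q) (F q v)" for q v
    by (simp add: F_def)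
  let ?M = "sym_module.span (B - Bk)"
  have F_low: "F q \<in> ?M" if "q \<in> skel_verts \<Gamma>" "ind \<Gamma> \<xi> q < k" for q
  proof -
    have "F q \<in> sym_module.span {b \<in> B. deg b \<le> ind \<Gamma> \<xi> q}"
      using F[OF IH[OF that]] F_hom by (intro homogeneous_in_span B(1) deg) (auto simp: B(3) flow_up_def)
    moreover have "{b \<in> B. deg b \<le> ind \<Gamma> \<xi> q} \<subseteq> B - Bk"
      using deg_Bk that by auto
    ultimately show ?thesis using sym_module.span_mono by blast
  qed
  \<comment> \<open>Leading terms are removed one by one. At a vertex of index below
    \<open>k\<close> the correction lies in \<open>?M\<close>; at index \<open>k\<close> its
    coefficient is a real number and is recorded in \<open>y\<close>.\<close>
  have reduce: "(\<forall>v. homogeneous k (h v)) \<longrightarrow>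
      (\<exists>y. (\<lambda>v. h v - (\<Sum>q\<in>L. sym_const (y q) * F q v)) \<in> ?M)" if "h \<in> eqcoh \<Gamma>" for h
    using that
  proof (induction rule: lead_induct)
    case zero
    have "(\<lambda>v. 0) \<in> ?M" using sym_module.span_zero[of "B - Bk"] by (simp add: zero_fun_def)
    then show ?case by (intro impI exI[of _ "\<lambda>_. 0"]) simp
  next
    case (step h q)
    show ?case
    proof
      assume hom: "\<forall>v. homogeneous k (h v)"
      obtain s where s: "h q = thom q * s" "ind \<Gamma> \<xi> q \<le> k" "homogeneous (k - ind \<Gamma> \<xi> q) s"
        using leading_homogeneous[OF step(1,4,3)] hom by blast
      \<comment> \<open>At index exactly \<open>k\<close> the cofactor \<open>s\<close> is a nonzero
        constant, so \<open>h\<close> rescaled is itself a flow-up class: no vertex outside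
        \<open>L\<close> can obstruct the reduction.\<close>
      have "\<exists>f. flow_up q f"
      proof (cases "ind \<Gamma> \<xi> q < k")
        case False
        then obtain a where a: "s = sym_const a" using s homogeneous_0_imp_const by force
        have "a \<noteq> 0" using step(3) s(1) a by auto
        then have "sym_const (1 / a) * h q = thom q"
          by (simp add: s(1) a mult.left_commute[of _ "thom q"] sym_const_mult[symmetric])
        then have "flow_up q (\<lambda>v. sym_const (1 / a) * h v)"
          using step(1,4) by (simp add: flow_up_def eqcoh_mult vanishes_below_def)
        then show ?thesis by blast
      qed (use IH step(2) in blast)
      then have Fq: "flow_up q (F q)" by (rule F)
      let ?h = "\<lambda>v. h v - s * F q v"
      have "?h \<in> eqcoh \<Gamma>"
        using step(1) Fq by (intro eqcoh_diff eqcoh_mult) (simp_all add: flow_up_def)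
      moreover have "vanishes_below (Suc (r q)) ?h"
        using step(2,4) Fq s(1)
        by (intro vanishes_below_Suc) (auto simp: flow_up_def vanishes_below_def mult.commute)
      moreover have "homogeneous k (?h v)" for v
        using homogeneous_mult[OF s(3) F_hom[of q v]] s(2) hom by (intro homogeneous_diff) auto
      ultimately obtain y where y: "(\<lambda>v. ?h v - (\<Sum>q\<in>L. sym_const (y q) * F q v)) \<in> ?M"
        using step(5) by blast
      show "\<exists>y. (\<lambda>v. h v - (\<Sum>q\<in>L. sym_const (y q) * F q v)) \<in> ?M"
      proof (cases "ind \<Gamma> \<xi> q < k")
        case True
        have "(\<lambda>v. ?h v - (\<Sum>q\<in>L. sym_const (y q) * F q v)) + sym_scale s (F q) \<in> ?M"
          using y F_low[OF step(2) True] by (intro sym_module.span_add sym_module.span_scale)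
        moreover have "(\<lambda>v. ?h v - (\<Sum>q\<in>L. sym_const (y q) * F q v)) + sym_scale s (F q) =
            (\<lambda>v. h v - (\<Sum>q\<in>L. sym_const (y q) * F q v))"
          by (simp add: fun_eq_iff sym_scale_def)
        ultimately show ?thesis by (intro exI[of _ y]) simp
      next
        case False
        then have q: "q \<in> L" "ind \<Gamma> \<xi> q = k" using s(2) step(2) Fq by (auto simp: L_def)
        then obtain a where a: "s = sym_const a" using s(3) homogeneous_0_imp_const by force
        define z where "z q' = y q' + (if q' = q then a else 0)" for q'
        have "(\<Sum>q'\<in>L. sym_const (z q') * F q' v) = (\<Sum>q'\<in>L. sym_const (y q') * F q' v) + s * F q v" for v
        proof -
          have "(\<Sum>q'\<in>L. sym_const (if q' = q then a else 0) * F q' v) =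
              (\<Sum>q'\<in>L. if q' = q then s * F q v else 0)"
            by (intro sum.cong) (auto simp: a)
          also have "\<dots> = s * F q v" using q finL by simp
          finally show ?thesis by (simp add: z_def sym_const_add distrib_right sum.distrib)
        qed
        then have "(\<lambda>v. h v - (\<Sum>q\<in>L. sym_const (z q) * F q v)) =
            (\<lambda>v. ?h v - (\<Sum>q\<in>L. sym_const (y q) * F q v))"
          by (simp add: fun_eq_iff algebra_simps)
        with y show ?thesis by (intro exI[of _ z]) simp
      qed
    qed
  qed
  have ex_y: "\<exists>y. (\<lambda>v. b v - (\<Sum>q\<in>L. sym_const (y q) * F q v)) \<in> ?M" if "b \<in> Bk" for b
  proof -
    have "b \<in> eqcoh \<Gamma>" using that finBk B(3) sym_module.span_base by blast
    then show ?thesis using reduce that by (auto simp: Bk_def)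
  qed
  define y where "y b = (SOME y. (\<lambda>v. b v - (\<Sum>q\<in>L. sym_const (y q) * F q v)) \<in> ?M)" for b
  have y: "(\<lambda>v. b v - (\<Sum>q\<in>L. sym_const (y b q) * F q v)) \<in> ?M" if "b \<in> Bk" for b
    unfolding y_def by (rule someI_ex[OF ex_y[OF that]])
  have "card Bk \<le> card L"
  proof (rule ccontr)
    assume "\<not> card Bk \<le> card L"
    then obtain x where x: "\<exists>b\<in>Bk. x b \<noteq> 0" "\<And>q. q \<in> L \<Longrightarrow> (\<Sum>b\<in>Bk. x b * y b q) = 0"
      using underdetermined_system[of L Bk y] finL finBk by auto
    have "(\<Sum>b\<in>Bk. sym_scale (sym_const (x b)) (\<lambda>v. b v - (\<Sum>q\<in>L. sym_const (y b q) * F q v))) \<in> ?M"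
      by (intro sym_module.span_sum sym_module.span_scale y)
    also have "(\<Sum>b\<in>Bk. sym_scale (sym_const (x b)) (\<lambda>v. b v - (\<Sum>q\<in>L. sym_const (y b q) * F q v))) =
        (\<Sum>b\<in>Bk. sym_scale (sym_const (x b)) b)"
    proof
      fix v
      have "(\<Sum>b\<in>Bk. sym_const (x b) * (\<Sum>q\<in>L. sym_const (y b q) * F q v)) =
          (\<Sum>q\<in>L. (\<Sum>b\<in>Bk. sym_const (x b * y b q)) * F q v)"
        by (simp add: sum_distrib_left sum_distrib_right sym_const_mult mult.assoc)
          (rule sum.swap)
      also have "\<dots> = 0" using x(2) by (simp add: sym_const_sum[symmetric])
      finally show "(\<Sum>b\<in>Bk. sym_scale (sym_const (x b)) (\<lambda>v. b v - (\<Sum>q\<in>L. sym_const (y b q) * F q v))) v =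
          (\<Sum>b\<in>Bk. sym_scale (sym_const (x b)) b) v"
        by (simp add: sum_apply sym_scale_def right_diff_distrib sum_subtractf)
    qed
    finally obtain c where c: "(\<Sum>b\<in>Bk. sym_scale (sym_const (x b)) b) = (\<Sum>b\<in>B - Bk. sym_scale (c b) b)"
      using B(1) by (auto simp: sym_module.span_finite)
    define u where "u b = (if b \<in> Bk then sym_const (x b) else - c b)" for b
    have "(\<Sum>b\<in>B. sym_scale (u b) b) = (\<Sum>b\<in>B - Bk. sym_scale (u b) b) + (\<Sum>b\<in>Bk. sym_scale (u b) b)"
      using sum.subset_diff[OF finBk(2) B(1)] .
    also have "(\<Sum>b\<in>Bk. sym_scale (u b) b) = (\<Sum>b\<in>Bk. sym_scale (sym_const (x b)) b)"
      by (simp add: u_def)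
    also have "(\<Sum>b\<in>B - Bk. sym_scale (u b) b) = - (\<Sum>b\<in>B - Bk. sym_scale (c b) b)"
      by (simp add: u_def sum_negf[symmetric] sym_module.scale_minus_left)
    finally have "(\<Sum>b\<in>B. sym_scale (u b) b) = 0" unfolding c by (simp only: add.left_inverse)
    moreover have "\<exists>b\<in>B. u b \<noteq> 0" using x(1) finBk by (auto simp: u_def)
    ultimately show False
      using B(2) sym_module.dependent_finite[OF B(1)] by blast
  qed
  moreover have "card Bk = card {q \<in> skel_verts \<Gamma>. ind \<Gamma> \<xi> q = k}"
    using B(5)[of k] by (simp add: Bk_def betti_def)
  ultimately have "L = {q \<in> skel_verts \<Gamma>. ind \<Gamma> \<xi> q = k}"
    using finite_verts by (intro card_seteq) (auto simp: L_def)
  then show ?case using less.prems by (auto simp: L_def k_def)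
qed

end

subsection \<open>Generic covectors\<close>

text \<open>A real subspace is no finite union of proper subspaces: on the line
  \<open>w + s w'\<close> each new condition excludes one value of \<open>s\<close>. Where
  \<open>w' \<bullet> x\<close> is zero the formula merely excludes \<open>s = 0\<close>, which does
  no harm.\<close>

lemma exists_nonorthogonal:
  fixes T L :: "(real ^ 'n::finite) set"
  assumes "finite T" "subspace L" "\<And>t. t \<in> T \<Longrightarrow> \<exists>w\<in>L. w \<bullet> t \<noteq> 0"
  shows "\<exists>w\<in>L. \<forall>t\<in>T. w \<bullet> t \<noteq> 0"
  using assms(1,3)
proof (induction T rule: finite_induct)
  case empty
  show ?case using subspace_0[OF assms(2)] by blast
next
  case (insert t T)
  obtain w where w: "w \<in> L" "\<forall>x\<in>T. w \<bullet> x \<noteq> 0" using insert by auto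
  obtain w' where w': "w' \<in> L" "w' \<bullet> t \<noteq> 0" using insert.prems by auto
  have "finite ((\<lambda>x. - (w \<bullet> x) / (w' \<bullet> x)) ` insert t T)" using insert by simp
  then obtain s where s: "s \<notin> (\<lambda>x. - (w \<bullet> x) / (w' \<bullet> x)) ` insert t T"
    using ex_new_if_finite[OF infinite_UNIV_char_0] by blast
  have "(w + s *\<^sub>R w') \<bullet> x \<noteq> 0" if x: "x \<in> insert t T" for x
  proof
    assume eq: "(w + s *\<^sub>R w') \<bullet> x = 0"
    then have "w' \<bullet> x \<noteq> 0" using w w' x by (auto simp: inner_add_left)
    then have "s = - (w \<bullet> x) / (w' \<bullet> x)" using eq by (simp add: inner_add_left field_simps)
    with s x show False by blast
  qed
  moreover have "w + s *\<^sub>R w' \<in> L"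
    using w w' assms(2) by (simp add: subspace_add subspace_scale)
  ultimately show ?case by blast
qed

lemma exists_nonorthogonal_UNIV:
  fixes T :: "(real ^ 'n::finite) set"
  assumes "finite T" "0 \<notin> T"
  shows "\<exists>w. \<forall>t\<in>T. w \<bullet> t \<noteq> 0"
proof -
  have "\<exists>w\<in>UNIV. w \<bullet> t \<noteq> 0" if "t \<in> T" for t
    using that assms(2) by (intro bexI[of _ t]) auto
  then show ?thesis using exists_nonorthogonal[OF assms(1) subspace_UNIV] by blast
qed

lemma linear_inner: "linear (\<lambda>v. w \<bullet> v)"
  by (simp add: linear_iff inner_add_right)

text \<open>Clearing denominators in one coordinate gives a polynomial \<open>P\<close>. At the pole
  \<open>- 1 / t e1\<close> every term but that of \<open>e1\<close> contains the vanishing factor,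
  and distinct poles keep the remaining term nonzero.\<close>

lemma finite_zeros_sum_poles:
  fixes u :: "'e \<Rightarrow> real ^ 'n::finite" and c t :: "'e \<Rightarrow> real"
  assumes S: "finite S" and inj: "inj_on t S" and t: "\<And>e. e \<in> S \<Longrightarrow> t e \<noteq> 0"
    and e1: "e1 \<in> S" "c e1 \<noteq> 0" "u e1 \<noteq> 0"
  shows "finite {s. (\<forall>e\<in>S. 1 + s * t e \<noteq> 0) \<and> (\<Sum>e\<in>S. (c e / (1 + s * t e)) *\<^sub>R u e) = 0}"
proof -
  obtain i where i: "u e1 $ i \<noteq> 0" using e1(3) by (auto simp: vec_eq_iff)
  define P where "P = (\<Sum>e\<in>S. smult (c e * u e $ i) (\<Prod>k\<in>S - {e}. [:1, t k:]))"
  have P: "poly P s = (\<Sum>e\<in>S. c e * u e $ i * (\<Prod>k\<in>S - {e}. 1 + s * t k))" for s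
    by (simp add: P_def poly_sum poly_prod)
  let ?s = "- 1 / t e1"
  have "c e * u e $ i * (\<Prod>k\<in>S - {e}. 1 + ?s * t k) = 0" if "e \<in> S - {e1}" for e
  proof -
    have "(\<Prod>k\<in>S - {e}. 1 + ?s * t k) = 0"
      using that S e1 t[OF e1(1)] by (intro prod_zero) (auto intro!: bexI[of _ e1])
    then show ?thesis by simp
  qed
  then have "poly P ?s = c e1 * u e1 $ i * (\<Prod>k\<in>S - {e1}. 1 + ?s * t k)"
    unfolding P sum.remove[OF S e1(1)] by (simp only: sum.neutral[OF ballI] add_0_right)
  moreover have "(\<Prod>k\<in>S - {e1}. 1 + ?s * t k) \<noteq> 0"
  proof -
    have "1 + ?s * t k \<noteq> 0" if "k \<in> S - {e1}" for k
    proof -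
      have "t k \<noteq> t e1" using that inj e1(1) by (auto simp: inj_on_def)
      then show ?thesis using t[OF e1(1)] by (simp add: field_simps)
    qed
    then show ?thesis by (simp only: prod_zero_iff[OF finite_Diff[OF S]]) blast
  qed
  ultimately have "poly P ?s \<noteq> 0" using e1 i by simp
  then have "P \<noteq> 0" by auto
  then have fin: "finite {s. poly P s = 0}" by (rule poly_roots_finite)
  have "poly P s = 0"
    if s: "\<forall>e\<in>S. 1 + s * t e \<noteq> 0" "(\<Sum>e\<in>S. (c e / (1 + s * t e)) *\<^sub>R u e) = 0" for s
  proof -
    have "c e * u e $ i * (\<Prod>k\<in>S - {e}. 1 + s * t k) =
        (\<Prod>k\<in>S. 1 + s * t k) * (c e / (1 + s * t e) * u e $ i)" if "e \<in> S" for e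
      using that S s(1) by (simp add: prod.remove[of S e])
    then have "poly P s = (\<Prod>k\<in>S. 1 + s * t k) * (\<Sum>e\<in>S. c e / (1 + s * t e) * u e $ i)"
      unfolding P by (simp add: sum_distrib_left)
    also have "(\<Sum>e\<in>S. c e / (1 + s * t e) * u e $ i) = (\<Sum>e\<in>S. (c e / (1 + s * t e)) *\<^sub>R u e) $ i"
      by simp
    finally show ?thesis using s(2) by simp
  qed
  then show ?thesis by (intro finite_subset[OF _ fin]) blast
qed

context axial_skeleton
begin

lemma skel_star_eq: "skel_star \<Gamma> p = {e \<in> skel_edges \<Gamma>. fst e = p}"
  by (simp add: out_arcs_def)

lemma finite_star: "finite (skel_star \<Gamma> p)"
  using finite_edges by (simp add: skel_star_eq)

lemma star_nonparallel:
  "e \<in> skel_star \<Gamma> p \<Longrightarrow> e' \<in> skel_star \<Gamma> p \<Longrightarrow> e \<noteq> e' \<Longrightarrow> axial \<Gamma> e \<notin> span {axial \<Gamma> e'}"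
  by (cases e; cases e') (auto simp: skel_star_eq nonparallel)

lemma star_edge: "e \<in> skel_star \<Gamma> p \<Longrightarrow> e \<in> skel_edges \<Gamma>"
  by (simp add: skel_star_eq)

text \<open>Along a line \<open>\<xi>0 + s \<eta>\<close> the genericity conditions are rational in \<open>s\<close>, and none of them holds
  identically because the edges at a vertex have their poles at distinct values of \<open>s\<close>.\<close>

lemma generic_exists:
  assumes pol: "polarizing \<Gamma> \<xi>0"
  shows "\<exists>\<xi>. polarizing \<Gamma> \<xi> \<and> generic \<Gamma> \<xi> \<and>
    (\<forall>e\<in>skel_edges \<Gamma>. \<xi> (axial \<Gamma> e) > 0 \<longleftrightarrow> \<xi>0 (axial \<Gamma> e) > 0)"
proof -
  let ?V = "skel_verts \<Gamma>" and ?E = "skel_edges \<Gamma>" and ?\<alpha> = "axial \<Gamma>"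
  have lin0: "linear \<xi>0" and xi0: "\<And>e. e \<in> ?E \<Longrightarrow> \<xi>0 (?\<alpha> e) \<noteq> 0"
    using pol by (auto simp: polarizing_def)
  define u where "u e = ?\<alpha> e /\<^sub>R \<xi>0 (?\<alpha> e)" for e
  have u_nz: "u e \<noteq> 0" if "e \<in> ?E" for e
    using xi0[OF that] linear_0[OF lin0] by (auto simp: u_def)
  have u_ne: "u e \<noteq> u e'" if "e \<in> skel_star \<Gamma> p" "e' \<in> skel_star \<Gamma> p" "e \<noteq> e'" for p e e'
  proof
    assume eq: "u e = u e'"
    have "?\<alpha> e = \<xi>0 (?\<alpha> e) *\<^sub>R u e"
      using xi0[OF star_edge[OF that(1)]] by (simp add: u_def)
    also have "\<dots> = (\<xi>0 (?\<alpha> e) / \<xi>0 (?\<alpha> e')) *\<^sub>R ?\<alpha> e'"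
      unfolding eq by (simp add: u_def divide_inverse)
    also have "\<dots> \<in> span {?\<alpha> e'}" by (intro span_mul span_base) simp
    finally show False using star_nonparallel that by blast
  qed
  define S where "S = {(e, e'). \<exists>p. e \<in> skel_star \<Gamma> p \<and> e' \<in> skel_star \<Gamma> p \<and> e \<noteq> e'}"
  \<comment> \<open>A direction \<open>w\<close> off \<open>T\<close> gives the edges at a vertex
    poles \<open>- 1 / t e\<close> that exist and are distinct.\<close>
  define T where "T = u ` ?E \<union> (\<lambda>(e, e'). u e - u e') ` S"
  have "finite S"
    unfolding S_def
    by (rule finite_subset[of _ "?E \<times> ?E"]) (use finite_edges star_edge in auto)
  then have "finite T" using finite_edges by (simp add: T_def)
  moreover have "0 \<notin> T"
  proof
    assume "0 \<in> T"
    then consider e where "e \<in> ?E" "u e = 0" | e e' where "(e, e') \<in> S" "u e = u e'"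
      by (auto simp: T_def)
    then show False
    proof cases
      case 1
      then show ?thesis using u_nz by blast
    next
      case 2
      then show ?thesis using u_ne unfolding S_def by blast
    qed
  qed
  ultimately obtain w where w: "\<forall>x\<in>T. w \<bullet> x \<noteq> 0"
    using exists_nonorthogonal_UNIV by blast
  define t where "t e = w \<bullet> u e" for e
  have t_nz: "t e \<noteq> 0" if "e \<in> ?E" for e
  proof -
    have "u e \<in> T" unfolding T_def using that by (intro UnI1 imageI)
    then show ?thesis using w unfolding t_def by blast
  qed
  have t_inj: "inj_on t (skel_star \<Gamma> p)" for p
  proof (rule inj_onI, rule ccontr)
    fix e e' assume e: "e \<in> skel_star \<Gamma> p" "e' \<in> skel_star \<Gamma> p" "t e = t e'" "e \<noteq> e'"
    have "(e, e') \<in> S" unfolding S_def using e(1,2,4) by blast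
    then have "(\<lambda>(e, e'). u e - u e') (e, e') \<in> T" unfolding T_def by (intro UnI2 imageI)
    then have "w \<bullet> (u e - u e') \<noteq> 0" using w unfolding prod.case by blast
    then show False using e(3) by (simp add: t_def inner_diff_right)
  qed
  define \<xi> where "\<xi> s v = \<xi>0 v + s * (w \<bullet> v)" for s v
  have xi: "\<xi> s (?\<alpha> e) = \<xi>0 (?\<alpha> e) * (1 + s * t e)" if "e \<in> ?E" for s e
    using xi0[OF that] by (simp add: \<xi>_def t_def u_def algebra_simps)
  define bad where "bad p c = {s. (\<forall>e\<in>skel_star \<Gamma> p. 1 + s * t e \<noteq> 0) \<and>
      (\<Sum>e\<in>skel_star \<Gamma> p. (c e / (1 + s * t e)) *\<^sub>R u e) = 0}" for p c
  have bad: "finite (bad p c)" if "e1 \<in> skel_star \<Gamma> p" "c e1 \<noteq> 0" for p c e1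
    unfolding bad_def using that t_nz u_nz t_inj star_edge
    by (intro finite_zeros_sum_poles[of _ t e1]) (auto intro: finite_star)
  \<comment> \<open>The coefficients of \<open>x e1 - x e2 - x e3 + x e4\<close>, as a sum of
    indicators because edges may coincide. For distinct pairs one survives: at \<open>e2\<close> if
    \<open>e1 = e3\<close>, at \<open>e1\<close> otherwise.\<close>
  define cf where "cf e1 e2 e3 e4 e =
      (if e = e1 then 1 else 0) - (if e = e2 then 1 else 0) - (if e = e3 then 1 else 0) + (if e = e4 then 1 else (0::real))"
    for e1 e2 e3 e4 e :: "'v \<times> 'v"
  define Q where "Q = {(p, e1, e2, e3, e4). p \<in> ?V \<and> {e1, e2, e3, e4} \<subseteq> skel_star \<Gamma> p \<and>
      e1 \<noteq> e2 \<and> e3 \<noteq> e4 \<and> (e1, e2) \<noteq> (e3, e4)}"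
  have Q: "(p, e1, e2, e3, e4) \<in> Q \<longleftrightarrow> p \<in> ?V \<and> {e1, e2, e3, e4} \<subseteq> skel_star \<Gamma> p \<and>
      e1 \<noteq> e2 \<and> e3 \<noteq> e4 \<and> (e1, e2) \<noteq> (e3, e4)" for p e1 e2 e3 e4
    by (simp only: Q_def mem_Collect_eq prod.case)
  have "Q \<subseteq> ?V \<times> ?E \<times> ?E \<times> ?E \<times> ?E"
  proof
    fix x assume "x \<in> Q"
    moreover obtain p e1 e2 e3 e4 where "x = (p, e1, e2, e3, e4)" by (metis surj_pair)
    ultimately show "x \<in> ?V \<times> ?E \<times> ?E \<times> ?E \<times> ?E" using Q star_edge by blast
  qed
  then have finQ: "finite Q"
    by (rule finite_subset) (use finite_verts finite_edges in blast)
  have cf_bad: "finite (bad p (cf e1 e2 e3 e4))" if "(p, e1, e2, e3, e4) \<in> Q" for p e1 e2 e3 e4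
  proof (cases "e1 = e3")
    case True
    have *: "{e1, e2, e3, e4} \<subseteq> skel_star \<Gamma> p" "e1 \<noteq> e2" "e3 \<noteq> e4" "(e1, e2) \<noteq> (e3, e4)"
      using that unfolding Q by blast+
    then have "cf e1 e2 e3 e4 e2 \<noteq> 0" using True by (simp add: cf_def)
    then show ?thesis using * by (intro bad[of e2]) blast+
  next
    case False
    have *: "{e1, e2, e3, e4} \<subseteq> skel_star \<Gamma> p" "e1 \<noteq> e2" "e3 \<noteq> e4"
      using that unfolding Q by blast+
    then have "cf e1 e2 e3 e4 e1 \<noteq> 0" using False by (simp add: cf_def)
    then show ?thesis using * by (intro bad[of e1]) blast+
  qed
  define N where "N = (\<Union>(p, e1, e2, e3, e4)\<in>Q. bad p (cf e1 e2 e3 e4))"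
  have finN: "finite N"
    unfolding N_def
  proof (rule finite_UN_I[OF finQ])
    fix x assume "x \<in> Q"
    moreover obtain p e1 e2 e3 e4 where x: "x = (p, e1, e2, e3, e4)" by (metis surj_pair)
    ultimately show "finite (case x of (p, e1, e2, e3, e4) \<Rightarrow> bad p (cf e1 e2 e3 e4))"
      unfolding x prod.case by (intro cf_bad)
  qed
  define \<sigma> where "\<sigma> = (\<Sum>e\<in>?E. \<bar>t e\<bar>)"
  have sum_nn: "0 \<le> \<sigma>" unfolding \<sigma>_def by (simp add: sum_nonneg)
  \<comment> \<open>For \<open>s\<close> below this bound every \<open>s * t e\<close> is less than
    one in absolute value, so no edge changes sign.\<close>
  define \<epsilon> where "\<epsilon> = 1 / (1 + \<sigma>)"
  have "\<epsilon> > 0" using sum_nn by (simp add: \<epsilon>_def)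
  then have "infinite {0<..<\<epsilon>}" by simp
  then have "\<not> {0<..<\<epsilon>} \<subseteq> N" using finN finite_subset by blast
  then obtain s where s: "0 < s" "s < \<epsilon>" "s \<notin> N" by (auto simp: subset_iff)
  have pos: "1 + s * t e > 0" if "e \<in> ?E" for e
  proof -
    have "\<bar>t e\<bar> \<le> \<sigma>"
      unfolding \<sigma>_def using member_le_sum[of e ?E "\<lambda>e. \<bar>t e\<bar>"] that finite_edges by simp
    then have "s * \<bar>t e\<bar> \<le> s * \<sigma>" using s(1) by simp
    also have "\<dots> \<le> \<epsilon> * \<sigma>" using s(2) sum_nn by (intro mult_right_mono) auto
    also have "\<dots> < 1" using sum_nn by (simp add: \<epsilon>_def field_simps)
    finally have "\<bar>s * t e\<bar> < 1" using s(1) by (simp add: abs_mult)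
    then show ?thesis by linarith
  qed
  have "linear (\<xi> s)"
    unfolding \<xi>_def by (intro linear_compose_add lin0) (simp add: linear_iff inner_add_right algebra_simps)
  moreover have "\<xi> s (?\<alpha> e) \<noteq> 0" if "e \<in> ?E" for e
    using xi[OF that] xi0[OF that] pos[OF that] by simp
  ultimately have "polarizing \<Gamma> (\<xi> s)" by (simp add: polarizing_def)
  moreover have "\<xi> s (?\<alpha> e) > 0 \<longleftrightarrow> \<xi>0 (?\<alpha> e) > 0" if "e \<in> ?E" for e
    using xi[OF that] pos[OF that] by (simp add: zero_less_mult_iff)
  moreover have "generic \<Gamma> (\<xi> s)"
    unfolding generic_def
  proof (intro ballI inj_onI)
    fix p a b
    let ?P = "{(e, e'). e \<in> skel_star \<Gamma> p \<and> e' \<in> skel_star \<Gamma> p \<and> e \<noteq> e'}"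
    assume p: "p \<in> ?V" and ab: "a \<in> ?P" "b \<in> ?P"
      "(case a of (e, e') \<Rightarrow> ?\<alpha> e /\<^sub>R \<xi> s (?\<alpha> e) - ?\<alpha> e' /\<^sub>R \<xi> s (?\<alpha> e')) =
       (case b of (e, e') \<Rightarrow> ?\<alpha> e /\<^sub>R \<xi> s (?\<alpha> e) - ?\<alpha> e' /\<^sub>R \<xi> s (?\<alpha> e'))"
    obtain e1 e2 e3 e4 where ab_eq: "a = (e1, e2)" "b = (e3, e4)" by (metis surj_pair)
    have e: "e1 \<in> skel_star \<Gamma> p" "e2 \<in> skel_star \<Gamma> p" "e1 \<noteq> e2"
      "e3 \<in> skel_star \<Gamma> p" "e4 \<in> skel_star \<Gamma> p" "e3 \<noteq> e4"
      and eq: "?\<alpha> e1 /\<^sub>R \<xi> s (?\<alpha> e1) - ?\<alpha> e2 /\<^sub>R \<xi> s (?\<alpha> e2) = ?\<alpha> e3 /\<^sub>R \<xi> s (?\<alpha> e3) - ?\<alpha> e4 /\<^sub>R \<xi> s (?\<alpha> e4)"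
      using ab unfolding ab_eq prod.case mem_Collect_eq by blast+
    define x where "x e = u e /\<^sub>R (1 + s * t e)" for e
    have x: "?\<alpha> e /\<^sub>R \<xi> s (?\<alpha> e) = x e" if "e \<in> skel_star \<Gamma> p" for e
      using xi[OF star_edge[OF that]] by (simp add: x_def u_def)
    have delta: "(\<Sum>e\<in>skel_star \<Gamma> p. (if e = e' then 1 else (0::real)) *\<^sub>R x e) = x e'"
      if "e' \<in> skel_star \<Gamma> p" for e'
    proof -
      have "(\<Sum>e\<in>skel_star \<Gamma> p. (if e = e' then 1 else (0::real)) *\<^sub>R x e) =
          (\<Sum>e\<in>skel_star \<Gamma> p. if e = e' then x e' else 0)"
        by (intro sum.cong) auto
      then show ?thesis using that finite_star by simp
    qed
    have "(\<Sum>e\<in>skel_star \<Gamma> p. (cf e1 e2 e3 e4 e / (1 + s * t e)) *\<^sub>R u e) =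
        (\<Sum>e\<in>skel_star \<Gamma> p. cf e1 e2 e3 e4 e *\<^sub>R x e)"
      by (simp add: x_def divide_inverse)
    also have "\<dots> = x e1 - x e2 - x e3 + x e4"
      unfolding cf_def scaleR_add_left scaleR_diff_left sum.distrib sum_subtractf
      using e by (simp only: delta)
    also have "\<dots> = 0" using eq e by (simp only: x) (simp add: algebra_simps)
    finally have "s \<in> bad p (cf e1 e2 e3 e4)"
      using pos star_edge by (force simp: bad_def)
    then have "(p, e1, e2, e3, e4) \<notin> Q" using s(3) unfolding N_def by blast
    then show "a = b" unfolding ab_eq using p e unfolding Q by blast
  qed
  ultimately show ?thesis by blast
qed

end

text \<open>The number of strict ancestors grows along oriented edges; an enumeration
  \<open>i\<close> of the vertices, as last digit in base \<open>card ?V\<close>, breaks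
  ties.\<close>

lemma (in axial_skeleton) rank_exists:
  assumes acyc: "acyclic_orientation \<Gamma> \<xi>"
  shows "\<exists>r :: 'v \<Rightarrow> nat. inj_on r (skel_verts \<Gamma>) \<and>
    (\<forall>p q. (p, q) \<in> skel_edges \<Gamma> \<longrightarrow> \<xi> (axial \<Gamma> (p, q)) > 0 \<longrightarrow> r p < r q)"
proof -
  let ?V = "skel_verts \<Gamma>"
  define R where "R = {e \<in> skel_edges \<Gamma>. \<xi> (axial \<Gamma> e) > 0}"
  have acyc: "acyclic R" using acyc by (simp add: acyclic_orientation_def R_def)
  have "R \<subseteq> ?V \<times> ?V" using edge_verts by (auto simp: R_def)
  then have "R\<^sup>+ \<subseteq> ?V \<times> ?V" using trancl_subset_Sigma by blast
  then have fin: "finite {x. (x, q) \<in> R\<^sup>+}" for q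
    by (intro finite_subset[OF _ finite_verts]) auto
  define h where "h q = card {x. (x, q) \<in> R\<^sup>+}" for q
  have h: "h p < h q" if "(p, q) \<in> R" for p q
    unfolding h_def
  proof (rule psubset_card_mono[OF fin], rule psubsetI)
    show "{x. (x, p) \<in> R\<^sup>+} \<subseteq> {x. (x, q) \<in> R\<^sup>+}" using that by auto
    have "p \<in> {x. (x, q) \<in> R\<^sup>+}" "p \<notin> {x. (x, p) \<in> R\<^sup>+}"
      using that acyc by (auto simp: acyclic_def)
    then show "{x. (x, p) \<in> R\<^sup>+} \<noteq> {x. (x, q) \<in> R\<^sup>+}" by blast
  qed
  obtain i where i: "bij_betw i ?V {0..<card ?V}"
    using ex_bij_betw_finite_nat[OF finite_verts] by blast
  define r where "r q = h q * card ?V + i q" for q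
  have i_less: "i q < card ?V" if "q \<in> ?V" for q
    using i that by (auto simp: bij_betw_def)
  have lt: "r p < r q" if "p \<in> ?V" "h p < h q" for p q
  proof -
    have "r p < (h p + 1) * card ?V" using i_less[OF that(1)] by (simp add: r_def)
    also have "\<dots> \<le> h q * card ?V" using that(2) by (intro mult_right_mono) auto
    finally show ?thesis by (simp add: r_def)
  qed
  have "inj_on r ?V"
  proof (rule inj_onI)
    fix p q assume pq: "p \<in> ?V" "q \<in> ?V" "r p = r q"
    then have "h p = h q" using lt[of p q] lt[of q p] by (metis less_irrefl nat_neq_iff)
    then have "i p = i q" using pq(3) by (simp add: r_def)
    then show "p = q" using i pq by (auto simp: bij_betw_def inj_on_def)
  qed
  moreover have "r p < r q" if "(p, q) \<in> skel_edges \<Gamma>" "\<xi> (axial \<Gamma> (p, q)) > 0" for p q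
    using lt[of p q] h[of p q] that edge_verts by (auto simp: R_def)
  ultimately show ?thesis by blast
qed

subsection \<open>Invariance of the Betti numbers\<close>

locale conn_skeleton = axial_skeleton \<Gamma>
  for \<Gamma> :: "('v, 'n::finite) skeleton" +
  assumes conn_star:
      "(p, q) \<in> skel_edges \<Gamma> \<Longrightarrow> e \<in> skel_star \<Gamma> p \<Longrightarrow> conn \<Gamma> (p, q) e \<in> skel_star \<Gamma> q"
    and conn_self: "(p, q) \<in> skel_edges \<Gamma> \<Longrightarrow> conn \<Gamma> (p, q) (p, q) = (q, p)"
    and conn_inverse:
      "(p, q) \<in> skel_edges \<Gamma> \<Longrightarrow> e \<in> skel_star \<Gamma> p \<Longrightarrow> conn \<Gamma> (q, p) (conn \<Gamma> (p, q) e) = e"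
    and axial_conn: "(p, q) \<in> skel_edges \<Gamma> \<Longrightarrow> e \<in> skel_star \<Gamma> p \<Longrightarrow>
      \<exists>l>0. axial \<Gamma> e - l *\<^sub>R axial \<Gamma> (conn \<Gamma> (p, q) e) \<in> span {axial \<Gamma> (p, q)}"
begin

text \<open>When the covector crosses the wall \<open>\<zeta>\<close>, the edges on which it changes sign form a matching and the
  connection along such an edge exchanges the indices of its endpoints.\<close>

lemma betti_wall_crossing:
  fixes \<zeta> :: "real ^ 'n \<Rightarrow> real"
  assumes lin: "linear \<zeta>" and pol: "polarizing \<Gamma> \<xi>" "polarizing \<Gamma> \<xi>'"
    and sign: "\<And>e. e \<in> skel_edges \<Gamma> \<Longrightarrow> \<zeta> (axial \<Gamma> e) \<noteq> 0 \<Longrightarrow>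
      (\<xi> (axial \<Gamma> e) < 0 \<longleftrightarrow> \<zeta> (axial \<Gamma> e) < 0) \<and> (\<xi>' (axial \<Gamma> e) < 0 \<longleftrightarrow> \<zeta> (axial \<Gamma> e) < 0)"
    and uniq: "\<And>p e e'. e \<in> skel_star \<Gamma> p \<Longrightarrow> e' \<in> skel_star \<Gamma> p \<Longrightarrow>
      \<zeta> (axial \<Gamma> e) = 0 \<Longrightarrow> \<zeta> (axial \<Gamma> e') = 0 \<Longrightarrow> e = e'"
  shows "betti \<Gamma> \<xi> i = betti \<Gamma> \<xi>' i"
proof -
  let ?V = "skel_verts \<Gamma>" and ?E = "skel_edges \<Gamma>" and ?\<alpha> = "axial \<Gamma>"
  \<comment> \<open>An edge on the wall may keep its sign; only the endpoints of edges that change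
    sign are exchanged.\<close>
  define flip where "flip p q \<longleftrightarrow> (p, q) \<in> ?E \<and> \<zeta> (?\<alpha> (p, q)) = 0 \<and> (\<xi> (?\<alpha> (p, q)) < 0 \<longleftrightarrow> \<not> \<xi>' (?\<alpha> (p, q)) < 0)" for p q
  have neg: "\<eta> (?\<alpha> (q, p)) < 0 \<longleftrightarrow> \<not> \<eta> (?\<alpha> (p, q)) < 0" if "polarizing \<Gamma> \<eta>" "(p, q) \<in> ?E" for \<eta> p q
    using that edge_reverse_linear[of \<eta> p q] by (auto simp: polarizing_def)
  have flip_sym: "flip q p" if "flip p q" for p q
  proof -
    have pq: "(p, q) \<in> ?E" using that by (simp add: flip_def)
    show ?thesis
      using that edge_sym[OF pq] unfolding flip_def edge_reverse_linear[OF lin pq]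
        neg[OF pol(1) pq] neg[OF pol(2) pq] by auto
  qed
  have flip_uniq: "q = q'" if "flip p q" "flip p q'" for p q q'
    using uniq[of "(p, q)" p "(p, q')"] that by (auto simp: flip_def skel_star_eq)
  define \<phi> where "\<phi> p = (if \<exists>q. flip p q then SOME q. flip p q else p)" for p
  have phi_flip: "\<phi> p = q" if "flip p q" for p q
  proof -
    have "(SOME q. flip p q) = q" by (rule some_equality[of "flip p", OF that flip_uniq[OF _ that]])
    moreover have "\<exists>q. flip p q" using that by (rule exI)
    ultimately show ?thesis unfolding \<phi>_def by (simp only: if_True)
  qed
  have phi_phi: "\<phi> (\<phi> p) = p" for p
  proof (cases "\<exists>q. flip p q")
    case True
    then obtain q where q: "flip p q" by blast
    show ?thesis unfolding phi_flip[OF q] by (rule phi_flip[OF flip_sym[OF q]])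
  next
    case False
    then have "\<phi> p = p" unfolding \<phi>_def by (rule if_not_P)
    then show ?thesis by simp
  qed
  have phi_V: "\<phi> p \<in> ?V" if "p \<in> ?V" for p
  proof (cases "\<exists>q. flip p q")
    case True
    then obtain q where "flip p q" by blast
    then show ?thesis using phi_flip edge_verts by (auto simp: flip_def)
  qed (use that in \<open>simp add: \<phi>_def\<close>)
  have star_E: "e \<in> ?E" if "e \<in> skel_star \<Gamma> p" for e p using that by (rule star_edge)
  \<comment> \<open>For \<open>e\<close> other than \<open>(p, q)\<close> the value of
    \<open>\<zeta>\<close> is nonzero by uniqueness, and transport rescales it by a positive factor
    since \<open>\<zeta>\<close> kills the edge \<open>(p, q)\<close>. That edge itself is reversed
    and changes sign, which cancels out.\<close>
  have transport: "(\<xi> (?\<alpha> e) < 0 \<longleftrightarrow> \<xi>' (?\<alpha> (conn \<Gamma> (p, q) e)) < 0)"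
    if fl: "flip p q" and e: "e \<in> skel_star \<Gamma> p" for p q e
  proof (cases "e = (p, q)")
    case True
    have "(p, q) \<in> ?E" using fl by (simp add: flip_def)
    then have "\<xi>' (?\<alpha> (conn \<Gamma> (p, q) e)) < 0 \<longleftrightarrow> \<not> \<xi>' (?\<alpha> (p, q)) < 0"
      using neg[OF pol(2)] True conn_self by simp
    then show ?thesis using fl True by (simp add: flip_def)
  next
    case False
    have pq: "(p, q) \<in> ?E" "\<zeta> (?\<alpha> (p, q)) = 0" using fl by (auto simp: flip_def)
    obtain l where l: "l > 0" "?\<alpha> e - l *\<^sub>R ?\<alpha> (conn \<Gamma> (p, q) e) \<in> span {?\<alpha> (p, q)}"
      using axial_conn[OF pq(1) e] by blast
    obtain k where "?\<alpha> e - l *\<^sub>R ?\<alpha> (conn \<Gamma> (p, q) e) = k *\<^sub>R ?\<alpha> (p, q)"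
      using l(2) by (auto simp: span_singleton)
    then have "\<zeta> (?\<alpha> e - l *\<^sub>R ?\<alpha> (conn \<Gamma> (p, q) e)) = 0"
      using pq(2) by (simp add: linear_scale[OF lin])
    then have z: "\<zeta> (?\<alpha> e) = l * \<zeta> (?\<alpha> (conn \<Gamma> (p, q) e))"
      by (simp add: linear_diff[OF lin] linear_scale[OF lin])
    have "(p, q) \<in> skel_star \<Gamma> p" using pq(1) by (simp add: skel_star_eq)
    then have "\<zeta> (?\<alpha> e) \<noteq> 0" using uniq[OF e _ _ pq(2)] False by blast
    then show ?thesis
      using z l(1) sign[OF star_E[OF e]] sign[OF star_E[OF conn_star[OF pq(1) e]]]
      by (auto simp: mult_less_0_iff)
  qed
  have ind_phi: "ind \<Gamma> \<xi>' (\<phi> p) = ind \<Gamma> \<xi> p" for p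
  proof (cases "\<exists>q. flip p q")
    case True
    then obtain q where fl: "flip p q" by blast
    then have pq: "(p, q) \<in> ?E" "(q, p) \<in> ?E" using edge_sym by (auto simp: flip_def)
    have "bij_betw (conn \<Gamma> (p, q)) {e \<in> skel_star \<Gamma> p. \<xi> (?\<alpha> e) < 0} {e \<in> skel_star \<Gamma> q. \<xi>' (?\<alpha> e) < 0}"
    proof (rule bij_betwI[where g = "conn \<Gamma> (q, p)"])
      show "conn \<Gamma> (p, q) \<in> {e \<in> skel_star \<Gamma> p. \<xi> (?\<alpha> e) < 0} \<rightarrow> {e \<in> skel_star \<Gamma> q. \<xi>' (?\<alpha> e) < 0}"
        using transport[OF fl] conn_star[OF pq(1)] by blast
      show "conn \<Gamma> (q, p) \<in> {e \<in> skel_star \<Gamma> q. \<xi>' (?\<alpha> e) < 0} \<rightarrow> {e \<in> skel_star \<Gamma> p. \<xi> (?\<alpha> e) < 0}"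
      proof
        fix e assume e: "e \<in> {e \<in> skel_star \<Gamma> q. \<xi>' (?\<alpha> e) < 0}"
        then have "conn \<Gamma> (q, p) e \<in> skel_star \<Gamma> p" using conn_star[OF pq(2)] by blast
        then show "conn \<Gamma> (q, p) e \<in> {e \<in> skel_star \<Gamma> p. \<xi> (?\<alpha> e) < 0}"
          using transport[OF fl] conn_inverse[OF pq(2)] e by auto
      qed
    qed (use conn_inverse pq in blast)+
    then show ?thesis
      unfolding ind_def phi_flip[OF fl] by (rule bij_betw_same_card[symmetric])
  next
    case False
    have "\<xi> (?\<alpha> e) < 0 \<longleftrightarrow> \<xi>' (?\<alpha> e) < 0" if "e \<in> skel_star \<Gamma> p" for e
      using False sign[OF star_E[OF that]] that by (cases e) (auto simp: flip_def skel_star_eq)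
    then have "{e \<in> skel_star \<Gamma> p. \<xi>' (?\<alpha> e) < 0} = {e \<in> skel_star \<Gamma> p. \<xi> (?\<alpha> e) < 0}" by blast
    then show ?thesis using False by (simp add: ind_def \<phi>_def)
  qed
  have ind_phi': "ind \<Gamma> \<xi> (\<phi> p) = ind \<Gamma> \<xi>' p" for p
    using ind_phi[of "\<phi> p"] by (simp add: phi_phi)
  have "bij_betw \<phi> {p \<in> ?V. ind \<Gamma> \<xi> p = i} {p \<in> ?V. ind \<Gamma> \<xi>' p = i}"
    by (rule bij_betwI[where g = \<phi>]) (use phi_V phi_phi ind_phi ind_phi' in auto)
  then show ?thesis unfolding betti_def by (rule bij_betw_same_card)
qed

text \<open>For polarizing covectors: the ratios of \<open>\<xi>'\<close> to \<open>\<xi>\<close> on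
  the edges at a vertex are distinct, so the path meets the walls at a vertex one at a time.\<close>

definition transverse :: "(real ^ 'n \<Rightarrow> real) \<Rightarrow> (real ^ 'n \<Rightarrow> real) \<Rightarrow> bool" where
  "transverse \<xi> \<xi>' \<longleftrightarrow> (\<forall>p e e'. e \<in> skel_star \<Gamma> p \<longrightarrow> e' \<in> skel_star \<Gamma> p \<longrightarrow> e \<noteq> e' \<longrightarrow>
    \<xi> (axial \<Gamma> e) * \<xi>' (axial \<Gamma> e') \<noteq> \<xi> (axial \<Gamma> e') * \<xi>' (axial \<Gamma> e))"

text \<open>The covectors \<open>u \<xi> + \<xi>'\<close> move from \<open>\<xi>\<close> to \<open>\<xi>'\<close> as \<open>u\<close> decreases from infinity to \<open>0\<close>; the wall of
  the edge \<open>e\<close> is met at \<open>u = \<rho> e\<close>.\<close>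

lemma betti_transverse:
  assumes "polarizing \<Gamma> \<xi>" "polarizing \<Gamma> \<xi>'" "transverse \<xi> \<xi>'"
  shows "betti \<Gamma> \<xi> i = betti \<Gamma> \<xi>' i"
  using assms
\<comment> \<open>The measure counts the edges whose wall is still ahead, at a positive
  parameter.\<close>
proof (induction "card {e \<in> skel_edges \<Gamma>. - \<xi>' (axial \<Gamma> e) / \<xi> (axial \<Gamma> e) > 0}"
    arbitrary: \<xi> rule: less_induct)
  case less
  let ?E = "skel_edges \<Gamma>" and ?\<alpha> = "axial \<Gamma>"
  define \<rho> where "\<rho> e = - \<xi>' (?\<alpha> e) / \<xi> (?\<alpha> e)" for e
  have nz: "\<xi> (?\<alpha> e) \<noteq> 0" "\<xi>' (?\<alpha> e) \<noteq> 0" if "e \<in> ?E" for e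
    using less.prems that by (auto simp: polarizing_def)
  have xi': "\<xi>' (?\<alpha> e) = - \<rho> e * \<xi> (?\<alpha> e)" if "e \<in> ?E" for e
    using nz[OF that] by (simp add: \<rho>_def)
  have rho_nz: "\<rho> e \<noteq> 0" if "e \<in> ?E" for e using nz[OF that] by (simp add: \<rho>_def)
  let ?P = "{e \<in> ?E. \<rho> e > 0}"
  show ?case
  proof (cases "?P = {}")
    case True
    have "\<xi> (?\<alpha> e) < 0 \<longleftrightarrow> \<xi>' (?\<alpha> e) < 0" if "e \<in> ?E" for e
    proof -
      have "\<not> \<rho> e > 0" using True that by blast
      then have "\<rho> e < 0" using rho_nz[OF that] by linarith
      then show ?thesis by (auto simp: xi'[OF that] zero_less_mult_iff)
    qed
    then have "{e \<in> skel_star \<Gamma> p. \<xi> (?\<alpha> e) < 0} = {e \<in> skel_star \<Gamma> p. \<xi>' (?\<alpha> e) < 0}" for p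
      using star_edge by blast
    then show ?thesis by (simp add: betti_def ind_def)
  next
    case False
    define u0 where "u0 = Max (\<rho> ` ?P)"
    have fin: "finite ?P" using finite_edges by simp
    then have u0_in: "u0 \<in> \<rho> ` ?P" using False unfolding u0_def by (intro Max_in) auto
    have u0_pos: "u0 > 0" using u0_in by auto
    have u0_max: "\<rho> e \<le> u0" if "e \<in> ?E" for e
    proof (cases "\<rho> e > 0")
      case True
      then show ?thesis unfolding u0_def using fin that by (intro Max_ge) auto
    next
      case False
      then show ?thesis using u0_pos by linarith
    qed
    \<comment> \<open>The next wall below \<open>u0\<close>, or \<open>0\<close> if none is
      positive; the midpoint \<open>u1\<close> is then positive and only the walls at
      \<open>u0\<close> are crossed.\<close>
    define M where "M = Max (insert 0 (\<rho> ` {e \<in> ?E. \<rho> e < u0}))"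
    have finM: "finite (insert 0 (\<rho> ` {e \<in> ?E. \<rho> e < u0}))" using finite_edges by simp
    have M: "0 \<le> M" "M < u0" "\<And>e. e \<in> ?E \<Longrightarrow> \<rho> e < u0 \<Longrightarrow> \<rho> e \<le> M"
      using finM u0_pos by (auto simp: M_def)
    define u1 where "u1 = (M + u0) / 2"
    have u1: "0 < u1" "u1 < u0" "\<And>e. e \<in> ?E \<Longrightarrow> \<rho> e < u0 \<Longrightarrow> \<rho> e < u1"
      using M u0_pos by (force simp: u1_def)+
    define \<zeta> where "\<zeta> u v = u * \<xi> v + \<xi>' v" for u v
    have lin: "linear (\<zeta> u)" for u
      using less.prems by (simp add: \<zeta>_def polarizing_def linear_iff algebra_simps)
    have zeta: "\<zeta> u (?\<alpha> e) = \<xi> (?\<alpha> e) * (u - \<rho> e)" if "e \<in> ?E" for u e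
      by (simp add: \<zeta>_def xi'[OF that] algebra_simps)
    have rho_cases: "\<rho> e < u1 \<or> \<rho> e = u0" if "e \<in> ?E" for e
      using u0_max[OF that] u1(3)[OF that] by force
    have pol1: "polarizing \<Gamma> (\<zeta> u1)"
      using lin nz u1(2) rho_cases by (fastforce simp: polarizing_def zeta)
    have "betti \<Gamma> \<xi> i = betti \<Gamma> (\<zeta> u1) i"
    proof (rule betti_wall_crossing[OF lin less.prems(1) pol1, of u0])
      fix e assume e: "e \<in> ?E" "\<zeta> u0 (?\<alpha> e) \<noteq> 0"
      then have "\<rho> e < u1" using rho_cases[OF e(1)] by (auto simp: zeta)
      then show "(\<xi> (?\<alpha> e) < 0 \<longleftrightarrow> \<zeta> u0 (?\<alpha> e) < 0) \<and> (\<zeta> u1 (?\<alpha> e) < 0 \<longleftrightarrow> \<zeta> u0 (?\<alpha> e) < 0)"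
        using u1(2) by (simp add: zeta[OF e(1)] mult_less_0_iff)
    next
      fix p e e' assume e: "e \<in> skel_star \<Gamma> p" "e' \<in> skel_star \<Gamma> p"
        "\<zeta> u0 (?\<alpha> e) = 0" "\<zeta> u0 (?\<alpha> e') = 0"
      then have "\<rho> e = u0" "\<rho> e' = u0"
        using zeta[OF star_edge[OF e(1)], of u0] zeta[OF star_edge[OF e(2)], of u0]
          nz[OF star_edge[OF e(1)]] nz[OF star_edge[OF e(2)]] by simp_all
      then have "\<xi> (?\<alpha> e) * \<xi>' (?\<alpha> e') = \<xi> (?\<alpha> e') * \<xi>' (?\<alpha> e)"
        using xi'[OF star_edge[OF e(1)]] xi'[OF star_edge[OF e(2)]] by simp
      then show "e = e'" using less.prems(3) e(1,2) unfolding transverse_def by blast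
    qed
    also have "\<dots> = betti \<Gamma> \<xi>' i"
    proof (rule less.hyps[OF _ pol1 less.prems(2)])
      \<comment> \<open>Seen from the new start \<open>\<zeta> u1\<close>, the wall parameter of
        \<open>e\<close> becomes \<open>\<rho> e / (u1 - \<rho> e)\<close>; it is positive only for
        walls not yet crossed.\<close>
      have ratio: "- \<xi>' (?\<alpha> e) / \<zeta> u1 (?\<alpha> e) = \<rho> e / (u1 - \<rho> e)" if "e \<in> ?E" for e
        using nz[OF that] by (simp add: zeta[OF that] xi'[OF that])
      have pos: "0 < \<rho> e \<and> \<rho> e < u0" if "\<rho> e / (u1 - \<rho> e) > 0" for e
        using that u1(1,2) by (auto simp: zero_less_divide_iff)
      have sub: "{e \<in> ?E. - \<xi>' (?\<alpha> e) / \<zeta> u1 (?\<alpha> e) > 0} \<subseteq> {e \<in> ?P. \<rho> e < u0}"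
      proof
        fix e assume "e \<in> {e \<in> ?E. - \<xi>' (?\<alpha> e) / \<zeta> u1 (?\<alpha> e) > 0}"
        then show "e \<in> {e \<in> ?P. \<rho> e < u0}" using ratio[of e] pos[of e] by simp
      qed
      have "{e \<in> ?P. \<rho> e < u0} \<subset> ?P" using u0_in by auto
      with sub have "{e \<in> ?E. - \<xi>' (?\<alpha> e) / \<zeta> u1 (?\<alpha> e) > 0} \<subset> ?P"
        by (rule subset_psubset_trans)
      then have "card {e \<in> ?E. - \<xi>' (?\<alpha> e) / \<zeta> u1 (?\<alpha> e) > 0} < card ?P"
        by (rule psubset_card_mono[OF fin])
      then show "card {e \<in> ?E. - \<xi>' (?\<alpha> e) / \<zeta> u1 (?\<alpha> e) > 0} <
          card {e \<in> ?E. - \<xi>' (?\<alpha> e) / \<xi> (?\<alpha> e) > 0}"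
        by (simp only: \<rho>_def)
      show "transverse (\<zeta> u1) \<xi>'"
        unfolding transverse_def
      proof (intro allI impI)
        fix p e e' assume e: "e \<in> skel_star \<Gamma> p" "e' \<in> skel_star \<Gamma> p" "e \<noteq> e'"
        have "\<zeta> u1 (?\<alpha> e) * \<xi>' (?\<alpha> e') - \<zeta> u1 (?\<alpha> e') * \<xi>' (?\<alpha> e) =
            u1 * (\<xi> (?\<alpha> e) * \<xi>' (?\<alpha> e') - \<xi> (?\<alpha> e') * \<xi>' (?\<alpha> e))"
          by (simp add: \<zeta>_def algebra_simps)
        moreover have "\<xi> (?\<alpha> e) * \<xi>' (?\<alpha> e') \<noteq> \<xi> (?\<alpha> e') * \<xi>' (?\<alpha> e)"
          using less.prems(3) e unfolding transverse_def by blast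
        ultimately show "\<zeta> u1 (?\<alpha> e) * \<xi>' (?\<alpha> e') \<noteq> \<zeta> u1 (?\<alpha> e') * \<xi>' (?\<alpha> e)"
          using u1(1) by auto
      qed
    qed
    finally show ?thesis .
  qed
qed

text \<open>The two covectors need not be transverse to each other, so a third one,
  \<open>w\<close>, transverse to both, mediates. Failure of transversality means
  \<open>w \<bullet> D \<eta> e e' = 0\<close>, and \<open>D\<close> is nonzero because edges at a
  vertex are not parallel.\<close>

lemma betti_invariant:
  assumes pol: "polarizing \<Gamma> \<xi>" "polarizing \<Gamma> \<xi>'"
  shows "betti \<Gamma> \<xi> i = betti \<Gamma> \<xi>' i"
proof -
  let ?E = "skel_edges \<Gamma>" and ?\<alpha> = "axial \<Gamma>"
  define D where "D \<eta> e e' = \<eta> (?\<alpha> e) *\<^sub>R ?\<alpha> e' - \<eta> (?\<alpha> e') *\<^sub>R ?\<alpha> e" for \<eta> :: "real ^ 'n \<Rightarrow> real" and e e'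
  have nz: "?\<alpha> e \<noteq> 0" if "e \<in> ?E" for e
    using pol(1) that linear_0 by (force simp: polarizing_def)
  have D_nz: "D \<eta> e e' \<noteq> 0"
    if "polarizing \<Gamma> \<eta>" "e \<in> skel_star \<Gamma> p" "e' \<in> skel_star \<Gamma> p" "e \<noteq> e'" for \<eta> p e e'
  proof
    assume "D \<eta> e e' = 0"
    then have eq: "\<eta> (?\<alpha> e) *\<^sub>R ?\<alpha> e' = \<eta> (?\<alpha> e') *\<^sub>R ?\<alpha> e" by (simp add: D_def)
    have "\<eta> (?\<alpha> e) \<noteq> 0" using that(1) star_edge[OF that(2)] by (simp add: polarizing_def)
    then have "?\<alpha> e' = (1 / \<eta> (?\<alpha> e)) *\<^sub>R (\<eta> (?\<alpha> e) *\<^sub>R ?\<alpha> e')" by simp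
    also have "\<dots> \<in> span {?\<alpha> e}" unfolding eq by (intro span_mul span_base) simp
    finally show False using star_nonparallel that by blast
  qed
  define S where "S = {(e, e'). \<exists>p. e \<in> skel_star \<Gamma> p \<and> e' \<in> skel_star \<Gamma> p \<and> e \<noteq> e'}"
  define T where "T = ?\<alpha> ` ?E \<union> (\<lambda>(e, e'). D \<xi> e e') ` S \<union> (\<lambda>(e, e'). D \<xi>' e e') ` S"
  have "finite S"
    unfolding S_def
    by (rule finite_subset[of _ "?E \<times> ?E"]) (use finite_edges star_edge in auto)
  then have "finite T" using finite_edges by (simp add: T_def)
  moreover have "0 \<notin> T"
  proof
    assume "0 \<in> T"
    then consider e where "e \<in> ?E" "?\<alpha> e = 0" | \<eta> e e' where "polarizing \<Gamma> \<eta>" "(e, e') \<in> S" "D \<eta> e e' = 0"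
      using pol by (auto simp: T_def)
    then show False
    proof cases
      case 1
      then show ?thesis using nz by blast
    next
      case 2
      have "\<exists>p. e \<in> skel_star \<Gamma> p \<and> e' \<in> skel_star \<Gamma> p \<and> e \<noteq> e'"
        using 2(2) unfolding S_def mem_Collect_eq prod.case .
      then obtain p where "e \<in> skel_star \<Gamma> p" "e' \<in> skel_star \<Gamma> p" "e \<noteq> e'"
        by (elim exE conjE)
      from D_nz[OF 2(1) this] show ?thesis using 2(3) by (rule notE)
    qed
  qed
  ultimately obtain w where w: "\<forall>t\<in>T. w \<bullet> t \<noteq> 0"
    using exists_nonorthogonal_UNIV by blast
  have polw: "polarizing \<Gamma> (\<lambda>v. w \<bullet> v)"
  proof -
    have "w \<bullet> ?\<alpha> e \<noteq> 0" if "e \<in> ?E" for e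
      using w that unfolding T_def by blast
    then show ?thesis by (simp add: polarizing_def linear_inner)
  qed
  have "transverse \<eta> (\<lambda>v. w \<bullet> v)" if "\<eta> \<in> {\<xi>, \<xi>'}" for \<eta>
    unfolding transverse_def
  proof (intro allI impI notI)
    fix p e e' assume e: "e \<in> skel_star \<Gamma> p" "e' \<in> skel_star \<Gamma> p" "e \<noteq> e'"
      and eq: "\<eta> (?\<alpha> e) * (w \<bullet> ?\<alpha> e') = \<eta> (?\<alpha> e') * (w \<bullet> ?\<alpha> e)"
    have "(e, e') \<in> S"
      unfolding S_def mem_Collect_eq prod.case using e by (intro exI[of _ p] conjI)
    then have "(\<lambda>(e, e'). D \<eta> e e') (e, e') \<in> T" using that unfolding T_def by blast
    then have "D \<eta> e e' \<in> T" unfolding prod.case .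
    then have "w \<bullet> D \<eta> e e' \<noteq> 0" using w by blast
    then show False using eq by (simp add: D_def inner_diff_right)
  qed
  then show ?thesis
    using betti_transverse[OF pol(1) polw] betti_transverse[OF pol(2) polw] by simp
qed

end

subsection \<open>Slices as components\<close>

text \<open>Adjoining the edge and its endpoint keeps \<open>C\<close> connected, connectivity being
  that of the symmetric closure; maximality then forces the edge into \<open>C\<close>.\<close>

lemma max_connected_closed:
  assumes max: "pre_digraph.max_subgraph (with_proj G) Digraph_Component.connected (with_proj C)"
    and uv: "(u, v) \<in> parcs G" "u \<in> pverts C"
  shows "(u, v) \<in> parcs C"
proof -
  have sub: "subgraph (with_proj C) (with_proj G)"
    and con: "Digraph_Component.connected (with_proj C)"
    and maximal: "\<And>H'. H' \<noteq> with_proj C \<Longrightarrow> subgraph (with_proj C) H' \<Longrightarrow>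
      subgraph H' (with_proj G) \<Longrightarrow> \<not> Digraph_Component.connected H'"
    using max unfolding pre_digraph.max_subgraph_def by blast+
  have wfG: "wf_digraph (with_proj G)" and wfC: "wf_digraph (with_proj C)"
    and le: "pverts C \<subseteq> pverts G" "parcs C \<subseteq> parcs G"
    using sub by (auto simp: subgraph_def)
  define C' where "C' = \<lparr>pverts = insert v (pverts C), parcs = insert (u, v) (parcs C)\<rparr>"
  have C': "pverts C' = insert v (pverts C)" "parcs C' = insert (u, v) (parcs C)"
    by (simp_all add: C'_def)
  have "v \<in> pverts G" using wf_digraph.head_in_verts[OF wfG, of "(u, v)"] uv by simp
  have wfC': "wf_digraph (with_proj C')"
  proof
    fix e assume "e \<in> arcs (with_proj C')"
    then have "e = (u, v) \<or> e \<in> parcs C" by (simp add: C')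
    then show "tail (with_proj C') e \<in> verts (with_proj C')" "head (with_proj C') e \<in> verts (with_proj C')"
      using wf_digraph.tail_in_verts[OF wfC, of e] wf_digraph.head_in_verts[OF wfC, of e] uv(2)
      by (auto simp: C')
  qed
  have "subgraph (with_proj C) (with_proj C')"
    using wfC wfC' by (auto simp: subgraph_def C')
  moreover have "subgraph (with_proj C') (with_proj G)"
    using wfC' wfG le uv \<open>v \<in> pverts G\<close> by (auto simp: subgraph_def C')
  moreover have "Digraph_Component.connected (with_proj C')"
    unfolding connected_conv with_proj_simps C'
  proof (intro conjI ballI)
    let ?V = "insert v (pverts C)" and ?R = "symcl (insert (u, v) (parcs C))"
    show "?V \<noteq> {}" by simp
    have old: "(x, y) \<in> rtrancl_on ?V ?R" if "x \<in> pverts C" "y \<in> pverts C" for x y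
    proof (rule rtrancl_on_mono)
      show "(x, y) \<in> rtrancl_on (pverts C) (symcl (parcs C))"
        using con that by (simp add: connected_conv)
    qed (auto simp: symcl_def)
    have "(u, v) \<in> rtrancl_on ?V ?R" "(v, u) \<in> rtrancl_on ?V ?R"
      using uv(2) rtrancl_on_into_rtrancl_on[of u u ?V ?R v] rtrancl_on_into_rtrancl_on[of v v ?V ?R u]
      by (auto simp: symcl_def)
    then have to_u: "(x, u) \<in> rtrancl_on ?V ?R" "(u, x) \<in> rtrancl_on ?V ?R" if "x \<in> ?V" for x
      using that old uv(2) by auto
    show "(x, y) \<in> rtrancl_on ?V ?R" if "x \<in> ?V" "y \<in> ?V" for x y
      using to_u(1)[OF that(1)] to_u(2)[OF that(2)] by (rule rtrancl_on_trans)
  qed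
  ultimately have "with_proj C' = with_proj C" using maximal by blast
  then have "parcs C' = parcs C" by (metis with_proj_simps(2))
  then show ?thesis using C' by blast
qed

text \<open>Vertices plus arcs are maximised among the connected subgraphs containing
  \<open>p\<close>, starting from the lone vertex.\<close>

lemma max_connected_exists:
  assumes G: "pair_fin_digraph G" and p: "p \<in> pverts G"
  shows "\<exists>C. pre_digraph.max_subgraph (with_proj G) Digraph_Component.connected (with_proj C) \<and> p \<in> pverts C"
proof -
  interpret G: pair_fin_digraph G by (rule G)
  define ok where "ok C \<longleftrightarrow> subgraph (with_proj C) (with_proj G) \<and>
    Digraph_Component.connected (with_proj C) \<and> p \<in> pverts C" for C
  define size where "size C = card (pverts C) + card (parcs C)" for C :: "'a pair_pre_digraph"
  have le: "pverts C \<subseteq> pverts G" "parcs C \<subseteq> parcs G" if "ok C" for C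
    using that by (auto simp: ok_def subgraph_def)
  have "ok \<lparr>pverts = {p}, parcs = {}\<rparr>"
  proof -
    have "wf_digraph (with_proj \<lparr>pverts = {p}, parcs = {}\<rparr>)" by unfold_locales auto
    moreover have "(p, p) \<in> rtrancl_on {p} (symcl {})" by (rule rtrancl_on_refl) simp
    ultimately show ?thesis
      using p G.wf_digraph_axioms by (auto simp: ok_def subgraph_def connected_conv)
  qed
  moreover have "size C < card (pverts G) + card (parcs G) + 1" if "ok C" for C
    unfolding size_def
    using card_mono[OF G.pair_finite_verts le(1)[OF that]] card_mono[OF G.pair_finite_arcs le(2)[OF that]]
    by linarith
  ultimately obtain C where C: "ok C" and max: "\<And>D. ok D \<Longrightarrow> size D \<le> size C"
    using ex_has_greatest_nat[of ok _ size "card (pverts G) + card (parcs G) + 1"] by blast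
  have "pre_digraph.max_subgraph (with_proj G) Digraph_Component.connected (with_proj C)"
    unfolding pre_digraph.max_subgraph_def
  proof (intro conjI allI impI notI)
    show "subgraph (with_proj C) (with_proj G)" "Digraph_Component.connected (with_proj C)"
      using C by (auto simp: ok_def)
    fix K assume K: "K \<noteq> with_proj C \<and> subgraph (with_proj C) K"
      "subgraph K (with_proj G) \<and> Digraph_Component.connected K"
    \<comment> \<open>The competitor \<open>K\<close> is an arbitrary digraph; compatibility with
      the larger graph puts it into the form \<open>with_proj D\<close>.\<close>
    define D where "D = \<lparr>pverts = verts K, parcs = arcs K\<rparr>"
    have "with_proj D = K"
      using K by (cases K) (auto simp: D_def with_proj_def subgraph_def compatible_def)
    moreover have le_D: "pverts C \<subseteq> pverts D" "parcs C \<subseteq> parcs D"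
      using K by (auto simp: D_def subgraph_def)
    ultimately have D: "ok D" "D \<noteq> C" using K C by (auto simp: ok_def)
    have "finite (pverts D)" "finite (parcs D)"
      using le[OF D(1)] G.pair_finite_verts G.pair_finite_arcs finite_subset by blast+
    then have "pverts C = pverts D" "parcs C = parcs D"
      using max[OF D(1)] le_D card_mono[of "pverts D" "pverts C"] card_mono[of "parcs D" "parcs C"]
        card_seteq[of "pverts D" "pverts C"] card_seteq[of "parcs D" "parcs C"]
      by (simp_all add: size_def)
    then show False using D(2) by simp
  qed
  then show ?thesis using C by (auto simp: ok_def)
qed

text \<open>Closure under edges in \<open>H\<close>, which every component has. Unlike a component
  of \<open>slice_graph\<close>, a lone vertex with no edge in \<open>H\<close> qualifies
  too.\<close>

definition slice_at :: "('v, 'n::finite) skeleton \<Rightarrow> (real ^ 'n) set \<Rightarrow> 'v pair_pre_digraph \<Rightarrow> bool" where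
  "slice_at \<Gamma> H C \<longleftrightarrow> pverts C \<subseteq> skel_verts \<Gamma> \<and>
    parcs C = {e \<in> skel_edges \<Gamma>. fst e \<in> pverts C \<and> axial \<Gamma> e \<in> H} \<and>
    (\<forall>e\<in>parcs C. snd e \<in> pverts C)"

context one_skeleton
begin

lemma axial_skeleton: "axial_skeleton \<Gamma>"
proof
  show "finite (skel_verts \<Gamma>)" by (rule pair_finite_verts)
next
  fix p q assume e: "(p, q) \<in> skel_edges \<Gamma>"
  show "p \<in> skel_verts \<Gamma> \<and> q \<in> skel_verts \<Gamma>" using in_arcsD1[OF e] in_arcsD2[OF e] by simp
  show "(q, p) \<in> skel_edges \<Gamma>"
    using pair_sym_arcs e by (auto simp: symmetric_def dest: symD)
  show "axial \<Gamma> (q, p) = - axial \<Gamma> (p, q)" by (rule axial_reverse[OF e])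
  fix q' assume e': "(p, q') \<in> skel_edges \<Gamma>" "q \<noteq> q'"
  have "axial \<Gamma> (p, q) \<noteq> axial \<Gamma> (p, q') \<and> independent {axial \<Gamma> (p, q), axial \<Gamma> (p, q')}"
    by (rule axial_indep) (use e e' in_arcsD1[OF e] in \<open>auto simp: out_arcs_def\<close>)
  then show "axial \<Gamma> (p, q) \<notin> span {axial \<Gamma> (p, q')}"
    by (simp add: independent_insert)
qed

sublocale axial: axial_skeleton \<Gamma>
  by (rule axial_skeleton)

lemma slice_graph_arcs: "parcs (slice_graph \<Gamma> H) = {e \<in> skel_edges \<Gamma>. axial \<Gamma> e \<in> H}"
  and slice_graph_verts:
    "pverts (slice_graph \<Gamma> H) = fst ` {e \<in> skel_edges \<Gamma>. axial \<Gamma> e \<in> H} \<union> snd ` {e \<in> skel_edges \<Gamma>. axial \<Gamma> e \<in> H}"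
  by (simp_all add: slice_graph_def Let_def)

lemma slice_at_component:
  assumes max: "pre_digraph.max_subgraph (with_proj (slice_graph \<Gamma> H)) Digraph_Component.connected (with_proj C)"
  shows "slice_at \<Gamma> H C"
proof -
  have "subgraph (with_proj C) (with_proj (slice_graph \<Gamma> H))"
    using max by (simp add: pre_digraph.max_subgraph_def)
  then have wf: "wf_digraph (with_proj C)" and le: "pverts C \<subseteq> pverts (slice_graph \<Gamma> H)"
    "parcs C \<subseteq> parcs (slice_graph \<Gamma> H)" by (auto simp: subgraph_def)
  have ends: "fst e \<in> pverts C" "snd e \<in> pverts C" if "e \<in> parcs C" for e
    using wf_digraph.tail_in_verts[OF wf, of e] wf_digraph.head_in_verts[OF wf, of e] that by simp_all
  have "pverts C \<subseteq> skel_verts \<Gamma>"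
    using le(1) axial.edge_verts unfolding slice_graph_verts by auto
  moreover have "parcs C = {e \<in> skel_edges \<Gamma>. fst e \<in> pverts C \<and> axial \<Gamma> e \<in> H}"
  proof (intro equalityI subsetI)
    fix e assume "e \<in> parcs C"
    then show "e \<in> {e \<in> skel_edges \<Gamma>. fst e \<in> pverts C \<and> axial \<Gamma> e \<in> H}"
      using ends le(2) unfolding slice_graph_arcs by blast
  next
    fix e assume "e \<in> {e \<in> skel_edges \<Gamma>. fst e \<in> pverts C \<and> axial \<Gamma> e \<in> H}"
    then show "e \<in> parcs C"
      using max_connected_closed[OF max, of "fst e" "snd e"] unfolding slice_graph_arcs by simp
  qed
  ultimately show ?thesis using ends by (simp add: slice_at_def)
qed

lemma two_slicesE:
  assumes "\<Sigma> \<in> two_slices \<Gamma>"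
  obtains H C where "\<Sigma> = \<Gamma>\<lparr>graph := C\<rparr>" "subspace H" "slice_at \<Gamma> H C"
  using assms slice_at_component unfolding two_slices_def by blast

lemma slice_through_edge:
  assumes H: "subspace H" "dim H = 2" and e: "(p, q) \<in> skel_edges \<Gamma>" "axial \<Gamma> (p, q) \<in> H"
  shows "\<exists>C. \<Gamma>\<lparr>graph := C\<rparr> \<in> two_slices \<Gamma> \<and> slice_at \<Gamma> H C \<and> p \<in> pverts C"
proof -
  let ?E = "{e \<in> skel_edges \<Gamma>. axial \<Gamma> e \<in> H}"
  have fin: "pair_fin_digraph (slice_graph \<Gamma> H)"
    by unfold_locales (auto simp: slice_graph_arcs slice_graph_verts axial.finite_edges)
  have "(p, q) \<in> ?E" using e by simp
  then have "fst (p, q) \<in> fst ` ?E" by (rule imageI)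
  then have "p \<in> pverts (slice_graph \<Gamma> H)" unfolding slice_graph_verts by simp
  then obtain C where "pre_digraph.max_subgraph (with_proj (slice_graph \<Gamma> H))
      Digraph_Component.connected (with_proj C)" "p \<in> pverts C"
    using max_connected_exists[OF fin] by blast
  then show ?thesis using H slice_at_component unfolding two_slices_def by blast
qed

end

section \<open>What slices inherit\<close>

locale slice = axial_skeleton \<Gamma>
  for \<Gamma> :: "('v, 'n::finite) skeleton" +
  fixes H :: "(real ^ 'n) set" and C :: "'v pair_pre_digraph"
  assumes subspace: "subspace H" and slice_at: "slice_at \<Gamma> H C"
begin

lemma slice_verts: "p \<in> pverts C \<Longrightarrow> p \<in> skel_verts \<Gamma>"
  and slice_edge_iff: "(p, q) \<in> parcs C \<longleftrightarrow> (p, q) \<in> skel_edges \<Gamma> \<and> p \<in> pverts C \<and> axial \<Gamma> (p, q) \<in> H"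
  using slice_at by (auto simp: slice_at_def)

lemma slice_edge_snd: "(p, q) \<in> parcs C \<Longrightarrow> q \<in> pverts C"
  using slice_at unfolding slice_at_def by force

lemma slice_axial_skeleton: "axial_skeleton (\<Gamma>\<lparr>graph := C\<rparr>)"
proof
  have "pverts C \<subseteq> skel_verts \<Gamma>" using slice_verts by blast
  then show "finite (skel_verts (\<Gamma>\<lparr>graph := C\<rparr>))" using finite_verts finite_subset by auto
next
  fix p q assume "(p, q) \<in> skel_edges (\<Gamma>\<lparr>graph := C\<rparr>)"
  then have pq: "(p, q) \<in> parcs C" by simp
  then have E: "(p, q) \<in> skel_edges \<Gamma>" "p \<in> pverts C" "axial \<Gamma> (p, q) \<in> H" by (auto simp: slice_edge_iff)
  have q: "q \<in> pverts C" by (rule slice_edge_snd[OF pq])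
  show "p \<in> skel_verts (\<Gamma>\<lparr>graph := C\<rparr>) \<and> q \<in> skel_verts (\<Gamma>\<lparr>graph := C\<rparr>)" using E q by simp
  show "axial (\<Gamma>\<lparr>graph := C\<rparr>) (q, p) = - axial (\<Gamma>\<lparr>graph := C\<rparr>) (p, q)"
    using reverse[OF E(1)] by simp
  have "axial \<Gamma> (q, p) \<in> H" using reverse[OF E(1)] E(3) subspace by (simp add: subspace_neg)
  then show "(q, p) \<in> skel_edges (\<Gamma>\<lparr>graph := C\<rparr>)"
    using edge_sym[OF E(1)] q by (simp add: slice_edge_iff)
  fix q' assume "(p, q') \<in> skel_edges (\<Gamma>\<lparr>graph := C\<rparr>)" "q \<noteq> q'"
  then show "axial (\<Gamma>\<lparr>graph := C\<rparr>) (p, q) \<notin> span {axial (\<Gamma>\<lparr>graph := C\<rparr>) (p, q')}"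
    using nonparallel[OF E(1)] by (simp add: slice_edge_iff)
qed

lemma slice_polarizing: "polarizing \<Gamma> \<xi> \<Longrightarrow> polarizing (\<Gamma>\<lparr>graph := C\<rparr>) \<xi>"
  by (auto simp: polarizing_def slice_edge_iff)

lemma slice_ranked_skeleton:
  assumes "ranked_skeleton \<Gamma> \<xi> r"
  shows "ranked_skeleton (\<Gamma>\<lparr>graph := C\<rparr>) \<xi> r"
proof -
  interpret r: ranked_skeleton \<Gamma> \<xi> r by (rule assms)
  interpret s: axial_skeleton "\<Gamma>\<lparr>graph := C\<rparr>" by (rule slice_axial_skeleton)
  have "inj_on r (pverts C)"
    using r.rank_inj slice_verts by (blast intro: inj_on_subset)
  then show ?thesis
    using slice_polarizing[OF r.polarizing] r.rank_mono by unfold_locales (auto simp: slice_edge_iff)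
qed

lemma slice_acyclic_orientation:
  assumes "acyclic_orientation \<Gamma> \<xi>"
  shows "acyclic_orientation (\<Gamma>\<lparr>graph := C\<rparr>) \<xi>"
proof -
  have "{e \<in> parcs C. 0 < \<xi> (axial \<Gamma> e)} \<subseteq> {e \<in> skel_edges \<Gamma>. 0 < \<xi> (axial \<Gamma> e)}"
    by (auto simp: slice_edge_iff)
  then show ?thesis using assms unfolding acyclic_orientation_def by (auto intro: acyclic_subset)
qed

lemma slice_star: "skel_star (\<Gamma>\<lparr>graph := C\<rparr>) p \<subseteq> skel_star \<Gamma> p"
  by (auto simp: out_arcs_def slice_edge_iff)

lemma axial_slice: "axial (\<Gamma>\<lparr>graph := C\<rparr>) = axial \<Gamma>"
  by simp

lemma slice_generic:
  assumes "generic \<Gamma> \<xi>"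
  shows "generic (\<Gamma>\<lparr>graph := C\<rparr>) \<xi>"
  unfolding generic_def
proof
  fix p assume "p \<in> skel_verts (\<Gamma>\<lparr>graph := C\<rparr>)"
  then have "p \<in> skel_verts \<Gamma>" using slice_verts by simp
  then have inj: "inj_on (\<lambda>(e, e'). axial \<Gamma> e /\<^sub>R \<xi> (axial \<Gamma> e) - axial \<Gamma> e' /\<^sub>R \<xi> (axial \<Gamma> e'))
      {(e, e'). e \<in> skel_star \<Gamma> p \<and> e' \<in> skel_star \<Gamma> p \<and> e \<noteq> e'}"
    using assms unfolding generic_def by (rule bspec[rotated])
  show "inj_on (\<lambda>(e, e'). axial (\<Gamma>\<lparr>graph := C\<rparr>) e /\<^sub>R \<xi> (axial (\<Gamma>\<lparr>graph := C\<rparr>) e) -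
      axial (\<Gamma>\<lparr>graph := C\<rparr>) e' /\<^sub>R \<xi> (axial (\<Gamma>\<lparr>graph := C\<rparr>) e'))
      {(e, e'). e \<in> skel_star (\<Gamma>\<lparr>graph := C\<rparr>) p \<and> e' \<in> skel_star (\<Gamma>\<lparr>graph := C\<rparr>) p \<and> e \<noteq> e'}"
    unfolding axial_slice by (rule inj_on_subset[OF inj]) (use slice_star[of p] in blast)
qed

end

text \<open>The connection preserves \<open>H\<close>: a positive multiple of the transported axial
  vector differs from one in \<open>H\<close> by a multiple of another.\<close>

lemma (in one_skeleton) conn_skeleton_slice:
  assumes "subspace H" "slice_at \<Gamma> H C"
  shows "conn_skeleton (\<Gamma>\<lparr>graph := C\<rparr>)"
proof -
  interpret slice \<Gamma> H C using assms by unfold_locales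
  interpret s: axial_skeleton "\<Gamma>\<lparr>graph := C\<rparr>" by (rule slice_axial_skeleton)
  have star: "e \<in> skel_star \<Gamma> p" if "e \<in> skel_star (\<Gamma>\<lparr>graph := C\<rparr>) p" for e p
    using slice_star that by blast
  have in_H: "axial \<Gamma> e \<in> H" if "e \<in> skel_star (\<Gamma>\<lparr>graph := C\<rparr>) p" for e p
    using that by (cases e) (auto simp: s.skel_star_eq slice_edge_iff)
  have E: "(p, q) \<in> skel_edges \<Gamma>" if "(p, q) \<in> skel_edges (\<Gamma>\<lparr>graph := C\<rparr>)" for p q
    using that by (simp add: slice_edge_iff)
  have conn: "\<exists>l>0. axial \<Gamma> e - l *\<^sub>R axial \<Gamma> (conn \<Gamma> (p, q) e) \<in> span {axial \<Gamma> (p, q)}"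
    if "(p, q) \<in> skel_edges \<Gamma>" "e \<in> skel_star \<Gamma> p" for p q e
    using scal_pos[OF that] axial_conn[OF that] by blast
  show ?thesis
  proof
    fix p q e assume "(p, q) \<in> skel_edges (\<Gamma>\<lparr>graph := C\<rparr>)" and e: "e \<in> skel_star (\<Gamma>\<lparr>graph := C\<rparr>) p"
    then have pq: "(p, q) \<in> parcs C" "(p, q) \<in> skel_edges \<Gamma>" using E by simp_all
    let ?e = "conn \<Gamma> (p, q) e"
    have e': "?e \<in> skel_star \<Gamma> q"
      using bij_betwE[OF conn_bij[OF pq(2)]] star[OF e] by blast
    obtain l where l: "l > 0" "axial \<Gamma> e - l *\<^sub>R axial \<Gamma> ?e \<in> span {axial \<Gamma> (p, q)}"
      using conn[OF pq(2) star[OF e]] by blast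
    have "span {axial \<Gamma> (p, q)} \<subseteq> H"
      using pq(1) subspace by (intro span_minimal) (simp_all add: slice_edge_iff)
    then have "axial \<Gamma> e - l *\<^sub>R axial \<Gamma> ?e \<in> H" using l(2) by blast
    then have "axial \<Gamma> e - (axial \<Gamma> e - l *\<^sub>R axial \<Gamma> ?e) \<in> H"
      by (rule subspace_diff[OF subspace in_H[OF e]])
    then have "l *\<^sub>R axial \<Gamma> ?e \<in> H" by simp
    then have "(1 / l) *\<^sub>R (l *\<^sub>R axial \<Gamma> ?e) \<in> H" by (rule subspace_scale[OF subspace])
    then have "axial \<Gamma> ?e \<in> H" using l(1) by simp
    then show "conn (\<Gamma>\<lparr>graph := C\<rparr>) (p, q) e \<in> skel_star (\<Gamma>\<lparr>graph := C\<rparr>) q"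
      using e' slice_edge_snd[OF pq(1)] by (cases ?e) (simp add: out_arcs_def slice_edge_iff)
    show "\<exists>l>0. axial (\<Gamma>\<lparr>graph := C\<rparr>) e - l *\<^sub>R axial (\<Gamma>\<lparr>graph := C\<rparr>) (conn (\<Gamma>\<lparr>graph := C\<rparr>) (p, q) e)
        \<in> span {axial (\<Gamma>\<lparr>graph := C\<rparr>) (p, q)}"
      using conn[OF pq(2) star[OF e]] by simp
    show "conn (\<Gamma>\<lparr>graph := C\<rparr>) (q, p) (conn (\<Gamma>\<lparr>graph := C\<rparr>) (p, q) e) = e"
      using conn_inverse[OF pq(2) star[OF e]] by simp
  next
    fix p q assume "(p, q) \<in> skel_edges (\<Gamma>\<lparr>graph := C\<rparr>)"
    then show "conn (\<Gamma>\<lparr>graph := C\<rparr>) (p, q) (p, q) = (q, p)" using conn_self[OF E] by simp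
  qed
qed

subsection \<open>Flow-up classes of slices\<close>

locale ranked_slice = ranked_skeleton \<Gamma> \<xi> r + slice \<Gamma> H C
  for \<Gamma> :: "('v, 'n::finite) skeleton" and \<xi> r H C
begin

sublocale S: ranked_skeleton "\<Gamma>\<lparr>graph := C\<rparr>" \<xi> r
  by (rule slice_ranked_skeleton) unfold_locales

lemma slice_down: "p \<in> pverts C \<Longrightarrow> S.down p = {e \<in> down p. axial \<Gamma> e \<in> H}"
  by (auto simp: S.down_def down_def slice_edge_iff)

lemma thom_slice:
  assumes "p \<in> pverts C"
  shows "thom p = S.thom p * (\<Prod>e\<in>{e \<in> down p. axial \<Gamma> e \<notin> H}. sym_vec (axial \<Gamma> e))"
proof -
  have "down p = {e \<in> down p. axial \<Gamma> e \<in> H} \<union> {e \<in> down p. axial \<Gamma> e \<notin> H}" by blast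
  then have "thom p = (\<Prod>e\<in>{e \<in> down p. axial \<Gamma> e \<in> H} \<union> {e \<in> down p. axial \<Gamma> e \<notin> H}. sym_vec (axial \<Gamma> e))"
    unfolding thom_def by (rule arg_cong)
  also have "\<dots> = S.thom p * (\<Prod>e\<in>{e \<in> down p. axial \<Gamma> e \<notin> H}. sym_vec (axial \<Gamma> e))"
    unfolding S.thom_def slice_down[OF assms] using finite_down
    by (subst prod.union_disjoint) auto
  finally show ?thesis .
qed

text \<open>Multiplication by the product of all edges that leave \<open>H\<close> makes the extension by zero a class
  on the whole graph.\<close>

lemma leading_avoids:
  assumes p: "p \<in> pverts C" and f: "S.flow_up p f"
  shows "\<exists>u\<in>leading p. vec_prod H u"
proof -
  let ?\<alpha> = "\<lambda>e. sym_vec (axial \<Gamma> e)"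
  define T where "T = {e \<in> skel_edges \<Gamma>. fst e \<in> pverts C \<and> axial \<Gamma> e \<notin> H}"
  have finT: "finite T" using finite_edges by (simp add: T_def)
  define Q where "Q = (\<Prod>e\<in>T. ?\<alpha> e)"
  have dvd_Q: "?\<alpha> e dvd Q" if "e \<in> T" for e
    unfolding Q_def using finT that by (rule dvd_prodI)
  have f_eq: "f \<in> eqcoh (\<Gamma>\<lparr>graph := C\<rparr>)" and f_below: "S.vanishes_below (r p) f"
    and fp: "f p = S.thom p" using f by (auto simp: S.flow_up_def)
  have f0: "f v = 0" if "v \<notin> pverts C" for v using f_eq that by (simp add: S.eqcoh_iff)
  have "(\<lambda>v. Q * f v) \<in> eqcoh \<Gamma>"
    unfolding eqcoh_iff
  proof (intro conjI allI impI)
    fix v assume "v \<notin> skel_verts \<Gamma>"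
    then show "Q * f v = 0" using f0 slice_verts by force
  next
    fix s t assume st: "(s, t) \<in> skel_edges \<Gamma>"
    \<comment> \<open>An edge from the slice to its complement is not in \<open>H\<close>, since
      \<open>C\<close> is closed under edges in \<open>H\<close>; so it or its reverse is in
      \<open>T\<close>.\<close>
    consider "(s, t) \<in> parcs C" | "(s, t) \<in> T" | "s \<notin> pverts C" "(t, s) \<in> T" | "s \<notin> pverts C" "t \<notin> pverts C"
    proof -
      have "(t, s) \<in> T" if "s \<notin> pverts C" "t \<in> pverts C"
        using that edge_sym[OF st] slice_edge_snd[of t s] by (auto simp: T_def slice_edge_iff)
      then show thesis using that st unfolding T_def slice_edge_iff by fastforce
    qed
    then show "?\<alpha> (s, t) dvd Q * f t - Q * f s"
    proof cases
      case 1
      then show ?thesis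
        using S.eqcoh_edge[OF f_eq, of s t] by (simp add: right_diff_distrib[symmetric])
    next
      case 2
      then show ?thesis using dvd_Q by (simp add: right_diff_distrib[symmetric])
    next
      case 3
      have "?\<alpha> (s, t) dvd Q"
        using dvd_Q[OF 3(2)] by (simp add: reverse[OF st] sym_vec_uminus)
      then show ?thesis using f0[OF 3(1)] by simp
    next
      case 4
      then show ?thesis by (simp add: f0)
    qed
  qed
  moreover have "vanishes_below (r p) (\<lambda>v. Q * f v)"
    using f_below f0 by (force simp: vanishes_below_def S.vanishes_below_def)
  \<comment> \<open>The factors of \<open>Q\<close> descending from \<open>p\<close> complete the
    Thom value of the slice to that of the graph; the others form the witness.\<close>
  moreover have "Q * f p = (\<Prod>e\<in>T - down p. ?\<alpha> e) * thom p"
  proof -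
    have "T \<inter> down p = {e \<in> down p. axial \<Gamma> e \<notin> H}" using p by (auto simp: T_def down_def)
    moreover have "Q = (\<Prod>e\<in>T - down p. ?\<alpha> e) * (\<Prod>e\<in>T \<inter> down p. ?\<alpha> e)"
      unfolding Q_def using prod.Int_Diff[OF finT, of ?\<alpha> "down p"] by (simp add: mult.commute)
    ultimately show ?thesis by (simp add: fp thom_slice[OF p] mult_ac)
  qed
  ultimately have "(\<Prod>e\<in>T - down p. ?\<alpha> e) \<in> leading p"
    unfolding leading_def by blast
  moreover have "vec_prod H (\<Prod>e\<in>T - down p. ?\<alpha> e)"
    using finT by (intro vec_prod_prod) (auto simp: T_def)
  ultimately show ?thesis by blast
qed

text \<open>Let \<open>w\<close> be orthogonal to \<open>H\<close> but not to any edge outside \<open>H\<close>. The translation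
  \<open>v \<mapsto> v + w \<bullet> v\<close> fixes the edges in \<open>H\<close> and turns the other factors of the Thom value into units modulo
  higher degree.\<close>

lemma slice_flow_up:
  assumes p: "p \<in> pverts C" and f: "flow_up p f"
  shows "\<exists>g. S.flow_up p g"
proof -
  define L where "L = {w. \<forall>h\<in>H. w \<bullet> h = 0}"
  have "subspace L"
    by (auto simp: L_def subspace_def inner_add_left)
  moreover have "\<exists>w\<in>L. w \<bullet> t \<noteq> 0" if "t \<in> axial \<Gamma> ` skel_edges \<Gamma> - H" for t
  proof -
    have "t \<notin> H" using that by blast
    obtain y z where yz: "y \<in> span H" "\<And>h. h \<in> span H \<Longrightarrow> orthogonal z h" "t = y + z"
      using orthogonal_subspace_decomp_exists[of H t] by metis
    have "y \<in> H" using yz(1) subspace by (simp add: span_eq_iff[THEN iffD2])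
    then have "z \<noteq> 0" using yz(3) \<open>t \<notin> H\<close> by auto
    moreover have "z \<bullet> y = 0" using yz by (simp add: orthogonal_def)
    ultimately have "z \<bullet> t \<noteq> 0" by (simp add: yz(3) inner_add_right)
    moreover have "z \<in> L" using yz(2) by (auto simp: L_def orthogonal_def span_base)
    ultimately show ?thesis by blast
  qed
  ultimately obtain w where w: "w \<in> L" "\<forall>t\<in>axial \<Gamma> ` skel_edges \<Gamma> - H. w \<bullet> t \<noteq> 0"
    using exists_nonorthogonal[of "axial \<Gamma> ` skel_edges \<Gamma> - H" L] finite_edges by blast
  define \<rho> where "\<rho> = sym_self.subst (\<lambda>i. sym_vec (axis i 1) + sym_const (w $ i))"
  have rho_vec: "\<rho> (sym_vec v) = sym_vec v + sym_const (w \<bullet> v)" for v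
    unfolding \<rho>_def sym_self.subst_vec
    by (subst sym_vec_expand[of v])
      (simp add: distrib_left sum.distrib sym_const_mult[symmetric] sym_const_sum[symmetric]
        inner_vec_def mult.commute)
  have rho_H: "\<rho> (sym_vec v) = sym_vec v" if "v \<in> H" for v
    using w(1) that by (simp add: rho_vec L_def)
  define k where "k = ind (\<Gamma>\<lparr>graph := C\<rparr>) \<xi> p"
  define D where "D = {e \<in> down p. axial \<Gamma> e \<notin> H}"
  define c where "c = (\<Prod>e\<in>D. w \<bullet> axial \<Gamma> e)"
  have finD: "finite D" using finite_down by (simp add: D_def)
  have c: "c \<noteq> 0" unfolding c_def using finD w(2) by (auto simp: D_def down_def)
  have hcomp_rho: "hcomp 0 (\<Prod>e\<in>D. \<rho> (sym_vec (axial \<Gamma> e))) = sym_const c"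
    unfolding c_def using finD
  proof (induction D rule: finite_induct)
    case empty
    show ?case using homogeneous_const[of 1] by (simp add: homogeneous_iff_hcomp)
  next
    case (insert e D)
    have "hcomp 0 (sym_vec (axial \<Gamma> e)) = 0"
      using hcomp_hcomp[of 0 1 "sym_vec (axial \<Gamma> e)"] homogeneous_vec[of "axial \<Gamma> e"]
      by (simp add: homogeneous_iff_hcomp)
    then have "hcomp 0 (\<rho> (sym_vec (axial \<Gamma> e))) = sym_const (w \<bullet> axial \<Gamma> e)"
      using homogeneous_const[of "w \<bullet> axial \<Gamma> e"] by (simp add: rho_vec hcomp_add homogeneous_iff_hcomp)
    then show ?case using insert by (simp add: hcomp_0_mult sym_const_mult)
  qed
  \<comment> \<open>\<open>\<rho>\<close> fixes the Thom value of the slice, of degree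
    \<open>k\<close>. In degree \<open>k\<close> the value at \<open>p\<close> is therefore this
    Thom value times the constant term \<open>c\<close> of the other factors.\<close>
  define g where "g v = (if v \<in> pverts C then sym_const (1 / c) * hcomp k (\<rho> (f v)) else 0)" for v
  have f_eq: "f \<in> eqcoh \<Gamma>" and f_below: "vanishes_below (r p) f" and fp: "f p = thom p"
    using f by (auto simp: flow_up_def)
  have rho_0: "\<rho> 0 = 0" by (simp add: \<rho>_def sym_self.subst_0)
  have "g \<in> eqcoh (\<Gamma>\<lparr>graph := C\<rparr>)"
    unfolding S.eqcoh_iff
  proof (intro conjI allI impI)
    fix v assume "v \<notin> skel_verts (\<Gamma>\<lparr>graph := C\<rparr>)"
    then show "g v = 0" by (simp add: g_def)
  next
    fix s t assume "(s, t) \<in> skel_edges (\<Gamma>\<lparr>graph := C\<rparr>)"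
    then have st: "(s, t) \<in> parcs C" by simp
    then have st': "(s, t) \<in> skel_edges \<Gamma>" "s \<in> pverts C" "axial \<Gamma> (s, t) \<in> H" "t \<in> pverts C"
      using slice_edge_snd by (auto simp: slice_edge_iff)
    obtain h where h: "f t - f s = sym_vec (axial \<Gamma> (s, t)) * h"
      using eqcoh_edge[OF f_eq st'(1)] by (elim dvdE)
    have "\<rho> (f t) - \<rho> (f s) = sym_vec (axial \<Gamma> (s, t)) * \<rho> h"
      using arg_cong[OF h, of \<rho>] rho_H[OF st'(3)]
      by (simp add: \<rho>_def sym_self.subst_diff sym_self.subst_mult)
    then have "sym_vec (axial \<Gamma> (s, t)) dvd hcomp k (\<rho> (f t)) - hcomp k (\<rho> (f s))"
      by (simp add: hcomp_diff[symmetric] hcomp_mult_homogeneous[OF homogeneous_vec])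
    then have "sym_vec (axial \<Gamma> (s, t)) dvd g t - g s"
      using st' by (simp add: g_def right_diff_distrib[symmetric])
    then show "sym_vec (axial (\<Gamma>\<lparr>graph := C\<rparr>) (s, t)) dvd g t - g s" by simp
  qed
  moreover have "S.vanishes_below (r p) g"
    using f_below slice_verts by (auto simp: vanishes_below_def S.vanishes_below_def g_def rho_0)
  moreover have "g p = S.thom p"
  proof -
    have "\<rho> (S.thom p) = S.thom p"
      unfolding S.thom_def slice_down[OF p] by (simp add: \<rho>_def sym_self.subst_prod)
        (intro prod.cong refl rho_H[unfolded \<rho>_def], simp)
    then have "\<rho> (f p) = S.thom p * (\<Prod>e\<in>D. \<rho> (sym_vec (axial \<Gamma> e)))"
      by (simp add: fp thom_slice[OF p] D_def \<rho>_def sym_self.subst_mult sym_self.subst_prod)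
    then have "hcomp k (\<rho> (f p)) = S.thom p * sym_const c"
      by (simp add: k_def hcomp_mult_homogeneous[OF S.homogeneous_thom] hcomp_rho)
    then have "g p = S.thom p * sym_const (1 / c * c)"
      using p by (simp only: g_def if_True sym_const_mult mult_ac)
    then show ?thesis using c by simp
  qed
  ultimately show ?thesis by (auto simp: S.flow_up_def)
qed

end

text \<open>On a line any two edges at a vertex would be parallel, so components are points or
  single edges. The class is supported at \<open>p\<close> if \<open>p\<close> is the upper end, and
  is the constant \<open>1\<close> on the component otherwise.\<close>

lemma (in ranked_skeleton) flow_up_dim_1:
  assumes n: "CARD('n) = 1" and p: "p \<in> skel_verts \<Gamma>"
  shows "\<exists>f. flow_up p f"
proof -
  have uniq: "q = q'" if "(s, q) \<in> skel_edges \<Gamma>" "(s, q') \<in> skel_edges \<Gamma>" for s q q'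
  proof (rule ccontr)
    assume "q \<noteq> q'"
    have "dim {axial \<Gamma> (s, q')} = DIM(real ^ 'n)"
      using axial_nonzero[OF that(2)] n by (simp add: dim_insert)
    then have "span {axial \<Gamma> (s, q')} = UNIV" by (simp only: dim_eq_full)
    then show False using nonparallel[OF that \<open>q \<noteq> q'\<close>] by blast
  qed
  have no_loop: "(s, s) \<notin> skel_edges \<Gamma>" for s
  proof
    assume s: "(s, s) \<in> skel_edges \<Gamma>"
    then have "\<xi> (axial \<Gamma> (s, s)) > 0 \<or> \<xi> (axial \<Gamma> (s, s)) < 0" using xi_nonzero by force
    then show False using rank_mono[OF s] rank_antimono[OF s] by blast
  qed
  consider (isolated) "\<And>q. (p, q) \<notin> skel_edges \<Gamma>"
    | (edge) q where "(p, q) \<in> skel_edges \<Gamma>" by blast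
  then show ?thesis
  proof cases
    case isolated
    then have "\<And>q. (q, p) \<notin> skel_edges \<Gamma>" using edge_sym by blast
    moreover have "down p = {}" using isolated by (auto simp: down_def)
    ultimately have "flow_up p (\<lambda>v. if v = p then 1 else 0)"
      using isolated p by (auto simp: flow_up_def eqcoh_iff vanishes_below_def thom_def)
    then show ?thesis by blast
  next
    case edge
    have qp: "(q, p) \<in> skel_edges \<Gamma>" by (rule edge_sym[OF edge])
    have from_p: "t = q" if "(p, t) \<in> skel_edges \<Gamma>" for t using uniq that edge by blast
    have into_p: "t = q" if "(t, p) \<in> skel_edges \<Gamma>" for t using from_p edge_sym that by blast
    show ?thesis
    proof (cases "\<xi> (axial \<Gamma> (p, q)) < 0")
      case True
      have "e = (p, q)" if "e \<in> down p" for e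
        using that from_p by (cases e) (simp add: down_def)
      moreover have "(p, q) \<in> down p" using edge True by (simp add: down_def)
      ultimately have "down p = {(p, q)}" by blast
      then have thom: "thom p = sym_vec (axial \<Gamma> (p, q))" by (simp add: thom_def)
      define f where "f v = (if v = p then sym_vec (axial \<Gamma> (p, q)) else 0)" for v
      have "f \<in> eqcoh \<Gamma>"
        unfolding eqcoh_iff
      proof (intro conjI allI impI)
        fix s t assume st: "(s, t) \<in> skel_edges \<Gamma>"
        consider "s = p" "t = q" | "s = q" "t = p" | "s \<noteq> p" "t \<noteq> p"
          using from_p into_p st by blast
        then show "sym_vec (axial \<Gamma> (s, t)) dvd f t - f s"
        proof cases
          case 2
          then show ?thesis
            using no_loop[of p] qp by (auto simp: f_def reverse[OF edge] sym_vec_uminus)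
        qed (use no_loop[of p] edge in \<open>auto simp: f_def\<close>)
      qed (use p in \<open>auto simp: f_def\<close>)
      then have "flow_up p f" by (auto simp: flow_up_def vanishes_below_def thom f_def)
      then show ?thesis by blast
    next
      case False
      then have pos: "\<xi> (axial \<Gamma> (p, q)) > 0" using xi_nonzero[OF edge] by linarith
      have "e \<notin> down p" for e
        using False from_p by (cases e) (force simp: down_def)
      then have "down p = {}" by blast
      then have thom: "thom p = 1" by (simp add: thom_def)
      have from_q: "t = p" if "(q, t) \<in> skel_edges \<Gamma>" for t using uniq that qp by blast
      have into_q: "t = p" if "(t, q) \<in> skel_edges \<Gamma>" for t using from_q edge_sym that by blast
      define f where "f v = (if v = p \<or> v = q then 1 else 0 :: 'n sym_alg)" for v
      have "f \<in> eqcoh \<Gamma>"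
        unfolding eqcoh_iff
      proof (intro conjI allI impI)
        fix s t assume st: "(s, t) \<in> skel_edges \<Gamma>"
        then have "f s = f t" using from_p from_q into_p into_q unfolding f_def by metis
        then show "sym_vec (axial \<Gamma> (s, t)) dvd f t - f s" by simp
      qed (use edge_verts[OF edge] in \<open>auto simp: f_def\<close>)
      moreover have "r p < r q" by (rule rank_mono[OF edge pos])
      ultimately have "flow_up p f" by (auto simp: flow_up_def vanishes_below_def thom f_def)
      then show ?thesis by blast
    qed
  qed
qed

section \<open>The equivalence\<close>

theorem theorem1p1:
  fixes \<Gamma> :: "('v, 'n::finite) skeleton" and d :: nat
  assumes "one_skeleton \<Gamma> d"
    and "acyclicity_axiom \<Gamma>"
  shows "morse_package \<Gamma> \<longleftrightarrow> (\<forall>\<Sigma>\<in>two_slices \<Gamma>. morse_package \<Sigma>)"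
proof
  interpret one_skeleton \<Gamma> d by (rule assms)
  assume "morse_package \<Gamma>"
  then obtain \<xi> where \<xi>: "polarizing \<Gamma> \<xi>" "acyclic_orientation \<Gamma> \<xi>" "generic \<Gamma> \<xi>"
    and free: "graded_free (eqcoh \<Gamma>) (betti \<Gamma> \<xi>)"
    unfolding morse_package_def by blast
  obtain r where r: "inj_on r (skel_verts \<Gamma>)"
    "\<And>p q. (p, q) \<in> skel_edges \<Gamma> \<Longrightarrow> \<xi> (axial \<Gamma> (p, q)) > 0 \<Longrightarrow> r p < (r q :: nat)"
    using axial.rank_exists[OF \<xi>(2)] by blast
  interpret ranked_skeleton \<Gamma> \<xi> r using \<xi>(1) r by unfold_locales
  show "\<forall>\<Sigma>\<in>two_slices \<Gamma>. morse_package \<Sigma>"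
  proof
    fix \<Sigma> assume "\<Sigma> \<in> two_slices \<Gamma>"
    then obtain H C where \<Sigma>: "\<Sigma> = \<Gamma>\<lparr>graph := C\<rparr>" "subspace H" "slice_at \<Gamma> H C"
      by (rule two_slicesE)
    interpret s: ranked_slice \<Gamma> \<xi> r H C using \<Sigma> by unfold_locales
    have "graded_free (eqcoh \<Sigma>) (betti \<Sigma> \<xi>)"
      unfolding \<Sigma>(1)
    proof (rule s.S.graded_free_if_flow_up)
      fix p assume "p \<in> skel_verts (\<Gamma>\<lparr>graph := C\<rparr>)"
      then have p: "p \<in> pverts C" by simp
      obtain f where "flow_up p f" using flow_up_if_graded_free[OF free s.slice_verts[OF p]] by blast
      then show "\<exists>f. s.S.flow_up p f" by (rule s.slice_flow_up[OF p])
    qed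
    then show "morse_package \<Sigma>"
      unfolding morse_package_def \<Sigma>(1)
      using s.slice_polarizing[OF \<xi>(1)] s.slice_acyclic_orientation[OF \<xi>(2)] s.slice_generic[OF \<xi>(3)]
      by blast
  qed
next
  interpret one_skeleton \<Gamma> d by (rule assms)
  assume slices: "\<forall>\<Sigma>\<in>two_slices \<Gamma>. morse_package \<Sigma>"
  obtain \<xi>0 where \<xi>0: "polarizing \<Gamma> \<xi>0" "acyclic_orientation \<Gamma> \<xi>0"
    using assms(2) unfolding acyclicity_axiom_def by blast
  \<comment> \<open>Acyclicity grants no genericity; the perturbed covector keeps all signs and
    hence the acyclic orientation.\<close>
  obtain \<xi> where \<xi>: "polarizing \<Gamma> \<xi>" "generic \<Gamma> \<xi>"
    and sign: "\<forall>e\<in>skel_edges \<Gamma>. \<xi> (axial \<Gamma> e) > 0 \<longleftrightarrow> \<xi>0 (axial \<Gamma> e) > 0"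
    using axial.generic_exists[OF \<xi>0(1)] by blast
  have "{e \<in> skel_edges \<Gamma>. \<xi> (axial \<Gamma> e) > 0} = {e \<in> skel_edges \<Gamma>. \<xi>0 (axial \<Gamma> e) > 0}"
    using sign by blast
  then have acyc: "acyclic_orientation \<Gamma> \<xi>" using \<xi>0(2) by (simp only: acyclic_orientation_def)
  obtain r where r: "inj_on r (skel_verts \<Gamma>)"
    "\<And>p q. (p, q) \<in> skel_edges \<Gamma> \<Longrightarrow> \<xi> (axial \<Gamma> (p, q)) > 0 \<Longrightarrow> r p < (r q :: nat)"
    using axial.rank_exists[OF acyc] by blast
  interpret ranked_skeleton \<Gamma> \<xi> r using \<xi>(1) r by unfold_locales
  have ample: "ample (leading p)" if p: "p \<in> skel_verts \<Gamma>" for p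
    unfolding ample_def
  proof (intro allI impI)
    fix H :: "(real ^ 'n) set" assume H: "subspace H" "dim H = 2"
    show "\<exists>u\<in>leading p. vec_prod H u"
    proof (cases "\<exists>q. (p, q) \<in> skel_edges \<Gamma> \<and> axial \<Gamma> (p, q) \<in> H")
      case True
      then obtain C where C: "\<Gamma>\<lparr>graph := C\<rparr> \<in> two_slices \<Gamma>" "slice_at \<Gamma> H C" "p \<in> pverts C"
        using slice_through_edge[OF H] by blast
      interpret s: ranked_slice \<Gamma> \<xi> r H C using H C by unfold_locales
      interpret c: conn_skeleton "\<Gamma>\<lparr>graph := C\<rparr>" by (rule conn_skeleton_slice[OF H(1) C(2)])
      have "morse_package (\<Gamma>\<lparr>graph := C\<rparr>)" using slices C(1) by blast
      then obtain \<xi>' where \<xi>': "polarizing (\<Gamma>\<lparr>graph := C\<rparr>) \<xi>'"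
        and free: "graded_free (eqcoh (\<Gamma>\<lparr>graph := C\<rparr>)) (betti (\<Gamma>\<lparr>graph := C\<rparr>) \<xi>')"
        unfolding morse_package_def by blast
      \<comment> \<open>The package of the slice speaks of its own \<open>\<xi>'\<close>; flow-up
        classes for the common order need the Betti numbers of \<open>\<xi>\<close>.\<close>
      have "betti (\<Gamma>\<lparr>graph := C\<rparr>) \<xi>' = betti (\<Gamma>\<lparr>graph := C\<rparr>) \<xi>"
        using c.betti_invariant[OF \<xi>' s.slice_polarizing[OF \<xi>(1)]] by blast
      then have "graded_free (eqcoh (\<Gamma>\<lparr>graph := C\<rparr>)) (betti (\<Gamma>\<lparr>graph := C\<rparr>) \<xi>)"
        using free by simp
      then obtain f where "s.S.flow_up p f"
        using s.S.flow_up_if_graded_free[of p] C(3) by auto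
      then show ?thesis by (rule s.leading_avoids[OF C(3)])
    next
      case False
      \<comment> \<open>With no edge at \<open>p\<close> in \<open>H\<close> the lone vertex serves
        as slice: its Thom value is \<open>1\<close>, and so is its flow-up class at
        \<open>p\<close>.\<close>
      define C where "C = \<lparr>pverts = {p}, parcs = {}\<rparr>"
      have C: "pverts C = {p}" "parcs C = {}" by (simp_all add: C_def)
      have "slice_at \<Gamma> H C" using False p by (auto simp: slice_at_def C)
      then interpret s: ranked_slice \<Gamma> \<xi> r H C using H by unfold_locales
      have "s.S.flow_up p (\<lambda>v. if v = p then 1 else 0)"
        by (auto simp: s.S.flow_up_def s.S.eqcoh_iff s.S.vanishes_below_def s.S.thom_def s.S.down_def C)
      then show ?thesis by (intro s.leading_avoids) (simp_all add: C)
    qed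
  qed
  have "\<exists>f. flow_up p f" if "p \<in> skel_verts \<Gamma>" for p
  proof (cases "CARD('n) \<ge> 2")
    case True
    \<comment> \<open>Induction from the top vertex downwards: ampleness yields a class at
      \<open>p\<close> once all higher vertices have theirs.\<close>
    define m where "m p = Max (r ` skel_verts \<Gamma>) - r p" for p
    have r_le: "r q \<le> Max (r ` skel_verts \<Gamma>)" if "q \<in> skel_verts \<Gamma>" for q
      using finite_verts that by simp
    show ?thesis using that
    proof (induction "m p" arbitrary: p rule: less_induct)
      case less
      show ?case
      proof (rule flow_up_if_ample[OF True less.prems _ ample[OF less.prems]])
        fix q assume q: "q \<in> skel_verts \<Gamma>" "r p < r q"
        then have "m q < m p" unfolding m_def using r_le[OF q(1)] by linarith
        then show "\<exists>f. flow_up q f" using less.hyps q(1) by blast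
      qed
    qed
  next
    case False
    moreover have "CARD('n) > 0" by simp
    ultimately have "CARD('n) = 1" by linarith
    then show ?thesis using flow_up_dim_1 that by blast
  qed
  then have "graded_free (eqcoh \<Gamma>) (betti \<Gamma> \<xi>)" by (rule graded_free_if_flow_up)
  then show "morse_package \<Gamma>"
    unfolding morse_package_def using \<xi> acyc by blast
qed

end
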